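(* Let $\mathbb{D}$ be a triangulated derivator (defined on the $2$-category of small categories), and let $\mathcal{S}$ be a set of compact objects of $\mathbb{D}(e)$. Then: 1) the smallest full subcategory $\mathrm{Susp}_{\mathbb{D}(e)}(\mathcal{S})$ of $\mathbb{D}(e)$ containing $\mathcal{S}$ and closed under extensions, positive shifts and small coproducts is a left aisle; 2) every object of $\mathrm{Susp}_{\mathbb{D}(e)}(\mathcal{S})$ is the Milnor colimit of a sequence $X_0\to X_1\to X_2\to\cdots$ where $X_i$ is an $i$-fold extension of small coproducts of non negative shifts of objects of $\mathcal{S}$.
   Context: Triangulated derivators are in the sense of Cisinski–Neeman ("Additivity for derivator K-theory"); $e$ is the one-point category and $\mathbb{D}(e)$ is the base triangulated category, with shift $\Sigma$ and small coproducts. Non negative shifts are $\Sigma^n$ with $n\geq 0$. An object $S$ is compact if $\mathrm{Hom}(S,?)$ commutes with small coproducts. A left aisle in a triangulated category $\mathcal{D}$ is a full subcategory $\mathcal{U}$ containing a zero object, closed under $\Sigma$ and under extensions, and such that the inclusion $\mathcal{U}\to\mathcal{D}$ admits a right adjoint. $i$-fold extensions: writing $\mathcal{P}$ for the class of small coproducts of non negative shifts of objects of $\mathcal{S}$, a $0$-fold extension is an object of $\mathcal{P}$, and an $(i+1)$-fold extension is an object $E$ fitting in a triangle $E'\to E\to P\to\Sigma E'$ with $E'$ an $i$-fold extension and $P\in\mathcal{P}$. The Milnor colimit $\mathrm{Mcolim}_{n\geq 0}L_n$ of a sequence $L_0\xrightarrow{f_0}L_1\xrightarrow{f_1}\cdots$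 is the object, unique up to non-unique isomorphism, fitting into a triangle $\coprod_{n\geq 0}L_n\xrightarrow{\mathbf{1}-\sigma}\coprod_{n\geq 0}L_n\to\mathrm{Mcolim}_{n\geq 0}L_n\to\Sigma\coprod_{n\geq 0}L_n$, where $\sigma$ has components $L_n\xrightarrow{f_n}L_{n+1}\xrightarrow{\mathrm{can}}\coprod_{n\geq 0}L_n$. *)

theory Defs
  imports "HOL-Algebra.FiniteProduct" "HOL-Library.Equipollence" "HOL-Library.Countable_Set"
begin

section \<open>Categories, functors, natural transformations\<close>

text \<open>\<^term>\<open>Cmp C g f\<close> is the composite of \<^term>\<open>f\<close> followed by \<^term>\<open>g\<close>. Functors and
  natural transformations are extensional on their source, so that the strict equations below are
  plain equalities.\<close>

record ('o, 'a) cat =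
  Ob :: "'o set"
  Ar :: "'a set"
  Dom :: "'a \<Rightarrow> 'o"
  Cod :: "'a \<Rightarrow> 'o"
  Idt :: "'o \<Rightarrow> 'a"
  Cmp :: "'a \<Rightarrow> 'a \<Rightarrow> 'a"

definition Hom :: "('o, 'a) cat \<Rightarrow> 'o \<Rightarrow> 'o \<Rightarrow> 'a set" where
  "Hom C a b = {f \<in> Ar C. Dom C f = a \<and> Cod C f = b}"

definition is_cat :: "('o, 'a) cat \<Rightarrow> bool" where
  "is_cat C \<longleftrightarrow>
     (\<forall>f\<in>Ar C. Dom C f \<in> Ob C \<and> Cod C f \<in> Ob C) \<and>
     (\<forall>a\<in>Ob C. Idt C a \<in> Hom C a a) \<and>
     (\<forall>f\<in>Ar C. \<forall>g\<in>Ar C. Cod C f = Dom C g \<longrightarrow> Cmp C g f \<in> Hom C (Dom C f) (Cod C g)) \<and>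
     (\<forall>f\<in>Ar C. Cmp C f (Idt C (Dom C f)) = f \<and> Cmp C (Idt C (Cod C f)) f = f) \<and>
     (\<forall>f\<in>Ar C. \<forall>g\<in>Ar C. \<forall>h\<in>Ar C. Cod C f = Dom C g \<longrightarrow> Cod C g = Dom C h \<longrightarrow>
        Cmp C h (Cmp C g f) = Cmp C (Cmp C h g) f)"

definition is_iso :: "('o, 'a) cat \<Rightarrow> 'a \<Rightarrow> bool" where
  "is_iso C f \<longleftrightarrow> f \<in> Ar C \<and>
     (\<exists>g\<in>Hom C (Cod C f) (Dom C f). Cmp C g f = Idt C (Dom C f) \<and> Cmp C f g = Idt C (Cod C f))"

definition op_cat :: "('o, 'a) cat \<Rightarrow> ('o, 'a) cat" where
  "op_cat C = \<lparr>Ob = Ob C, Ar = Ar C, Dom = Cod C, Cod = Dom C, Idt = Idt C,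
     Cmp = (\<lambda>g f. Cmp C f g)\<rparr>"

definition full_sub :: "('o, 'a) cat \<Rightarrow> 'o set \<Rightarrow> ('o, 'a) cat" where
  "full_sub C U = \<lparr>Ob = U, Ar = {f \<in> Ar C. Dom C f \<in> U \<and> Cod C f \<in> U}, Dom = Dom C, Cod = Cod C,
     Idt = Idt C, Cmp = Cmp C\<rparr>"

record ('o, 'a, 'p, 'b) fct =
  Src :: "('o, 'a) cat"
  Tgt :: "('p, 'b) cat"
  FO :: "'o \<Rightarrow> 'p"
  FA :: "'a \<Rightarrow> 'b"

definition mk_fct ::
  "('o, 'a) cat \<Rightarrow> ('p, 'b) cat \<Rightarrow> ('o \<Rightarrow> 'p) \<Rightarrow> ('a \<Rightarrow> 'b) \<Rightarrow> ('o, 'a, 'p, 'b) fct" where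
  "mk_fct C D F G = \<lparr>Src = C, Tgt = D, FO = restrict F (Ob C), FA = restrict G (Ar C)\<rparr>"

definition is_fct :: "('o, 'a, 'p, 'b) fct \<Rightarrow> bool" where
  "is_fct F \<longleftrightarrow> is_cat (Src F) \<and> is_cat (Tgt F) \<and>
     FO F \<in> Ob (Src F) \<rightarrow>\<^sub>E Ob (Tgt F) \<and> FA F \<in> extensional (Ar (Src F)) \<and>
     (\<forall>f\<in>Ar (Src F). FA F f \<in> Hom (Tgt F) (FO F (Dom (Src F) f)) (FO F (Cod (Src F) f))) \<and>
     (\<forall>a\<in>Ob (Src F). FA F (Idt (Src F) a) = Idt (Tgt F) (FO F a)) \<and>
     (\<forall>f\<in>Ar (Src F). \<forall>g\<in>Ar (Src F). Cod (Src F) f = Dom (Src F) g \<longrightarrow>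
        FA F (Cmp (Src F) g f) = Cmp (Tgt F) (FA F g) (FA F f))"

definition id_fct :: "('o, 'a) cat \<Rightarrow> ('o, 'a, 'o, 'a) fct" where
  "id_fct C = mk_fct C C (\<lambda>a. a) (\<lambda>f. f)"

definition comp_fct ::
  "('p, 'b, 'q, 'c) fct \<Rightarrow> ('o, 'a, 'p, 'b) fct \<Rightarrow> ('o, 'a, 'q, 'c) fct" where
  "comp_fct G F = mk_fct (Src F) (Tgt G) (\<lambda>a. FO G (FO F a)) (\<lambda>f. FA G (FA F f))"

definition incl_fct :: "('o, 'a) cat \<Rightarrow> 'o set \<Rightarrow> ('o, 'a, 'o, 'a) fct" where
  "incl_fct C U = mk_fct (full_sub C U) C (\<lambda>a. a) (\<lambda>f. f)"

record ('o, 'a, 'p, 'b) ntr =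
  NSrc :: "('o, 'a, 'p, 'b) fct"
  NTgt :: "('o, 'a, 'p, 'b) fct"
  NC :: "'o \<Rightarrow> 'b"

definition mk_ntr ::
  "('o, 'a, 'p, 'b) fct \<Rightarrow> ('o, 'a, 'p, 'b) fct \<Rightarrow> ('o \<Rightarrow> 'b) \<Rightarrow> ('o, 'a, 'p, 'b) ntr" where
  "mk_ntr F G t = \<lparr>NSrc = F, NTgt = G, NC = restrict t (Ob (Src F))\<rparr>"

definition is_ntr :: "('o, 'a, 'p, 'b) ntr \<Rightarrow> bool" where
  "is_ntr t \<longleftrightarrow> is_fct (NSrc t) \<and> is_fct (NTgt t) \<and>
     Src (NSrc t) = Src (NTgt t) \<and> Tgt (NSrc t) = Tgt (NTgt t) \<and>
     NC t \<in> extensional (Ob (Src (NSrc t))) \<and>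
     (\<forall>a\<in>Ob (Src (NSrc t)). NC t a \<in> Hom (Tgt (NSrc t)) (FO (NSrc t) a) (FO (NTgt t) a)) \<and>
     (\<forall>f\<in>Ar (Src (NSrc t)).
        Cmp (Tgt (NSrc t)) (NC t (Cod (Src (NSrc t)) f)) (FA (NSrc t) f) =
        Cmp (Tgt (NSrc t)) (FA (NTgt t) f) (NC t (Dom (Src (NSrc t)) f)))"

definition id_ntr :: "('o, 'a, 'p, 'b) fct \<Rightarrow> ('o, 'a, 'p, 'b) ntr" where
  "id_ntr F = mk_ntr F F (\<lambda>a. Idt (Tgt F) (FO F a))"

definition vcomp ::
  "('o, 'a, 'p, 'b) ntr \<Rightarrow> ('o, 'a, 'p, 'b) ntr \<Rightarrow> ('o, 'a, 'p, 'b) ntr" where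
  "vcomp t s = mk_ntr (NSrc s) (NTgt t) (\<lambda>a. Cmp (Tgt (NSrc s)) (NC t a) (NC s a))"

definition hcomp ::
  "('p, 'b, 'q, 'c) ntr \<Rightarrow> ('o, 'a, 'p, 'b) ntr \<Rightarrow> ('o, 'a, 'q, 'c) ntr" where
  "hcomp t s = mk_ntr (comp_fct (NSrc t) (NSrc s)) (comp_fct (NTgt t) (NTgt s))
     (\<lambda>a. Cmp (Tgt (NSrc t)) (NC t (FO (NTgt s) a)) (FA (NSrc t) (NC s a)))"

definition fun_cat ::
  "('o, 'a) cat \<Rightarrow> ('p, 'b) cat \<Rightarrow> (('o, 'a, 'p, 'b) fct, ('o, 'a, 'p, 'b) ntr) cat" where
  "fun_cat C D = \<lparr>Ob = {F. is_fct F \<and> Src F = C \<and> Tgt F = D},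
     Ar = {t. is_ntr t \<and> Src (NSrc t) = C \<and> Tgt (NSrc t) = D},
     Dom = NSrc, Cod = NTgt, Idt = id_ntr, Cmp = vcomp\<rparr>"

definition prod_cat :: "'j set \<Rightarrow> ('j \<Rightarrow> ('o, 'a) cat) \<Rightarrow> ('j \<Rightarrow> 'o, 'j \<Rightarrow> 'a) cat" where
  "prod_cat J C = \<lparr>Ob = (\<Pi>\<^sub>E j\<in>J. Ob (C j)), Ar = (\<Pi>\<^sub>E j\<in>J. Ar (C j)),
     Dom = (\<lambda>f. \<lambda>j\<in>J. Dom (C j) (f j)), Cod = (\<lambda>f. \<lambda>j\<in>J. Cod (C j) (f j)),
     Idt = (\<lambda>a. \<lambda>j\<in>J. Idt (C j) (a j)), Cmp = (\<lambda>g f. \<lambda>j\<in>J. Cmp (C j) (g j) (f j))\<rparr>"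

definition full_fct :: "('o, 'a, 'p, 'b) fct \<Rightarrow> bool" where
  "full_fct F \<longleftrightarrow> (\<forall>a\<in>Ob (Src F). \<forall>b\<in>Ob (Src F).
     FA F ` Hom (Src F) a b = Hom (Tgt F) (FO F a) (FO F b))"

definition faithful_fct :: "('o, 'a, 'p, 'b) fct \<Rightarrow> bool" where
  "faithful_fct F \<longleftrightarrow> (\<forall>a\<in>Ob (Src F). \<forall>b\<in>Ob (Src F). inj_on (FA F) (Hom (Src F) a b))"

definition ess_surj :: "('o, 'a, 'p, 'b) fct \<Rightarrow> bool" where
  "ess_surj F \<longleftrightarrow> (\<forall>b\<in>Ob (Tgt F). \<exists>a\<in>Ob (Src F). \<exists>f\<in>Hom (Tgt F) (FO F a) b. is_iso (Tgt F) f)"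

definition nat_isomorphic :: "('o, 'a, 'p, 'b) fct \<Rightarrow> ('o, 'a, 'p, 'b) fct \<Rightarrow> bool" where
  "nat_isomorphic F G \<longleftrightarrow> (\<exists>t. is_ntr t \<and> NSrc t = F \<and> NTgt t = G \<and>
     (\<forall>a\<in>Ob (Src F). is_iso (Tgt F) (NC t a)))"

definition is_equivalence :: "('o, 'a, 'p, 'b) fct \<Rightarrow> bool" where
  "is_equivalence F \<longleftrightarrow> is_fct F \<and> (\<exists>G. is_fct G \<and> Src G = Tgt F \<and> Tgt G = Src F \<and>
     nat_isomorphic (comp_fct G F) (id_fct (Src F)) \<and>
     nat_isomorphic (comp_fct F G) (id_fct (Tgt F)))"

text \<open>\<^term>\<open>right_adj F R \<epsilon>\<close>: the functor \<^term>\<open>R\<close> is right adjoint to \<^term>\<open>F\<close> with counit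
  \<^term>\<open>\<epsilon>\<close>; \<^term>\<open>left_adj F L \<eta>\<close>: the functor \<^term>\<open>L\<close> is left adjoint to \<^term>\<open>F\<close> with unit
  \<^term>\<open>\<eta>\<close>.\<close>

definition right_adj ::
  "('o, 'a, 'p, 'b) fct \<Rightarrow> ('p, 'b, 'o, 'a) fct \<Rightarrow> ('p, 'b, 'p, 'b) ntr \<Rightarrow> bool" where
  "right_adj F R \<epsilon> \<longleftrightarrow> is_fct F \<and> is_fct R \<and> Src R = Tgt F \<and> Tgt R = Src F \<and>
     is_ntr \<epsilon> \<and> NSrc \<epsilon> = comp_fct F R \<and> NTgt \<epsilon> = id_fct (Tgt F) \<and>
     (\<forall>a\<in>Ob (Src F). \<forall>b\<in>Ob (Tgt F). \<forall>f\<in>Hom (Tgt F) (FO F a) b.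
        \<exists>!g. g \<in> Hom (Src F) a (FO R b) \<and> Cmp (Tgt F) (NC \<epsilon> b) (FA F g) = f)"

definition left_adj ::
  "('o, 'a, 'p, 'b) fct \<Rightarrow> ('p, 'b, 'o, 'a) fct \<Rightarrow> ('p, 'b, 'p, 'b) ntr \<Rightarrow> bool" where
  "left_adj F L \<eta> \<longleftrightarrow> is_fct F \<and> is_fct L \<and> Src L = Tgt F \<and> Tgt L = Src F \<and>
     is_ntr \<eta> \<and> NSrc \<eta> = id_fct (Tgt F) \<and> NTgt \<eta> = comp_fct F L \<and>
     (\<forall>a\<in>Ob (Src F). \<forall>b\<in>Ob (Tgt F). \<forall>f\<in>Hom (Tgt F) b (FO F a).
        \<exists>!g. g \<in> Hom (Src F) (FO L b) a \<and> Cmp (Tgt F) (FA F g) (NC \<eta> b) = f)"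

definition is_zero :: "('o, 'a) cat \<Rightarrow> 'o \<Rightarrow> bool" where
  "is_zero C z \<longleftrightarrow> z \<in> Ob C \<and> (\<forall>a\<in>Ob C. (\<exists>!f. f \<in> Hom C z a) \<and> (\<exists>!f. f \<in> Hom C a z))"

definition is_coproduct ::
  "('o, 'a) cat \<Rightarrow> 'j set \<Rightarrow> ('j \<Rightarrow> 'o) \<Rightarrow> 'o \<Rightarrow> ('j \<Rightarrow> 'a) \<Rightarrow> bool" where
  "is_coproduct C J X P \<iota> \<longleftrightarrow> P \<in> Ob C \<and> (\<forall>j\<in>J. X j \<in> Ob C \<and> \<iota> j \<in> Hom C (X j) P) \<and>
     (\<forall>Z\<in>Ob C. \<forall>f. (\<forall>j\<in>J. f j \<in> Hom C (X j) Z) \<longrightarrow>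
        (\<exists>!h. h \<in> Hom C P Z \<and> (\<forall>j\<in>J. Cmp C h (\<iota> j) = f j)))"

section \<open>Smallness and small categories\<close>

text \<open>A set is small if it has fewer elements than the type \<^typ>\<open>'u\<close>, whose cardinality is
  uncountable and regular. If it is moreover inaccessible, these are, up to bijection, the elements
  of a Grothendieck universe; that stronger closure property plays no role here.\<close>

definition regular_universe :: "'u itself \<Rightarrow> bool" where
  "regular_universe (_ :: 'u itself) \<longleftrightarrow> uncountable (UNIV :: 'u set) \<and>
     (\<forall>A :: 'u set. \<forall>B :: 'u \<Rightarrow> 'u set. A \<prec> (UNIV :: 'u set) \<longrightarrow>
        (\<forall>a\<in>A. B a \<prec> (UNIV :: 'u set)) \<longrightarrow> (\<Union>a\<in>A. B a) \<prec> (UNIV :: 'u set))"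

definition small :: "'u itself \<Rightarrow> 'b set \<Rightarrow> bool" where
  "small (_ :: 'u itself) A \<longleftrightarrow> A \<prec> (UNIV :: 'u set)"

definition locally_small :: "'u itself \<Rightarrow> ('o, 'a) cat \<Rightarrow> bool" where
  "locally_small U C \<longleftrightarrow> (\<forall>a\<in>Ob C. \<forall>b\<in>Ob C. small U (Hom C a b))"

definition has_small_coproducts :: "'u itself \<Rightarrow> ('o, 'a) cat \<Rightarrow> bool" where
  "has_small_coproducts U C \<longleftrightarrow>
     (\<forall>(J :: 'u set) X. small U J \<longrightarrow> (\<forall>j\<in>J. X j \<in> Ob C) \<longrightarrow> (\<exists>P \<iota>. is_coproduct C J X P \<iota>))"

text \<open>Objects and arrows of small categories are taken from a type closed under pairing, so that
  finite ordinals, products, sums and comma categories of small categories can be formed in it.\<close>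

datatype 'u el = At 'u | Nt (num: nat) | Pr (lft: "'u el") (rgt: "'u el")

type_synonym 'u scat = "('u el, 'u el) cat"
type_synonym 'u sfct = "('u el, 'u el, 'u el, 'u el) fct"
type_synonym 'u sntr = "('u el, 'u el, 'u el, 'u el) ntr"

definition small_cat :: "'u scat \<Rightarrow> bool" where
  "small_cat X \<longleftrightarrow> is_cat X \<and> small TYPE('u) (Ob X) \<and> small TYPE('u) (Ar X)"

definition small_fct :: "'u sfct \<Rightarrow> bool" where
  "small_fct u \<longleftrightarrow> is_fct u \<and> small_cat (Src u) \<and> small_cat (Tgt u)"

definition small_ntr :: "'u sntr \<Rightarrow> bool" where
  "small_ntr \<alpha> \<longleftrightarrow> is_ntr \<alpha> \<and> small_fct (NSrc \<alpha>) \<and> small_fct (NTgt \<alpha>)"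

text \<open>The ordered set \<open>{0 < \<dots> < n}\<close> as a category; \<open>ord_cat 0\<close> is the one-point category.\<close>

definition ord_cat :: "nat \<Rightarrow> 'u scat" where
  "ord_cat n = \<lparr>Ob = {Nt i |i. i \<le> n}, Ar = {Pr (Nt i) (Nt j) |i j. i \<le> j \<and> j \<le> n},
     Dom = lft, Cod = rgt, Idt = (\<lambda>a. Pr a a), Cmp = (\<lambda>g f. Pr (lft f) (rgt g))\<rparr>"

abbreviation pt_cat :: "'u scat" where
  "pt_cat \<equiv> ord_cat 0"

definition ord_map :: "nat \<Rightarrow> nat \<Rightarrow> (nat \<Rightarrow> nat) \<Rightarrow> 'u sfct" where
  "ord_map m n c = mk_fct (ord_cat m) (ord_cat n) (\<lambda>a. Nt (c (num a)))
     (\<lambda>f. Pr (Nt (c (num (lft f)))) (Nt (c (num (rgt f)))))"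

definition times_cat :: "'u scat \<Rightarrow> 'u scat \<Rightarrow> 'u scat" where
  "times_cat X Y = \<lparr>Ob = {Pr x y |x y. x \<in> Ob X \<and> y \<in> Ob Y},
     Ar = {Pr f g |f g. f \<in> Ar X \<and> g \<in> Ar Y},
     Dom = (\<lambda>f. Pr (Dom X (lft f)) (Dom Y (rgt f))),
     Cod = (\<lambda>f. Pr (Cod X (lft f)) (Cod Y (rgt f))),
     Idt = (\<lambda>a. Pr (Idt X (lft a)) (Idt Y (rgt a))),
     Cmp = (\<lambda>g f. Pr (Cmp X (lft g) (lft f)) (Cmp Y (rgt g) (rgt f)))\<rparr>"

definition times_fct :: "'u sfct \<Rightarrow> 'u sfct \<Rightarrow> 'u sfct" where
  "times_fct u v = mk_fct (times_cat (Src u) (Src v)) (times_cat (Tgt u) (Tgt v))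
     (\<lambda>a. Pr (FO u (lft a)) (FO v (rgt a))) (\<lambda>f. Pr (FA u (lft f)) (FA v (rgt f)))"

definition sum_cat :: "'u el set \<Rightarrow> ('u el \<Rightarrow> 'u scat) \<Rightarrow> 'u scat" where
  "sum_cat J X = \<lparr>Ob = {Pr j x |j x. j \<in> J \<and> x \<in> Ob (X j)},
     Ar = {Pr j f |j f. j \<in> J \<and> f \<in> Ar (X j)},
     Dom = (\<lambda>f. Pr (lft f) (Dom (X (lft f)) (rgt f))),
     Cod = (\<lambda>f. Pr (lft f) (Cod (X (lft f)) (rgt f))),
     Idt = (\<lambda>a. Pr (lft a) (Idt (X (lft a)) (rgt a))),
     Cmp = (\<lambda>g f. Pr (lft f) (Cmp (X (lft f)) (rgt g) (rgt f)))\<rparr>"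

definition sum_incl :: "'u el set \<Rightarrow> ('u el \<Rightarrow> 'u scat) \<Rightarrow> 'u el \<Rightarrow> 'u sfct" where
  "sum_incl J X j = mk_fct (X j) (sum_cat J X) (Pr j) (Pr j)"

definition pt :: "'u scat \<Rightarrow> 'u el \<Rightarrow> 'u sfct" where
  "pt X x = mk_fct pt_cat X (\<lambda>_. x) (\<lambda>_. Idt X x)"

definition pt_ntr :: "'u scat \<Rightarrow> 'u el \<Rightarrow> 'u sntr" where
  "pt_ntr X r = mk_ntr (pt X (Dom X r)) (pt X (Cod X r)) (\<lambda>_. r)"

definition to_pt :: "'u scat \<Rightarrow> 'u sfct" where
  "to_pt X = mk_fct X pt_cat (\<lambda>_. Nt 0) (\<lambda>_. Pr (Nt 0) (Nt 0))"

text \<open>For \<open>i \<in> I\<close>, the functor \<open>X \<rightarrow> I \<times> X\<close>, \<open>x \<mapsto> (i, x)\<close>, and, for an arrow \<open>r\<close> of \<open>I\<close>, the natural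
  transformation between two of them.\<close>

definition slot :: "'u scat \<Rightarrow> 'u scat \<Rightarrow> 'u el \<Rightarrow> 'u sfct" where
  "slot I X i = mk_fct X (times_cat I X) (\<lambda>x. Pr i x) (\<lambda>f. Pr (Idt I i) f)"

definition slot_ntr :: "'u scat \<Rightarrow> 'u scat \<Rightarrow> 'u el \<Rightarrow> 'u sntr" where
  "slot_ntr I X r = mk_ntr (slot I X (Dom I r)) (slot I X (Cod I r)) (\<lambda>x. Pr r (Idt X x))"

text \<open>For \<open>u : X \<rightarrow> Y\<close> and \<open>y \<in> Y\<close>, the category \<open>X/y\<close> of pairs \<open>(x, f : u x \<rightarrow> y)\<close> and the category
  \<open>y\X\<close> of pairs \<open>(x, f : y \<rightarrow> u x)\<close>. An arrow \<open>g : a \<rightarrow> b\<close> is stored together with its source and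
  target, as \<open>Pr (Pr a b) g\<close>.\<close>

definition comma_cat ::
  "'u scat \<Rightarrow> 'u el set \<Rightarrow> ('u el \<Rightarrow> 'u el \<Rightarrow> 'u el \<Rightarrow> bool) \<Rightarrow> 'u scat" where
  "comma_cat X A R = \<lparr>Ob = A,
     Ar = {Pr (Pr a b) g |a b g. a \<in> A \<and> b \<in> A \<and> g \<in> Hom X (lft a) (lft b) \<and> R a b g},
     Dom = (\<lambda>m. lft (lft m)), Cod = (\<lambda>m. rgt (lft m)),
     Idt = (\<lambda>a. Pr (Pr a a) (Idt X (lft a))),
     Cmp = (\<lambda>n m. Pr (Pr (lft (lft m)) (rgt (lft n))) (Cmp X (rgt n) (rgt m)))\<rparr>"

definition over_cat :: "'u sfct \<Rightarrow> 'u el \<Rightarrow> 'u scat" where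
  "over_cat u y = comma_cat (Src u)
     {Pr x f |x f. x \<in> Ob (Src u) \<and> f \<in> Hom (Tgt u) (FO u x) y}
     (\<lambda>a b g. Cmp (Tgt u) (rgt b) (FA u g) = rgt a)"

definition under_cat :: "'u sfct \<Rightarrow> 'u el \<Rightarrow> 'u scat" where
  "under_cat u y = comma_cat (Src u)
     {Pr x f |x f. x \<in> Ob (Src u) \<and> f \<in> Hom (Tgt u) y (FO u x)}
     (\<lambda>a b g. Cmp (Tgt u) (FA u g) (rgt a) = rgt b)"

definition over_proj :: "'u sfct \<Rightarrow> 'u el \<Rightarrow> 'u sfct" where
  "over_proj u y = mk_fct (over_cat u y) (Src u) lft rgt"

definition under_proj :: "'u sfct \<Rightarrow> 'u el \<Rightarrow> 'u sfct" where
  "under_proj u y = mk_fct (under_cat u y) (Src u) lft rgt"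

definition over_ntr :: "'u sfct \<Rightarrow> 'u el \<Rightarrow> 'u sntr" where
  "over_ntr u y = mk_ntr (comp_fct u (over_proj u y))
     (comp_fct (pt (Tgt u) y) (to_pt (over_cat u y))) rgt"

definition under_ntr :: "'u sfct \<Rightarrow> 'u el \<Rightarrow> 'u sntr" where
  "under_ntr u y = mk_ntr (comp_fct (pt (Tgt u) y) (to_pt (under_cat u y)))
     (comp_fct u (under_proj u y)) rgt"

text \<open>Open immersions are inclusions of sieves, closed immersions inclusions of cosieves.\<close>

definition open_immersion :: "'u sfct \<Rightarrow> bool" where
  "open_immersion j \<longleftrightarrow> small_fct j \<and> inj_on (FO j) (Ob (Src j)) \<and> full_fct j \<and> faithful_fct j \<and>
     (\<forall>r\<in>Ar (Tgt j). Cod (Tgt j) r \<in> FO j ` Ob (Src j) \<longrightarrow> Dom (Tgt j) r \<in> FO j ` Ob (Src j))"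

definition closed_immersion :: "'u sfct \<Rightarrow> bool" where
  "closed_immersion i \<longleftrightarrow> small_fct i \<and> inj_on (FO i) (Ob (Src i)) \<and> full_fct i \<and> faithful_fct i \<and>
     (\<forall>r\<in>Ar (Tgt i). Dom (Tgt i) r \<in> FO i ` Ob (Src i) \<longrightarrow> Cod (Tgt i) r \<in> FO i ` Ob (Src i))"

section \<open>Derivators\<close>

text \<open>A prederivator is a strict 2-functor from small categories to locally small categories that
  reverses both functors and natural transformations: \<open>u : X \<rightarrow> Y\<close> gives \<open>u\<^sup>* : D(Y) \<rightarrow> D(X)\<close> and
  \<open>\<alpha> : u \<Rightarrow> v\<close> gives \<open>\<alpha>\<^sup>* : v\<^sup>* \<Rightarrow> u\<^sup>*\<close>. Thus \<open>D(X)\<close> behaves like a category of presheaves on \<open>X\<close>.\<close>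

record ('u, 'o, 'm) prederivator =
  dcat :: "'u scat \<Rightarrow> ('o, 'm) cat"
  dfct :: "'u sfct \<Rightarrow> ('o, 'm, 'o, 'm) fct"
  dntr :: "'u sntr \<Rightarrow> ('o, 'm, 'o, 'm) ntr"

definition is_prederivator :: "('u, 'o, 'm) prederivator \<Rightarrow> bool" where
  "is_prederivator D \<longleftrightarrow>
     (\<forall>X. small_cat X \<longrightarrow> is_cat (dcat D X) \<and> locally_small TYPE('u) (dcat D X)) \<and>
     (\<forall>u. small_fct u \<longrightarrow>
        is_fct (dfct D u) \<and> Src (dfct D u) = dcat D (Tgt u) \<and> Tgt (dfct D u) = dcat D (Src u)) \<and>
     (\<forall>\<alpha>. small_ntr \<alpha> \<longrightarrow> is_ntr (dntr D \<alpha>) \<and>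
        NSrc (dntr D \<alpha>) = dfct D (NTgt \<alpha>) \<and> NTgt (dntr D \<alpha>) = dfct D (NSrc \<alpha>)) \<and>
     (\<forall>X. small_cat X \<longrightarrow> dfct D (id_fct X) = id_fct (dcat D X)) \<and>
     (\<forall>u v. small_fct u \<longrightarrow> small_fct v \<longrightarrow> Tgt u = Src v \<longrightarrow>
        dfct D (comp_fct v u) = comp_fct (dfct D u) (dfct D v)) \<and>
     (\<forall>u. small_fct u \<longrightarrow> dntr D (id_ntr u) = id_ntr (dfct D u)) \<and>
     (\<forall>\<alpha> \<beta>. small_ntr \<alpha> \<longrightarrow> small_ntr \<beta> \<longrightarrow> NTgt \<alpha> = NSrc \<beta> \<longrightarrow>
        dntr D (vcomp \<beta> \<alpha>) = vcomp (dntr D \<alpha>) (dntr D \<beta>)) \<and>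
     (\<forall>\<alpha> \<beta>. small_ntr \<alpha> \<longrightarrow> small_ntr \<beta> \<longrightarrow> Tgt (NSrc \<alpha>) = Src (NSrc \<beta>) \<longrightarrow>
        dntr D (hcomp \<beta> \<alpha>) = hcomp (dntr D \<alpha>) (dntr D \<beta>))"

definition Der1 :: "('u, 'o, 'm) prederivator \<Rightarrow> bool" where
  "Der1 D \<longleftrightarrow> (\<forall>J X. finite J \<longrightarrow> (\<forall>j\<in>J. small_cat (X j)) \<longrightarrow>
     is_equivalence (mk_fct (dcat D (sum_cat J X)) (prod_cat J (\<lambda>j. dcat D (X j)))
       (\<lambda>A. \<lambda>j\<in>J. FO (dfct D (sum_incl J X j)) A) (\<lambda>f. \<lambda>j\<in>J. FA (dfct D (sum_incl J X j)) f)))"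

definition Der2 :: "('u, 'o, 'm) prederivator \<Rightarrow> bool" where
  "Der2 D \<longleftrightarrow> (\<forall>X. small_cat X \<longrightarrow> (\<forall>f\<in>Ar (dcat D X).
     (\<forall>x\<in>Ob X. is_iso (dcat D pt_cat) (FA (dfct D (pt X x)) f)) \<longrightarrow> is_iso (dcat D X) f))"

definition Der3 :: "('u, 'o, 'm) prederivator \<Rightarrow> bool" where
  "Der3 D \<longleftrightarrow> (\<forall>u. small_fct u \<longrightarrow>
     (\<exists>R \<epsilon>. right_adj (dfct D u) R \<epsilon>) \<and> (\<exists>L \<eta>. left_adj (dfct D u) L \<eta>))"

text \<open>Base change: with \<open>j\<close> the projection of \<open>X/y\<close> (or \<open>y\X\<close>) to \<open>X\<close> and \<open>p\<close> the functor from it to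
  the point, the morphisms \<open>y\<^sup>* u\<^sub>* \<rightarrow> p\<^sub>* j\<^sup>*\<close> and \<open>p\<^sub>! j\<^sup>* \<rightarrow> y\<^sup>* u\<^sub>!\<close> induced by the canonical 2-cell
  are invertible. Here \<open>b\<close> is the component at \<open>A\<close>, given by its adjoint transpose.\<close>

definition Der4_right :: "('u, 'o, 'm) prederivator \<Rightarrow> bool" where
  "Der4_right D \<longleftrightarrow> (\<forall>u y R \<epsilon> Q \<theta> A b.
     small_fct u \<longrightarrow> y \<in> Ob (Tgt u) \<longrightarrow> A \<in> Ob (dcat D (Src u)) \<longrightarrow>
     right_adj (dfct D u) R \<epsilon> \<longrightarrow> right_adj (dfct D (to_pt (over_cat u y))) Q \<theta> \<longrightarrow>
     b \<in> Hom (dcat D pt_cat) (FO (dfct D (pt (Tgt u) y)) (FO R A))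
             (FO Q (FO (dfct D (over_proj u y)) A)) \<longrightarrow>
     Cmp (dcat D (over_cat u y)) (NC \<theta> (FO (dfct D (over_proj u y)) A))
         (FA (dfct D (to_pt (over_cat u y))) b) =
     Cmp (dcat D (over_cat u y)) (FA (dfct D (over_proj u y)) (NC \<epsilon> A))
         (NC (dntr D (over_ntr u y)) (FO R A)) \<longrightarrow>
     is_iso (dcat D pt_cat) b)"

definition Der4_left :: "('u, 'o, 'm) prederivator \<Rightarrow> bool" where
  "Der4_left D \<longleftrightarrow> (\<forall>u y L \<eta> Q \<theta> A b.
     small_fct u \<longrightarrow> y \<in> Ob (Tgt u) \<longrightarrow> A \<in> Ob (dcat D (Src u)) \<longrightarrow>
     left_adj (dfct D u) L \<eta> \<longrightarrow> left_adj (dfct D (to_pt (under_cat u y))) Q \<theta> \<longrightarrow>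
     b \<in> Hom (dcat D pt_cat) (FO Q (FO (dfct D (under_proj u y)) A))
             (FO (dfct D (pt (Tgt u) y)) (FO L A)) \<longrightarrow>
     Cmp (dcat D (under_cat u y)) (FA (dfct D (to_pt (under_cat u y))) b)
         (NC \<theta> (FO (dfct D (under_proj u y)) A)) =
     Cmp (dcat D (under_cat u y)) (NC (dntr D (under_ntr u y)) (FO L A))
         (FA (dfct D (under_proj u y)) (NC \<eta> A)) \<longrightarrow>
     is_iso (dcat D pt_cat) b)"

definition is_derivator :: "('u, 'o, 'm) prederivator \<Rightarrow> bool" where
  "is_derivator D \<longleftrightarrow>
     is_prederivator D \<and> Der1 D \<and> Der2 D \<and> Der3 D \<and> Der4_right D \<and> Der4_left D"

text \<open>The partial diagram functor \<open>D(I \<times> X) \<rightarrow> Fun(I\<^sup>o\<^sup>p, D(X))\<close>.\<close>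

definition dia_ob ::
  "('u, 'o, 'm) prederivator \<Rightarrow> 'u scat \<Rightarrow> 'u scat \<Rightarrow> 'o \<Rightarrow> ('u el, 'u el, 'o, 'm) fct" where
  "dia_ob D I X A = mk_fct (op_cat I) (dcat D X) (\<lambda>i. FO (dfct D (slot I X i)) A)
     (\<lambda>r. NC (dntr D (slot_ntr I X r)) A)"

definition dia ::
  "('u, 'o, 'm) prederivator \<Rightarrow> 'u scat \<Rightarrow> 'u scat \<Rightarrow>
   ('o, 'm, ('u el, 'u el, 'o, 'm) fct, ('u el, 'u el, 'o, 'm) ntr) fct" where
  "dia D I X = mk_fct (dcat D (times_cat I X)) (fun_cat (op_cat I) (dcat D X)) (dia_ob D I X)
     (\<lambda>f. mk_ntr (dia_ob D I X (Dom (dcat D (times_cat I X)) f))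
                 (dia_ob D I X (Cod (dcat D (times_cat I X)) f))
                 (\<lambda>i. FA (dfct D (slot I X i)) f))"

definition strong :: "('u, 'o, 'm) prederivator \<Rightarrow> bool" where
  "strong D \<longleftrightarrow> (\<forall>X. small_cat X \<longrightarrow> full_fct (dia D (ord_cat 1) X) \<and> ess_surj (dia D (ord_cat 1) X))"

text \<open>The functors \<open>i\<^sub>*\<close>, for closed immersions, have right adjoints and the functors \<open>j\<^sub>!\<close>, for open
  immersions, have left adjoints.\<close>

definition pointed :: "('u, 'o, 'm) prederivator \<Rightarrow> bool" where
  "pointed D \<longleftrightarrow>
     (\<forall>i R \<epsilon>. closed_immersion i \<longrightarrow> right_adj (dfct D i) R \<epsilon> \<longrightarrow> (\<exists>K \<kappa>. right_adj R K \<kappa>)) \<and>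
     (\<forall>j L \<eta>. open_immersion j \<longrightarrow> left_adj (dfct D j) L \<eta> \<longrightarrow> (\<exists>K \<kappa>. left_adj L K \<kappa>))"

text \<open>Global squares are objects of \<open>D([1] \<times> [1])\<close>. By contravariance such a square starts at the
  value at \<open>(1,1)\<close> and ends at the value at \<open>(0,0)\<close>.\<close>

definition square :: "'u scat" where
  "square = times_cat (ord_cat 1) (ord_cat 1)"

abbreviation vx :: "nat \<Rightarrow> nat \<Rightarrow> 'u el" where
  "vx i j \<equiv> Pr (Nt i) (Nt j)"

definition corner_start :: "'u sfct" where
  "corner_start = incl_fct square {vx 1 1, vx 0 1, vx 1 0}"

definition corner_end :: "'u sfct" where
  "corner_end = incl_fct square {vx 0 0, vx 0 1, vx 1 0}"

definition cocartesian :: "('u, 'o, 'm) prederivator \<Rightarrow> 'o \<Rightarrow> bool" where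
  "cocartesian D A \<longleftrightarrow> A \<in> Ob (dcat D square) \<and>
     (\<exists>L \<eta> c. left_adj (dfct D corner_start) L \<eta> \<and>
        c \<in> Hom (dcat D square) (FO L (FO (dfct D corner_start) A)) A \<and>
        Cmp (dcat D (Src corner_start)) (FA (dfct D corner_start) c)
          (NC \<eta> (FO (dfct D corner_start) A)) =
        Idt (dcat D (Src corner_start)) (FO (dfct D corner_start) A) \<and>
        is_iso (dcat D square) c)"

definition cartesian :: "('u, 'o, 'm) prederivator \<Rightarrow> 'o \<Rightarrow> bool" where
  "cartesian D A \<longleftrightarrow> A \<in> Ob (dcat D square) \<and>
     (\<exists>R \<epsilon> c. right_adj (dfct D corner_end) R \<epsilon> \<and>
        c \<in> Hom (dcat D square) A (FO R (FO (dfct D corner_end) A)) \<and>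
        Cmp (dcat D (Src corner_end)) (NC \<epsilon> (FO (dfct D corner_end) A))
          (FA (dfct D corner_end) c) =
        Idt (dcat D (Src corner_end)) (FO (dfct D corner_end) A) \<and>
        is_iso (dcat D square) c)"

definition triangulated_derivator :: "('u, 'o, 'm) prederivator \<Rightarrow> bool" where
  "triangulated_derivator D \<longleftrightarrow> is_derivator D \<and> strong D \<and> pointed D \<and>
     (\<forall>A\<in>Ob (dcat D square). cartesian D A \<longleftrightarrow> cocartesian D A)"

section \<open>Triangulated categories\<close>

record ('o, 'm) triangulation =
  plus :: "'m \<Rightarrow> 'm \<Rightarrow> 'm"
  shift :: "('o, 'm, 'o, 'm) fct"
  dist :: "('m \<times> 'm \<times> 'm) set"

definition zero_ar :: "('o, 'a) cat \<Rightarrow> 'o \<Rightarrow> 'o \<Rightarrow> 'a" where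
  "zero_ar C a b = (THE f. \<exists>z g h. is_zero C z \<and> g \<in> Hom C a z \<and> h \<in> Hom C z b \<and> f = Cmp C h g)"

definition hom_grp ::
  "('o, 'm) cat \<Rightarrow> ('o, 'm) triangulation \<Rightarrow> 'o \<Rightarrow> 'o \<Rightarrow> 'm monoid" where
  "hom_grp C T a b = \<lparr>carrier = Hom C a b, monoid.mult = plus T, one = zero_ar C a b\<rparr>"

definition neg :: "('o, 'm) cat \<Rightarrow> ('o, 'm) triangulation \<Rightarrow> 'm \<Rightarrow> 'm" where
  "neg C T f = m_inv (hom_grp C T (Dom C f) (Cod C f)) f"

definition additive_cat :: "('o, 'm) cat \<Rightarrow> ('o, 'm) triangulation \<Rightarrow> bool" where
  "additive_cat C T \<longleftrightarrow> is_cat C \<and> (\<exists>z. is_zero C z) \<and>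
     (\<forall>a\<in>Ob C. \<forall>b\<in>Ob C. \<exists>P \<iota>. is_coproduct C (UNIV :: bool set) (\<lambda>k. if k then a else b) P \<iota>) \<and>
     (\<forall>a\<in>Ob C. \<forall>b\<in>Ob C. comm_group (hom_grp C T a b)) \<and>
     (\<forall>a\<in>Ob C. \<forall>b\<in>Ob C. \<forall>c\<in>Ob C. \<forall>f\<in>Hom C a b. \<forall>f'\<in>Hom C a b. \<forall>g\<in>Hom C b c. \<forall>g'\<in>Hom C b c.
        Cmp C g (plus T f f') = plus T (Cmp C g f) (Cmp C g f') \<and>
        Cmp C (plus T g g') f = plus T (Cmp C g f) (Cmp C g' f))"

definition is_triangle ::
  "('o, 'm) cat \<Rightarrow> ('o, 'm, 'o, 'm) fct \<Rightarrow> 'm \<times> 'm \<times> 'm \<Rightarrow> bool" where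
  "is_triangle C S = (\<lambda>(f, g, h). f \<in> Ar C \<and> g \<in> Ar C \<and> h \<in> Ar C \<and>
     Cod C f = Dom C g \<and> Cod C g = Dom C h \<and> Cod C h = FO S (Dom C f))"

definition triangle_hom ::
  "('o, 'm) cat \<Rightarrow> ('o, 'm, 'o, 'm) fct \<Rightarrow> 'm \<times> 'm \<times> 'm \<Rightarrow> 'm \<times> 'm \<times> 'm \<Rightarrow> 'm \<Rightarrow> 'm \<Rightarrow> 'm \<Rightarrow> bool"
  where
  "triangle_hom C S = (\<lambda>(f, g, h) (f', g', h') a b c.
     a \<in> Hom C (Dom C f) (Dom C f') \<and> b \<in> Hom C (Dom C g) (Dom C g') \<and>
     c \<in> Hom C (Dom C h) (Dom C h') \<and>
     Cmp C b f = Cmp C f' a \<and> Cmp C c g = Cmp C g' b \<and> Cmp C (FA S a) h = Cmp C h' c)"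

definition triangle_iso ::
  "('o, 'm) cat \<Rightarrow> ('o, 'm, 'o, 'm) fct \<Rightarrow> 'm \<times> 'm \<times> 'm \<Rightarrow> 'm \<times> 'm \<times> 'm \<Rightarrow> bool" where
  "triangle_iso C S t t' \<longleftrightarrow> is_triangle C S t \<and> is_triangle C S t' \<and>
     (\<exists>a b c. triangle_hom C S t t' a b c \<and> is_iso C a \<and> is_iso C b \<and> is_iso C c)"

definition triangulated_cat :: "('o, 'm) cat \<Rightarrow> ('o, 'm) triangulation \<Rightarrow> bool" where
  "triangulated_cat C T \<longleftrightarrow>
     additive_cat C T \<and>
     is_equivalence (shift T) \<and> Src (shift T) = C \<and> Tgt (shift T) = C \<and>
     (\<forall>a\<in>Ob C. \<forall>b\<in>Ob C. \<forall>f\<in>Hom C a b. \<forall>g\<in>Hom C a b.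
        FA (shift T) (plus T f g) = plus T (FA (shift T) f) (FA (shift T) g)) \<and>
     (\<forall>t\<in>dist T. is_triangle C (shift T) t) \<and>
     (\<forall>t\<in>dist T. \<forall>t'. triangle_iso C (shift T) t t' \<longrightarrow> t' \<in> dist T) \<and>
     (\<forall>a\<in>Ob C. \<forall>z. is_zero C z \<longrightarrow>
        (Idt C a, zero_ar C a z, zero_ar C z (FO (shift T) a)) \<in> dist T) \<and>
     (\<forall>f\<in>Ar C. \<exists>g h. (f, g, h) \<in> dist T) \<and>
     (\<forall>f g h. is_triangle C (shift T) (f, g, h) \<longrightarrow>
        ((f, g, h) \<in> dist T \<longleftrightarrow> (g, h, neg C T (FA (shift T) f)) \<in> dist T)) \<and>
     (\<forall>f g h f' g' h' a b. (f, g, h) \<in> dist T \<longrightarrow> (f', g', h') \<in> dist T \<longrightarrow>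
        a \<in> Hom C (Dom C f) (Dom C f') \<longrightarrow> b \<in> Hom C (Cod C f) (Cod C f') \<longrightarrow>
        Cmp C b f = Cmp C f' a \<longrightarrow>
        (\<exists>c. triangle_hom C (shift T) (f, g, h) (f', g', h') a b c)) \<and>
     (\<forall>f g i i' j j' k k'. Cod C f = Dom C g \<longrightarrow>
        (f, i, i') \<in> dist T \<longrightarrow> (g, j, j') \<in> dist T \<longrightarrow> (Cmp C g f, k, k') \<in> dist T \<longrightarrow>
        (\<exists>v w. (v, w, Cmp C (FA (shift T) i) j') \<in> dist T \<and>
           v \<in> Hom C (Cod C i) (Cod C k) \<and> w \<in> Hom C (Cod C k) (Cod C j) \<and>
           Cmp C v i = Cmp C k g \<and> Cmp C k' v = i' \<and>
           Cmp C w k = j \<and> Cmp C j' w = Cmp C (FA (shift T) f) k'))"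

section \<open>The triangulated structure on the base of a derivator\<close>

abbreviation base :: "('u, 'o, 'm) prederivator \<Rightarrow> ('o, 'm) cat" where
  "base D \<equiv> dcat D pt_cat"

abbreviation val :: "('u, 'o, 'm) prederivator \<Rightarrow> 'u scat \<Rightarrow> 'u el \<Rightarrow> 'o \<Rightarrow> 'o" where
  "val D X x A \<equiv> FO (dfct D (pt X x)) A"

abbreviation val_ar :: "('u, 'o, 'm) prederivator \<Rightarrow> 'u scat \<Rightarrow> 'u el \<Rightarrow> 'm \<Rightarrow> 'm" where
  "val_ar D X x f \<equiv> FA (dfct D (pt X x)) f"

text \<open>For an arrow \<open>r : x \<rightarrow> y\<close> of \<open>X\<close>, the morphism \<open>y\<^sup>* A \<rightarrow> x\<^sup>* A\<close>.\<close>

abbreviation edge :: "('u, 'o, 'm) prederivator \<Rightarrow> 'u scat \<Rightarrow> 'u el \<Rightarrow> 'o \<Rightarrow> 'm" where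
  "edge D X r A \<equiv> NC (dntr D (pt_ntr X r)) A"

definition suspension_square :: "('u, 'o, 'm) prederivator \<Rightarrow> 'o \<Rightarrow> bool" where
  "suspension_square D Q \<longleftrightarrow> cocartesian D Q \<and>
     is_zero (base D) (val D square (vx 0 1) Q) \<and> is_zero (base D) (val D square (vx 1 0) Q)"

text \<open>Evaluation at \<open>(1,1)\<close> is an equivalence from the category of suspension squares to \<open>D(e)\<close>, and
  the suspension functor is its inverse followed by evaluation at \<open>(0,0)\<close>. Equivalently, it is a
  functor \<open>S\<close> with natural isomorphisms \<open>\<phi> Q : (0,0)\<^sup>* Q \<rightarrow> S ((1,1)\<^sup>* Q)\<close>; the pair \<open>(S, \<phi>)\<close> is
  determined up to a unique isomorphism.\<close>

definition is_suspension ::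
  "('u, 'o, 'm) prederivator \<Rightarrow> ('o, 'm, 'o, 'm) fct \<Rightarrow> ('o \<Rightarrow> 'm) \<Rightarrow> bool" where
  "is_suspension D S \<phi> \<longleftrightarrow> is_fct S \<and> Src S = base D \<and> Tgt S = base D \<and>
     (\<forall>Q. suspension_square D Q \<longrightarrow> is_iso (base D) (\<phi> Q) \<and>
        \<phi> Q \<in> Hom (base D) (val D square (vx 0 0) Q) (FO S (val D square (vx 1 1) Q))) \<and>
     (\<forall>Q Q' f. suspension_square D Q \<longrightarrow> suspension_square D Q' \<longrightarrow>
        f \<in> Hom (dcat D square) Q Q' \<longrightarrow>
        Cmp (base D) (FA S (val_ar D square (vx 1 1) f)) (\<phi> Q) =
        Cmp (base D) (\<phi> Q') (val_ar D square (vx 0 0) f))"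

text \<open>Objects of \<open>D([2] \<times> [1])\<close> look as follows, the value at \<open>(i,j)\<close> being written \<open>ij\<close>:
  \<open>21 \<rightarrow> 11 \<rightarrow> 01\<close> in the first row, \<open>20 \<rightarrow> 10 \<rightarrow> 00\<close> in the second, and vertical arrows from the
  first row to the second. \<open>part_square c A\<close> is the square in the columns \<open>c 0\<close> and \<open>c 1\<close>.\<close>

definition strip :: "'u scat" where
  "strip = times_cat (ord_cat 2) (ord_cat 1)"

definition part_square :: "('u, 'o, 'm) prederivator \<Rightarrow> (nat \<Rightarrow> nat) \<Rightarrow> 'o \<Rightarrow> 'o" where
  "part_square D c A = FO (dfct D (times_fct (ord_map 1 2 c) (id_fct (ord_cat 1)))) A"

definition coherent_triangle :: "('u, 'o, 'm) prederivator \<Rightarrow> 'o \<Rightarrow> bool" where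
  "coherent_triangle D A \<longleftrightarrow> A \<in> Ob (dcat D strip) \<and>
     is_zero (base D) (val D strip (vx 0 1) A) \<and> is_zero (base D) (val D strip (vx 2 0) A) \<and>
     cocartesian D (part_square D (\<lambda>i. i + 1) A) \<and> cocartesian D (part_square D (\<lambda>i. i) A)"

text \<open>The triangle \<open>x \<rightarrow> y \<rightarrow> z \<rightarrow> S x\<close> of a coherent triangle, with \<open>x, y, z\<close> its values at \<open>(2,1)\<close>,
  \<open>(1,1)\<close>, \<open>(1,0)\<close>. The value at \<open>(0,0)\<close> is identified with \<open>S x\<close> by means of the outer square. An
  arrow of \<open>strip\<close> is a pair of an arrow of \<open>[2]\<close> and an arrow of \<open>[1]\<close>.\<close>

definition std_triangle ::
  "('u, 'o, 'm) prederivator \<Rightarrow> ('o \<Rightarrow> 'm) \<Rightarrow> 'o \<Rightarrow> 'm \<times> 'm \<times> 'm" where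
  "std_triangle D \<phi> A =
     (edge D strip (Pr (vx 1 2) (vx 1 1)) A,
      edge D strip (Pr (vx 1 1) (vx 0 1)) A,
      Cmp (base D) (\<phi> (part_square D (\<lambda>i. 2 * i) A)) (edge D strip (Pr (vx 0 1) (vx 0 0)) A))"

text \<open>\<open>T\<close> is the canonical triangulated structure on \<open>D(e)\<close>: the shift is the suspension functor and
  the distinguished triangles are those isomorphic to the triangle of a coherent triangle. This
  pins down \<open>T\<close> up to isomorphism; the group structure on the morphism sets carries no additional
  information, since it is unique in an additive category. That Verdier's axioms hold for these
  data, whenever \<open>D\<close> is a triangulated derivator, is a theorem of Maltsiniotis, so the first
  conjunct is no restriction on \<open>D\<close>.\<close>

definition base_triangulation ::
  "('u, 'o, 'm) prederivator \<Rightarrow> ('o, 'm) triangulation \<Rightarrow> bool" where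
  "base_triangulation D T \<longleftrightarrow> triangulated_cat (base D) T \<and>
     (\<exists>\<phi>. is_suspension D (shift T) \<phi> \<and>
        dist T = {t. \<exists>A. coherent_triangle D A \<and>
          triangle_iso (base D) (shift T) (std_triangle D \<phi> A) t})"

section \<open>Compact objects, aisles, extensions and Milnor colimits\<close>

text \<open>\<open>Hom(S, ?)\<close> commutes with small coproducts: the canonical map from the direct sum of the groups
  \<open>Hom(S, X\<^sub>j)\<close> to \<open>Hom(S, P)\<close>, for \<open>P\<close> a coproduct of the \<open>X\<^sub>j\<close>, is bijective.\<close>

definition compact_ob ::
  "'u itself \<Rightarrow> ('o, 'm) cat \<Rightarrow> ('o, 'm) triangulation \<Rightarrow> 'o \<Rightarrow> bool" where
  "compact_ob U C T S \<longleftrightarrow> S \<in> Ob C \<and>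
     (\<forall>(J :: 'u set) X P \<iota>. small U J \<longrightarrow> is_coproduct C J X P \<iota> \<longrightarrow>
        bij_betw
          (\<lambda>x. finprod (hom_grp C T S P) (\<lambda>j. Cmp C (\<iota> j) (x j)) {j \<in> J. x j \<noteq> zero_ar C S (X j)})
          {x \<in> (\<Pi>\<^sub>E j\<in>J. Hom C S (X j)). finite {j \<in> J. x j \<noteq> zero_ar C S (X j)}}
          (Hom C S P))"

definition ext_closed :: "('o, 'm) cat \<Rightarrow> ('o, 'm) triangulation \<Rightarrow> 'o set \<Rightarrow> bool" where
  "ext_closed C T V \<longleftrightarrow> (\<forall>(f, g, h)\<in>dist T. Dom C f \<in> V \<longrightarrow> Cod C g \<in> V \<longrightarrow> Cod C f \<in> V)"

definition shift_closed :: "('o, 'm) triangulation \<Rightarrow> 'o set \<Rightarrow> bool" where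
  "shift_closed T V \<longleftrightarrow> (\<forall>a\<in>V. FO (shift T) a \<in> V)"

definition coprod_closed :: "'u itself \<Rightarrow> ('o, 'm) cat \<Rightarrow> 'o set \<Rightarrow> bool" where
  "coprod_closed U C V \<longleftrightarrow> (\<forall>(J :: 'u set) X P \<iota>. small U J \<longrightarrow> (\<forall>j\<in>J. X j \<in> V) \<longrightarrow>
     is_coproduct C J X P \<iota> \<longrightarrow> P \<in> V)"

text \<open>A full subcategory is given by its set of objects.\<close>

definition Susp :: "'u itself \<Rightarrow> ('o, 'm) cat \<Rightarrow> ('o, 'm) triangulation \<Rightarrow> 'o set \<Rightarrow> 'o set" where
  "Susp U C T \<S> = \<Inter> {V. V \<subseteq> Ob C \<and> \<S> \<subseteq> V \<and>
     ext_closed C T V \<and> shift_closed T V \<and> coprod_closed U C V}"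

definition left_aisle :: "('o, 'm) cat \<Rightarrow> ('o, 'm) triangulation \<Rightarrow> 'o set \<Rightarrow> bool" where
  "left_aisle C T V \<longleftrightarrow> V \<subseteq> Ob C \<and> (\<exists>z\<in>V. is_zero C z) \<and> shift_closed T V \<and> ext_closed C T V \<and>
     (\<exists>R \<epsilon>. right_adj (incl_fct C V) R \<epsilon>)"

definition shift_coproducts ::
  "'u itself \<Rightarrow> ('o, 'm) cat \<Rightarrow> ('o, 'm) triangulation \<Rightarrow> 'o set \<Rightarrow> 'o set" where
  "shift_coproducts U C T \<S> = {P. \<exists>(J :: 'u set) X \<iota>. small U J \<and>
     (\<forall>j\<in>J. \<exists>S\<in>\<S>. \<exists>n. X j = (FO (shift T) ^^ n) S) \<and> is_coproduct C J X P \<iota>}"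

primrec fold_ext ::
  "'u itself \<Rightarrow> ('o, 'm) cat \<Rightarrow> ('o, 'm) triangulation \<Rightarrow> 'o set \<Rightarrow> nat \<Rightarrow> 'o set" where
  "fold_ext U C T \<S> 0 = shift_coproducts U C T \<S>"
| "fold_ext U C T \<S> (Suc i) = {E. \<exists>(f, g, h)\<in>dist T.
     Dom C f \<in> fold_ext U C T \<S> i \<and> Cod C f = E \<and> Cod C g \<in> shift_coproducts U C T \<S>}"

definition is_Mcolim ::
  "('o, 'm) cat \<Rightarrow> ('o, 'm) triangulation \<Rightarrow> (nat \<Rightarrow> 'o) \<Rightarrow> (nat \<Rightarrow> 'm) \<Rightarrow> 'o \<Rightarrow> bool" where
  "is_Mcolim C T L f M \<longleftrightarrow> (\<exists>Q \<iota> \<sigma> g h. is_coproduct C UNIV L Q \<iota> \<and>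
     \<sigma> \<in> Hom C Q Q \<and> (\<forall>n. Cmp C \<sigma> (\<iota> n) = Cmp C (\<iota> (Suc n)) (f n)) \<and>
     (plus T (Idt C Q) (neg C T \<sigma>), g, h) \<in> dist T \<and> Cod C g = M)"

end

theory Submission
  imports Defs
begin

text \<open>For an object \<open>M\<close>, build a tower \<open>L 0 \<rightarrow> L 1 \<rightarrow> \<dots>\<close> over \<open>M\<close>: every morphism to \<open>M\<close> from a non-negative
  shift of an object of \<open>\<S>\<close> lifts to \<open>L 0\<close>, a small coproduct of such shifts, and \<open>L (Suc i)\<close> is the
  extension of a coproduct \<open>P\<close> of such shifts by \<open>L i\<close> classified by \<open>P \<rightarrow> cone (L i \<rightarrow> M) \<rightarrow> \<Sigma> (L i)\<close>,
  where all morphisms from such shifts to the cone lift to \<open>P\<close>. Let \<open>Y\<close> be the Milnor colimit of the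
  tower, \<open>u : Y \<rightarrow> M\<close> an induced morphism and \<open>N\<close> its cone. Let \<open>A\<close> be a non-negative shift of an object
  of \<open>\<S>\<close>. By compactness a morphism \<open>A \<rightarrow> \<Sigma> Y\<close> factors through some \<open>\<Sigma> (L i)\<close>; if \<open>\<Sigma> u\<close> kills it, it
  dies in \<open>\<Sigma> (L (Suc i))\<close> by construction. As \<open>A \<rightarrow> M\<close> lifts to \<open>Y\<close>, there is no non-zero morphism from
  \<open>A\<close> to \<open>N\<close>, hence none from any object of \<open>Susp \<S>\<close>. So \<open>u\<close> is the coreflection of \<open>M\<close>, and it is
  invertible if \<open>M\<close> lies in \<open>Susp \<S>\<close>. The derivator enters only through its base, a triangulated
  category with small morphism sets.\<close>

section \<open>Categories\<close>

locale category =
  fixes C :: "('o, 'm) cat"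
  assumes is_cat: "is_cat C"
begin

abbreviation cmp :: "'m \<Rightarrow> 'm \<Rightarrow> 'm" (infixl "\<cdot>" 70) where
  "g \<cdot> f \<equiv> Cmp C g f"

lemma Dom_Ob [simp]: "f \<in> Ar C \<Longrightarrow> Dom C f \<in> Ob C"
  and Cod_Ob [simp]: "f \<in> Ar C \<Longrightarrow> Cod C f \<in> Ob C"
  using is_cat unfolding is_cat_def by auto

lemma Idt_simps [simp]:
  assumes "a \<in> Ob C"
  shows "Idt C a \<in> Ar C" "Dom C (Idt C a) = a" "Cod C (Idt C a) = a"
  using is_cat assms unfolding is_cat_def Hom_def by auto

lemma cmp_simps [simp]:
  assumes "f \<in> Ar C" "g \<in> Ar C" "Cod C f = Dom C g"
  shows "g \<cdot> f \<in> Ar C" "Dom C (g \<cdot> f) = Dom C f" "Cod C (g \<cdot> f) = Cod C g"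
  using is_cat assms unfolding is_cat_def Hom_def by auto

lemma cmp_Idt [simp]:
  "f \<in> Ar C \<Longrightarrow> Dom C f = a \<Longrightarrow> f \<cdot> Idt C a = f"
  "f \<in> Ar C \<Longrightarrow> Cod C f = a \<Longrightarrow> Idt C a \<cdot> f = f"
  using is_cat unfolding is_cat_def by auto

lemma cmp_assoc:
  assumes "f \<in> Ar C" "g \<in> Ar C" "h \<in> Ar C" "Cod C f = Dom C g" "Cod C g = Dom C h"
  shows "h \<cdot> g \<cdot> f = h \<cdot> (g \<cdot> f)"
  using is_cat assms unfolding is_cat_def by simp

lemma Hom_Ob: "f \<in> Hom C a b \<Longrightarrow> a \<in> Ob C" "f \<in> Hom C a b \<Longrightarrow> b \<in> Ob C"
  by (auto simp: Hom_def)

lemma Idt_Hom [intro]: "a \<in> Ob C \<Longrightarrow> Idt C a \<in> Hom C a a"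
  by (simp add: Hom_def)

lemma cmp_Hom [intro]: "g \<in> Hom C b c \<Longrightarrow> f \<in> Hom C a b \<Longrightarrow> g \<cdot> f \<in> Hom C a c"
  by (auto simp: Hom_def)

lemma Hom_assoc:
  "h \<in> Hom C c d \<Longrightarrow> g \<in> Hom C b c \<Longrightarrow> f \<in> Hom C a b \<Longrightarrow> h \<cdot> g \<cdot> f = h \<cdot> (g \<cdot> f)"
  by (auto simp: Hom_def cmp_assoc)

lemma Hom_Idt [simp]:
  "f \<in> Hom C a b \<Longrightarrow> f \<cdot> Idt C a = f"
  "f \<in> Hom C a b \<Longrightarrow> Idt C b \<cdot> f = f"
  by (auto simp: Hom_def)

section \<open>Isomorphisms\<close>

lemma is_isoI:
  assumes "f \<in> Hom C a b" "g \<in> Hom C b a" "g \<cdot> f = Idt C a" "f \<cdot> g = Idt C b"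
  shows "is_iso C f"
  using assms unfolding is_iso_def Hom_def by auto

lemma is_isoE:
  assumes "is_iso C f" "f \<in> Hom C a b"
  obtains g where "g \<in> Hom C b a" "g \<cdot> f = Idt C a" "f \<cdot> g = Idt C b"
  using assms unfolding is_iso_def Hom_def by auto

lemma is_iso_Idt: "a \<in> Ob C \<Longrightarrow> is_iso C (Idt C a)"
  by (rule is_isoI[OF Idt_Hom Idt_Hom]) (auto simp: Hom_def)

section \<open>Coproducts and their universal property\<close>

lemma is_coproduct_injection:
  assumes "is_coproduct C J X P \<iota>"
  shows "P \<in> Ob C" "j \<in> J \<Longrightarrow> X j \<in> Ob C" "j \<in> J \<Longrightarrow> \<iota> j \<in> Hom C (X j) P"
  using assms unfolding is_coproduct_def by auto

lemma is_coproduct_copair: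
  assumes "is_coproduct C J X P \<iota>" "Z \<in> Ob C" "\<And>j. j \<in> J \<Longrightarrow> f j \<in> Hom C (X j) Z"
  obtains h where "h \<in> Hom C P Z" "\<And>j. j \<in> J \<Longrightarrow> h \<cdot> \<iota> j = f j"
proof -
  have "\<forall>f. (\<forall>j\<in>J. f j \<in> Hom C (X j) Z) \<longrightarrow>
      (\<exists>!k. k \<in> Hom C P Z \<and> (\<forall>j\<in>J. k \<cdot> \<iota> j = f j))"
    using assms(1,2) unfolding is_coproduct_def by simp
  with assms(3) have "\<exists>!k. k \<in> Hom C P Z \<and> (\<forall>j\<in>J. k \<cdot> \<iota> j = f j)"
    by simp
  then show thesis
    using that by blast
qed

lemma is_coproduct_eqI:
  assumes P: "is_coproduct C J X P \<iota>" and h: "h \<in> Hom C P Z" "h' \<in> Hom C P Z"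
    and eq: "\<And>j. j \<in> J \<Longrightarrow> h \<cdot> \<iota> j = h' \<cdot> \<iota> j"
  shows "h = h'"
proof -
  have hom: "\<forall>j\<in>J. h \<cdot> \<iota> j \<in> Hom C (X j) Z"
    by (intro ballI cmp_Hom[OF h(1)] is_coproduct_injection(3)[OF P])
  have "\<forall>f. (\<forall>j\<in>J. f j \<in> Hom C (X j) Z) \<longrightarrow>
      (\<exists>!k. k \<in> Hom C P Z \<and> (\<forall>j\<in>J. k \<cdot> \<iota> j = f j))"
    using P Hom_Ob(2)[OF h(1)] unfolding is_coproduct_def by simp
  note spec[OF this, of "\<lambda>j. h \<cdot> \<iota> j"]
  with hom have "\<exists>!k. k \<in> Hom C P Z \<and> (\<forall>j\<in>J. k \<cdot> \<iota> j = h \<cdot> \<iota> j)"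
    by simp
  then show ?thesis
    using h eq by metis
qed

text \<open>Existence of coproducts, closure under them and compactness are formulated for index
  sets inside \<open>'u\<close>. Reindexing along a bijection carries them over to small index sets
  of other types, such as \<open>nat\<close>.\<close>

lemma is_coproduct_reindex:
  assumes e: "bij_betw e J K" and P: "is_coproduct C K X P \<iota>"
  shows "is_coproduct C J (X \<circ> e) P (\<iota> \<circ> e)"
  unfolding is_coproduct_def
proof (intro conjI ballI allI impI)
  have eJ: "e j \<in> K" if "j \<in> J" for j
    using e that by (auto simp: bij_betw_def)
  show "P \<in> Ob C"
    using is_coproduct_injection(1)[OF P] .
  show "(X \<circ> e) j \<in> Ob C" "(\<iota> \<circ> e) j \<in> Hom C ((X \<circ> e) j) P" if "j \<in> J" for j
    using is_coproduct_injection[OF P] eJ[OF that] by auto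
  fix Z f assume Z: "Z \<in> Ob C" and f: "\<forall>j\<in>J. f j \<in> Hom C ((X \<circ> e) j) Z"
  define e' where "e' = inv_into J e"
  have e': "e' k \<in> J" "e (e' k) = k" if "k \<in> K" for k
    using e that unfolding e'_def bij_betw_def by (auto simp: inv_into_into f_inv_into_f)
  have e'e: "e' (e j) = j" if "j \<in> J" for j
    using e that unfolding e'_def bij_betw_def by simp
  have "f (e' k) \<in> Hom C (X k) Z" if "k \<in> K" for k
    using f e'[OF that] by force
  then obtain h where h: "h \<in> Hom C P Z" "\<And>k. k \<in> K \<Longrightarrow> h \<cdot> \<iota> k = f (e' k)"
    using is_coproduct_copair[OF P Z, of "\<lambda>k. f (e' k)"] by metis
  show "\<exists>!h. h \<in> Hom C P Z \<and> (\<forall>j\<in>J. h \<cdot> (\<iota> \<circ> e) j = f j)"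
  proof (rule ex1I[of _ h])
    show "h \<in> Hom C P Z \<and> (\<forall>j\<in>J. h \<cdot> (\<iota> \<circ> e) j = f j)"
      using h eJ e'e by simp
    fix h' assume h': "h' \<in> Hom C P Z \<and> (\<forall>j\<in>J. h' \<cdot> (\<iota> \<circ> e) j = f j)"
    show "h' = h"
    proof (rule is_coproduct_eqI[OF P])
      fix k assume k: "k \<in> K"
      show "h' \<cdot> \<iota> k = h \<cdot> \<iota> k"
        using h(2)[OF k] h' e'[OF k] by (metis comp_apply)
    qed (use h h' in auto)
  qed
qed

section \<open>Zero objects and coreflections\<close>

lemma is_zero_Hom:
  assumes "is_zero C z" "f \<in> Hom C a b" "g \<in> Hom C a b" "a = z \<or> b = z"
  shows "f = g"
  using assms Hom_Ob[OF assms(2)] unfolding is_zero_def by metis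

text \<open>A coreflection chosen for each object separately is already a functor: the action on
  arrows is forced by the unique factorization through \<open>e\<close>, and the same uniqueness
  yields functoriality. The family \<open>e\<close> becomes the counit.\<close>

lemma right_adj_incl_fct:
  assumes V: "V \<subseteq> Ob C"
    and Y: "\<And>M. M \<in> Ob C \<Longrightarrow> Y M \<in> V \<and> e M \<in> Hom C (Y M) M"
    and univ: "\<And>M A f. M \<in> Ob C \<Longrightarrow> A \<in> V \<Longrightarrow> f \<in> Hom C A M \<Longrightarrow>
      \<exists>!g. g \<in> Hom C A (Y M) \<and> e M \<cdot> g = f"
  shows "\<exists>R \<epsilon>. right_adj (incl_fct C V) R \<epsilon>"
proof -
  define r where "r f = (THE g. g \<in> Hom C (Y (Dom C f)) (Y (Cod C f)) \<and>
    e (Cod C f) \<cdot> g = f \<cdot> e (Dom C f))" for f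
  have r: "r f \<in> Hom C (Y (Dom C f)) (Y (Cod C f))" "e (Cod C f) \<cdot> r f = f \<cdot> e (Dom C f)"
    if "f \<in> Ar C" for f
  proof -
    have f: "f \<in> Hom C (Dom C f) (Cod C f)"
      using that by (simp add: Hom_def)
    have "f \<cdot> e (Dom C f) \<in> Hom C (Y (Dom C f)) (Cod C f)"
      using cmp_Hom[OF f] Y[of "Dom C f"] that by simp
    then have "\<exists>!g. g \<in> Hom C (Y (Dom C f)) (Y (Cod C f)) \<and> e (Cod C f) \<cdot> g = f \<cdot> e (Dom C f)"
      using Y that by (intro univ) simp_all
    from theI'[OF this] show "r f \<in> Hom C (Y (Dom C f)) (Y (Cod C f))"
      "e (Cod C f) \<cdot> r f = f \<cdot> e (Dom C f)"
      unfolding r_def by auto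
  qed
  have r_eqI: "r f = g"
    if "f \<in> Hom C a b" "g \<in> Hom C (Y a) (Y b)" "e b \<cdot> g = f \<cdot> e a" for f g a b
  proof -
    have f: "f \<in> Ar C" "Dom C f = a" "Cod C f = b"
      using that(1) by (auto simp: Hom_def)
    have ab: "a \<in> Ob C" "b \<in> Ob C"
      using Hom_Ob[OF that(1)] .
    have "\<exists>!g. g \<in> Hom C (Y a) (Y b) \<and> e b \<cdot> g = f \<cdot> e a"
      using cmp_Hom[OF that(1)] Y[OF ab(1)] by (intro univ ab(2)) auto
    then show ?thesis
      using r[OF f(1)] that(2,3) unfolding f(2,3) by blast
  qed
  define S where "S = full_sub C V"
  have S: "is_cat S"
    unfolding S_def is_cat_def full_sub_def Hom_def using V by (auto simp: cmp_assoc)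
  define R where "R = mk_fct C S Y r"
  have R_simps: "Src R = C" "Tgt R = S" "\<And>a. a \<in> Ob C \<Longrightarrow> FO R a = Y a"
      "\<And>f. f \<in> Ar C \<Longrightarrow> FA R f = r f"
    unfolding R_def mk_fct_def by auto
  define I where "I = incl_fct C V"
  have I_simps: "Src I = S" "Tgt I = C" "\<And>a. a \<in> V \<Longrightarrow> FO I a = a"
      "\<And>f. f \<in> Ar S \<Longrightarrow> FA I f = f"
    unfolding I_def incl_fct_def mk_fct_def S_def full_sub_def by auto
  have S_simps: "Ob S = V" "Ar S = {f \<in> Ar C. Dom C f \<in> V \<and> Cod C f \<in> V}" "Dom S = Dom C"
      "Cod S = Cod C" "Idt S = Idt C" "Cmp S = Cmp C"
    unfolding S_def full_sub_def by auto
  have S_Hom: "Hom S a b = Hom C a b" if "a \<in> V" "b \<in> V" for a b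
    using that unfolding Hom_def S_simps by auto
  have I: "is_fct I"
    unfolding is_fct_def I_simps using S is_cat V
    by (auto simp: S_simps I_simps I_def incl_fct_def mk_fct_def Hom_def full_sub_def subset_iff)
  have R: "is_fct R"
    unfolding is_fct_def R_simps
  proof (intro conjI ballI impI)
    show "FO R \<in> Ob C \<rightarrow>\<^sub>E Ob S"
      unfolding R_def mk_fct_def S_simps using Y by auto
    show "FA R \<in> extensional (Ar C)"
      unfolding R_def mk_fct_def by auto
    show "FA R f \<in> Hom S (FO R (Dom C f)) (FO R (Cod C f))" if "f \<in> Ar C" for f
      using that r Y S_Hom by (simp add: R_simps)
    show "FA R (Idt C a) = Idt S (FO R a)" if "a \<in> Ob C" for a
    proof -
      have "r (Idt C a) = Idt C (Y a)"
        using Y[OF that] V that by (intro r_eqI[where a=a and b=a]) auto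
      then show ?thesis
        using that by (simp add: R_simps S_simps)
    qed
    show "FA R (g \<cdot> f) = Cmp S (FA R g) (FA R f)"
      if f: "f \<in> Ar C" and g: "g \<in> Ar C" and fg: "Cod C f = Dom C g" for f g
    proof -
      let ?a = "Dom C f" and ?b = "Dom C g" and ?c = "Cod C g"
      have H: "f \<in> Hom C ?a ?b" "g \<in> Hom C ?b ?c" "r f \<in> Hom C (Y ?a) (Y ?b)"
          "r g \<in> Hom C (Y ?b) (Y ?c)" "e ?a \<in> Hom C (Y ?a) ?a" "e ?b \<in> Hom C (Y ?b) ?b"
          "e ?c \<in> Hom C (Y ?c) ?c"
        using f g fg r[OF f] r[OF g] Y[of ?a] Y[of ?b] Y[of ?c] by (auto simp: Hom_def)
      have "e ?c \<cdot> (r g \<cdot> r f) = (e ?c \<cdot> r g) \<cdot> r f"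
        using Hom_assoc[OF H(7,4,3)] by simp
      also have "\<dots> = g \<cdot> e ?b \<cdot> r f"
        using r(2)[OF g] by simp
      also have "\<dots> = g \<cdot> (e ?b \<cdot> r f)"
        using Hom_assoc[OF H(2,6,3)] .
      also have "\<dots> = g \<cdot> (f \<cdot> e ?a)"
        using r(2)[OF f] fg by simp
      also have "\<dots> = g \<cdot> f \<cdot> e ?a"
        using Hom_assoc[OF H(2,1,5)] by simp
      \<comment> \<open>Both sides factor the composite of \<open>g \<cdot> f\<close> with
        \<open>e ?a\<close> through \<open>e ?c\<close>, so they agree by uniqueness.\<close>
      finally have "r (g \<cdot> f) = r g \<cdot> r f"
        using H by (intro r_eqI[where a="?a" and b="?c"]) auto
      then show ?thesis
        using f g fg by (simp add: R_simps S_simps)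
    qed
  qed (use is_cat S in auto)
  define \<epsilon> where "\<epsilon> = mk_ntr (comp_fct I R) (id_fct C) e"
  have IR: "is_fct (comp_fct I R)"
    using I R is_cat unfolding is_fct_def comp_fct_def
    by (auto simp: R_simps I_simps mk_fct_def PiE_iff Hom_def S_simps)
  have idC: "is_fct (id_fct C)"
    using is_cat unfolding is_fct_def id_fct_def mk_fct_def Hom_def by auto
  have IR_simps: "Src (comp_fct I R) = C" "Tgt (comp_fct I R) = C"
      "\<And>a. a \<in> Ob C \<Longrightarrow> FO (comp_fct I R) a = Y a"
      "\<And>f. f \<in> Ar C \<Longrightarrow> FA (comp_fct I R) f = r f"
  proof -
    show "FA (comp_fct I R) f = r f" if "f \<in> Ar C" for f
      using that r(1)[OF that] Y[of "Dom C f"] Y[of "Cod C f"] I_simps(4)[of "r f"]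
      by (simp add: comp_fct_def mk_fct_def R_simps S_simps Hom_def)
  qed (use Y in \<open>auto simp: comp_fct_def mk_fct_def R_simps I_simps\<close>)
  have \<epsilon>: "is_ntr \<epsilon>"
    unfolding is_ntr_def
  proof (intro conjI ballI)
    show "Cmp (Tgt (NSrc \<epsilon>)) (NC \<epsilon> (Cod (Src (NSrc \<epsilon>)) f)) (FA (NSrc \<epsilon>) f) =
        Cmp (Tgt (NSrc \<epsilon>)) (FA (NTgt \<epsilon>) f) (NC \<epsilon> (Dom (Src (NSrc \<epsilon>)) f))"
      if "f \<in> Ar (Src (NSrc \<epsilon>))" for f
      using that r(2)[of f] unfolding \<epsilon>_def
      by (auto simp: mk_ntr_def IR_simps id_fct_def mk_fct_def)
  qed (use IR idC Y in \<open>auto simp: \<epsilon>_def mk_ntr_def IR_simps id_fct_def mk_fct_def\<close>)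
  have "right_adj I R \<epsilon>"
    unfolding right_adj_def
  proof (intro conjI ballI)
    show "\<exists>!g. g \<in> Hom (Src I) a (FO R b) \<and> Cmp (Tgt I) (NC \<epsilon> b) (FA I g) = f"
      if "a \<in> Ob (Src I)" "b \<in> Ob (Tgt I)" "f \<in> Hom (Tgt I) (FO I a) b" for a b f
    proof -
      have *: "a \<in> V" "b \<in> Ob C" "f \<in> Hom C a b"
        using that by (auto simp: I_simps S_simps)
      have "(g \<in> Hom (Src I) a (FO R b) \<and> Cmp (Tgt I) (NC \<epsilon> b) (FA I g) = f) \<longleftrightarrow>
          (g \<in> Hom C a (Y b) \<and> e b \<cdot> g = f)" for g
        using * Y[of b] by (auto simp: I_simps R_simps S_Hom \<epsilon>_def mk_ntr_def IR_simps S_simps Hom_def)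
      then show ?thesis
        using univ[OF *(2,1,3)] by simp
    qed
  qed (use I R \<epsilon> in \<open>auto simp: I_simps R_simps \<epsilon>_def mk_ntr_def\<close>)
  then show ?thesis
    unfolding I_def by blast
qed

end

section \<open>Equivalences are fully faithful and essentially surjective\<close>

lemma nat_isomorphic_idE:
  assumes "is_fct F" "is_fct G" "Src G = Tgt F" "Tgt G = Src F"
    and "nat_isomorphic (comp_fct G F) (id_fct (Src F))"
  obtains t where "\<And>a. a \<in> Ob (Src F) \<Longrightarrow> is_iso (Src F) (t a)"
    and "\<And>a. a \<in> Ob (Src F) \<Longrightarrow> t a \<in> Hom (Src F) (FO G (FO F a)) a"
    and "\<And>a b f. f \<in> Hom (Src F) a b \<Longrightarrow>
      Cmp (Src F) (t b) (FA G (FA F f)) = Cmp (Src F) f (t a)"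
proof -
  obtain t where t: "is_ntr t" "NSrc t = comp_fct G F" "NTgt t = id_fct (Src F)"
      "\<forall>a\<in>Ob (Src F). is_iso (Src F) (NC t a)"
    using assms(4,5) unfolding nat_isomorphic_def by (auto simp: comp_fct_def mk_fct_def)
  show thesis
  proof (rule that[of "NC t"])
    show "is_iso (Src F) (NC t a)" "NC t a \<in> Hom (Src F) (FO G (FO F a)) a"
      if "a \<in> Ob (Src F)" for a
      using t that assms(4) unfolding is_ntr_def by (auto simp: comp_fct_def id_fct_def mk_fct_def)
    show "Cmp (Src F) (NC t b) (FA G (FA F f)) = Cmp (Src F) f (NC t a)"
      if "f \<in> Hom (Src F) a b" for a b f
      using t(1) that assms(4) unfolding is_ntr_def t(2,3)
      by (auto simp: comp_fct_def id_fct_def mk_fct_def Hom_def)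
  qed
qed

text \<open>Naturality recovers \<open>f\<close> from \<open>FA G (FA F f)\<close> by conjugation
  with the components of the isomorphism. Assuming a single composite to be isomorphic to the
  identity lets the lemma apply to either of two quasi-inverse functors.\<close>

lemma faithful_fct_if_retract:
  assumes F: "is_fct F" and G: "is_fct G" "Src G = Tgt F" "Tgt G = Src F"
    and iso: "nat_isomorphic (comp_fct G F) (id_fct (Src F))"
  shows "faithful_fct F"
  unfolding faithful_fct_def
proof (intro ballI inj_onI)
  interpret category "Src F"
    by unfold_locales (use F in \<open>simp add: is_fct_def\<close>)
  obtain t where t: "\<And>a. a \<in> Ob (Src F) \<Longrightarrow> is_iso (Src F) (t a)"
      "\<And>a. a \<in> Ob (Src F) \<Longrightarrow> t a \<in> Hom (Src F) (FO G (FO F a)) a"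
      "\<And>a b f. f \<in> Hom (Src F) a b \<Longrightarrow> Cmp (Src F) (t b) (FA G (FA F f)) = Cmp (Src F) f (t a)"
    using nat_isomorphic_idE[OF F G iso] by metis
  fix a b f g assume f: "f \<in> Hom (Src F) a b" and g: "g \<in> Hom (Src F) a b"
    and eq: "FA F f = FA F g" and a: "a \<in> Ob (Src F)"
  have "Cmp (Src F) f (t a) = Cmp (Src F) g (t a)"
    using t(3)[OF f] t(3)[OF g] eq by simp
  moreover obtain s where s: "s \<in> Hom (Src F) a (FO G (FO F a))" "Cmp (Src F) (t a) s = Idt (Src F) a"
    using is_isoE[OF t(1,2)[OF a]] by metis
  ultimately show "f = g"
    using Hom_assoc[OF f t(2)[OF a] s(1)] Hom_assoc[OF g t(2)[OF a] s(1)]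
      Hom_Idt(1)[OF f] Hom_Idt(1)[OF g] by metis
qed

lemma is_equivalence_properties:
  assumes "is_equivalence F"
  shows "faithful_fct F" "full_fct F" "ess_surj F"
proof -
  obtain G where F: "is_fct F" and G: "is_fct G" "Src G = Tgt F" "Tgt G = Src F"
    and iso: "nat_isomorphic (comp_fct G F) (id_fct (Src F))"
      "nat_isomorphic (comp_fct F G) (id_fct (Tgt F))"
    using assms unfolding is_equivalence_def by blast
  show "faithful_fct F"
    by (rule faithful_fct_if_retract[OF F G iso(1)])
  have G_faithful: "faithful_fct G"
    by (rule faithful_fct_if_retract[OF G(1) F]) (use G iso in simp_all)
  have F_Hom: "FA F f \<in> Hom (Tgt F) (FO F a) (FO F b)" if "f \<in> Hom (Src F) a b" for f a b
    using F that unfolding is_fct_def Hom_def by auto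
  have G_Hom: "FA G f \<in> Hom (Src F) (FO G a) (FO G b)" if "f \<in> Hom (Tgt F) a b" for f a b
    using G that unfolding is_fct_def Hom_def by auto
  have F_Ob: "FO F a \<in> Ob (Tgt F)" if "a \<in> Ob (Src F)" for a
    using F that unfolding is_fct_def by auto
  interpret category "Src F"
    by unfold_locales (use F in \<open>simp add: is_fct_def\<close>)
  obtain t where t: "\<And>a. a \<in> Ob (Src F) \<Longrightarrow> is_iso (Src F) (t a)"
      "\<And>a. a \<in> Ob (Src F) \<Longrightarrow> t a \<in> Hom (Src F) (FO G (FO F a)) a"
      "\<And>a b f. f \<in> Hom (Src F) a b \<Longrightarrow> Cmp (Src F) (t b) (FA G (FA F f)) = Cmp (Src F) f (t a)"
    using nat_isomorphic_idE[OF F G iso(1)] by metis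
  show "full_fct F"
    unfolding full_fct_def
  proof (intro ballI equalityI subsetI)
    fix a b h assume a: "a \<in> Ob (Src F)" and b: "b \<in> Ob (Src F)"
      and h: "h \<in> Hom (Tgt F) (FO F a) (FO F b)"
    obtain s where s: "s \<in> Hom (Src F) a (FO G (FO F a))" "Cmp (Src F) s (t a) = Idt (Src F) (FO G (FO F a))"
      using is_isoE[OF t(1,2)[OF a]] by metis
    obtain s' where s': "s' \<in> Hom (Src F) b (FO G (FO F b))" "Cmp (Src F) s' (t b) = Idt (Src F) (FO G (FO F b))"
      using is_isoE[OF t(1,2)[OF b]] by metis
    \<comment> \<open>The candidate for a preimage of \<open>h\<close> is \<open>FA G h\<close>,
      transported to a morphism from \<open>a\<close> to \<open>b\<close> by the components of
      \<open>t\<close>. Then \<open>G\<close> takes the same value on \<open>FA F f\<close> and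
      \<open>h\<close>, and faithfulness of \<open>G\<close> concludes.\<close>
    define f where "f = Cmp (Src F) (Cmp (Src F) (t b) (FA G h)) s"
    note tb_Gh = cmp_Hom[OF t(2)[OF b] G_Hom[OF h]]
    have f: "f \<in> Hom (Src F) a b"
      unfolding f_def by (rule cmp_Hom[OF tb_Gh s(1)])
    note GFf = G_Hom[OF F_Hom[OF f]]
    have "Cmp (Src F) (t b) (FA G (FA F f)) = Cmp (Src F) (t b) (FA G h)"
      using t(3)[OF f] Hom_assoc[OF tb_Gh s(1) t(2)[OF a]] s(2) Hom_Idt(1)[OF tb_Gh] f_def by simp
    then have "FA G (FA F f) = FA G h"
      using Hom_assoc[OF s'(1) t(2)[OF b] GFf] Hom_assoc[OF s'(1) t(2)[OF b] G_Hom[OF h]] s'(2)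
        Hom_Idt(2)[OF GFf] Hom_Idt(2)[OF G_Hom[OF h]] by simp
    then have "FA F f = h"
      using G_faithful F_Hom[OF f] h F_Ob[OF a] F_Ob[OF b] G(2) unfolding faithful_fct_def inj_on_def
      by auto
    then show "h \<in> FA F ` Hom (Src F) a b"
      using f by blast
  qed (use F_Hom in blast)
  show "ess_surj F"
    unfolding ess_surj_def
  proof
    fix b assume b: "b \<in> Ob (Tgt F)"
    obtain t where t: "\<And>a. a \<in> Ob (Tgt F) \<Longrightarrow> is_iso (Tgt F) (t a)"
        "\<And>a. a \<in> Ob (Tgt F) \<Longrightarrow> t a \<in> Hom (Tgt F) (FO F (FO G a)) a"
      using nat_isomorphic_idE[OF G(1) F] G iso(2) by metis
    have "FO G b \<in> Ob (Src F)"
      using G b unfolding is_fct_def by auto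
    then show "\<exists>a\<in>Ob (Src F). \<exists>f\<in>Hom (Tgt F) (FO F a) b. is_iso (Tgt F) f"
      using t b by blast
  qed
qed

section \<open>Triangulated categories\<close>

locale triangulated =
  fixes C :: "('o, 'm) cat" and T :: "('o, 'm) triangulation"
  assumes triangulated: "triangulated_cat C T"

sublocale triangulated \<subseteq> category C
  using triangulated unfolding triangulated_cat_def additive_cat_def by unfold_locales simp

context triangulated
begin

abbreviation add :: "'m \<Rightarrow> 'm \<Rightarrow> 'm" (infixl "\<oplus>" 65) where
  "f \<oplus> g \<equiv> plus T f g"

abbreviation uminus_ar :: "'m \<Rightarrow> 'm" ("\<ominus> _" [81] 80) where
  "\<ominus> f \<equiv> neg C T f"

abbreviation nul :: "'o \<Rightarrow> 'o \<Rightarrow> 'm" where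
  "nul \<equiv> zero_ar C"

abbreviation shO :: "'o \<Rightarrow> 'o" where
  "shO \<equiv> FO (shift T)"

abbreviation shA :: "'m \<Rightarrow> 'm" where
  "shA \<equiv> FA (shift T)"

lemma triangulatedD:
  shows "additive_cat C T"
    and "is_equivalence (shift T)" "Src (shift T) = C" "Tgt (shift T) = C"
    and "\<forall>a\<in>Ob C. \<forall>b\<in>Ob C. \<forall>f\<in>Hom C a b. \<forall>g\<in>Hom C a b. shA (f \<oplus> g) = shA f \<oplus> shA g"
    and "\<forall>t\<in>dist T. is_triangle C (shift T) t"
    and "\<forall>t\<in>dist T. \<forall>t'. triangle_iso C (shift T) t t' \<longrightarrow> t' \<in> dist T"
    and "\<forall>a\<in>Ob C. \<forall>z. is_zero C z \<longrightarrow> (Idt C a, nul a z, nul z (shO a)) \<in> dist T"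
    and "\<forall>f\<in>Ar C. \<exists>g h. (f, g, h) \<in> dist T"
    and "\<forall>f g h. is_triangle C (shift T) (f, g, h) \<longrightarrow>
      ((f, g, h) \<in> dist T \<longleftrightarrow> (g, h, \<ominus> (shA f)) \<in> dist T)"
    and "\<forall>f g h f' g' h' a b. (f, g, h) \<in> dist T \<longrightarrow> (f', g', h') \<in> dist T \<longrightarrow>
      a \<in> Hom C (Dom C f) (Dom C f') \<longrightarrow> b \<in> Hom C (Cod C f) (Cod C f') \<longrightarrow>
      b \<cdot> f = f' \<cdot> a \<longrightarrow>
      (\<exists>c. triangle_hom C (shift T) (f, g, h) (f', g', h') a b c)"
  using triangulated unfolding triangulated_cat_def by - (elim conjE, assumption)+

lemma additiveD:
  shows "\<exists>z. is_zero C z"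
    and "\<forall>a\<in>Ob C. \<forall>b\<in>Ob C. comm_group (hom_grp C T a b)"
    and "\<forall>a\<in>Ob C. \<forall>b\<in>Ob C. \<forall>c\<in>Ob C. \<forall>f\<in>Hom C a b. \<forall>f'\<in>Hom C a b.
      \<forall>g\<in>Hom C b c. \<forall>g'\<in>Hom C b c.
        g \<cdot> (f \<oplus> f') = g \<cdot> f \<oplus> g \<cdot> f' \<and> (g \<oplus> g') \<cdot> f = g \<cdot> f \<oplus> g' \<cdot> f"
  using triangulatedD(1) unfolding additive_cat_def by - (elim conjE, assumption)+

section \<open>Arithmetic in the groups of morphisms\<close>

lemma hom_grp_simps [simp]:
  "carrier (hom_grp C T a b) = Hom C a b"
  "monoid.mult (hom_grp C T a b) = plus T"
  "one (hom_grp C T a b) = nul a b"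
  by (simp_all add: hom_grp_def)

lemma comm_group_Hom: "a \<in> Ob C \<Longrightarrow> b \<in> Ob C \<Longrightarrow> comm_group (hom_grp C T a b)"
  using additiveD(2) by blast

lemma nul_Hom [simp]: "a \<in> Ob C \<Longrightarrow> b \<in> Ob C \<Longrightarrow> nul a b \<in> Hom C a b"
  using monoid.one_closed[OF group.is_monoid[OF comm_group.axioms(2)[OF comm_group_Hom]], of a b]
  by simp

lemma plus_Hom: "f \<in> Hom C a b \<Longrightarrow> g \<in> Hom C a b \<Longrightarrow> f \<oplus> g \<in> Hom C a b"
  using monoid.m_closed[OF group.is_monoid[OF comm_group.axioms(2)[OF comm_group_Hom]], of a b f g]
    Hom_Ob[of f a b] by simp

lemma plus_assoc:
  "f \<in> Hom C a b \<Longrightarrow> g \<in> Hom C a b \<Longrightarrow> h \<in> Hom C a b \<Longrightarrow> f \<oplus> g \<oplus> h = f \<oplus> (g \<oplus> h)"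
  using monoid.m_assoc[OF group.is_monoid[OF comm_group.axioms(2)[OF comm_group_Hom]], of a b f g h]
    Hom_Ob[of f a b] by simp

lemma plus_nul [simp]:
  "f \<in> Hom C a b \<Longrightarrow> f \<oplus> nul a b = f"
  "f \<in> Hom C a b \<Longrightarrow> nul a b \<oplus> f = f"
  using monoid.r_one[OF group.is_monoid[OF comm_group.axioms(2)[OF comm_group_Hom]], of a b f]
    monoid.l_one[OF group.is_monoid[OF comm_group.axioms(2)[OF comm_group_Hom]], of a b f]
    Hom_Ob[of f a b] by auto

lemma neg_Hom: "f \<in> Hom C a b \<Longrightarrow> \<ominus> f \<in> Hom C a b"
  using group.inv_closed[OF comm_group.axioms(2)[OF comm_group_Hom], of a b f]
    Hom_Ob[of f a b] unfolding neg_def by (auto simp: Hom_def)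

lemma neg_plus [simp]:
  "f \<in> Hom C a b \<Longrightarrow> f \<oplus> \<ominus> f = nul a b"
  "f \<in> Hom C a b \<Longrightarrow> \<ominus> f \<oplus> f = nul a b"
  using group.r_inv[OF comm_group.axioms(2)[OF comm_group_Hom], of a b f]
    group.l_inv[OF comm_group.axioms(2)[OF comm_group_Hom], of a b f]
    Hom_Ob[of f a b] unfolding neg_def by (auto simp: Hom_def)

lemma neg_eqI:
  assumes "f \<in> Hom C a b" "g \<in> Hom C a b" "f \<oplus> g = nul a b"
  shows "\<ominus> f = g"
proof -
  have "\<ominus> f = \<ominus> f \<oplus> (f \<oplus> g)"
    using assms neg_Hom[OF assms(1)] by simp
  also have "\<dots> = g"
    using plus_assoc[OF neg_Hom[OF assms(1)] assms(1,2)] assms by simp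
  finally show ?thesis .
qed

lemma neg_neg [simp]: "f \<in> Hom C a b \<Longrightarrow> \<ominus> (\<ominus> f) = f"
  by (rule neg_eqI[OF neg_Hom]) auto

lemma neg_inject: "f \<in> Hom C a b \<Longrightarrow> g \<in> Hom C a b \<Longrightarrow> \<ominus> f = \<ominus> g \<Longrightarrow> f = g"
  by (metis neg_neg)

lemma eq_if_diff_nul:
  assumes "f \<in> Hom C a b" "g \<in> Hom C a b" "f \<oplus> \<ominus> g = nul a b"
  shows "f = g"
  using neg_eqI[OF assms(1) neg_Hom[OF assms(2)] assms(3)] neg_inject assms by metis

text \<open>An additive map sends a neutral element to an element equal to its own double. This is
  how composition and the shift are seen to preserve zero morphisms.\<close>

lemma plus_idem_nul:
  assumes "f \<in> Hom C a b" "f \<oplus> f = f"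
  shows "f = nul a b"
proof -
  have "f \<oplus> (f \<oplus> \<ominus> f) = f \<oplus> \<ominus> f"
    using plus_assoc[OF assms(1,1) neg_Hom[OF assms(1)]] assms(2) by simp
  then show ?thesis
    using assms(1) by simp
qed

lemma neg_nul [simp]: "a \<in> Ob C \<Longrightarrow> b \<in> Ob C \<Longrightarrow> \<ominus> (nul a b) = nul a b"
  by (rule neg_eqI) auto

lemma cmp_plus:
  assumes "g \<in> Hom C b c" "f \<in> Hom C a b" "f' \<in> Hom C a b"
  shows "g \<cdot> (f \<oplus> f') = g \<cdot> f \<oplus> g \<cdot> f'"
proof -
  have "a \<in> Ob C" "b \<in> Ob C" "c \<in> Ob C"
    using assms Hom_Ob by blast+
  then show ?thesis
    using additiveD(3) assms by blast
qed

lemma plus_cmp: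
  assumes "g \<in> Hom C b c" "g' \<in> Hom C b c" "f \<in> Hom C a b"
  shows "(g \<oplus> g') \<cdot> f = g \<cdot> f \<oplus> g' \<cdot> f"
proof -
  have "a \<in> Ob C" "b \<in> Ob C" "c \<in> Ob C"
    using assms Hom_Ob by blast+
  then show ?thesis
    using additiveD(3) assms by blast
qed

lemma cmp_nul [simp]:
  assumes g: "g \<in> Hom C b c" and a: "a \<in> Ob C"
  shows "g \<cdot> nul a b = nul a c"
proof (rule plus_idem_nul)
  have n: "nul a b \<in> Hom C a b"
    using a Hom_Ob[OF g] by simp
  show "g \<cdot> nul a b \<in> Hom C a c"
    by (rule cmp_Hom[OF g n])
  show "g \<cdot> nul a b \<oplus> g \<cdot> nul a b = g \<cdot> nul a b"
    unfolding cmp_plus[OF g n n, symmetric] plus_nul(1)[OF n] by (rule refl)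
qed

lemma nul_cmp [simp]:
  assumes f: "f \<in> Hom C a b" and c: "c \<in> Ob C"
  shows "nul b c \<cdot> f = nul a c"
proof (rule plus_idem_nul)
  have n: "nul b c \<in> Hom C b c"
    using c Hom_Ob[OF f] by simp
  show "nul b c \<cdot> f \<in> Hom C a c"
    by (rule cmp_Hom[OF n f])
  show "nul b c \<cdot> f \<oplus> nul b c \<cdot> f = nul b c \<cdot> f"
    unfolding plus_cmp[OF n n f, symmetric] plus_nul(1)[OF n] by (rule refl)
qed

lemma cmp_neg:
  assumes g: "g \<in> Hom C b c" and f: "f \<in> Hom C a b"
  shows "g \<cdot> \<ominus> f = \<ominus> (g \<cdot> f)"
proof (rule neg_eqI[symmetric])
  show "g \<cdot> f \<oplus> g \<cdot> \<ominus> f = nul a c"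
    unfolding cmp_plus[OF g f neg_Hom[OF f], symmetric] neg_plus(1)[OF f]
    by (rule cmp_nul[OF g Hom_Ob(1)[OF f]])
qed (intro cmp_Hom[OF g] neg_Hom f)+

lemma neg_cmp:
  assumes g: "g \<in> Hom C b c" and f: "f \<in> Hom C a b"
  shows "\<ominus> g \<cdot> f = \<ominus> (g \<cdot> f)"
proof (rule neg_eqI[symmetric])
  show "g \<cdot> f \<oplus> \<ominus> g \<cdot> f = nul a c"
    unfolding plus_cmp[OF g neg_Hom[OF g] f, symmetric] neg_plus(1)[OF g]
    by (rule nul_cmp[OF f Hom_Ob(2)[OF g]])
qed (intro cmp_Hom[OF _ f] neg_Hom g)+

section \<open>The shift as an additive self-equivalence\<close>

lemma shiftD:
  shows "shO \<in> Ob C \<rightarrow>\<^sub>E Ob C"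
    and "\<forall>f\<in>Ar C. shA f \<in> Hom C (shO (Dom C f)) (shO (Cod C f))"
    and "\<forall>a\<in>Ob C. shA (Idt C a) = Idt C (shO a)"
    and "\<forall>f\<in>Ar C. \<forall>g\<in>Ar C. Cod C f = Dom C g \<longrightarrow> shA (g \<cdot> f) = shA g \<cdot> shA f"
proof -
  have "is_fct (shift T)"
    using triangulatedD(2) unfolding is_equivalence_def by (rule conjunct1)
  note * = this[unfolded is_fct_def triangulatedD(3,4)]
  show "shO \<in> Ob C \<rightarrow>\<^sub>E Ob C"
    and "\<forall>f\<in>Ar C. shA f \<in> Hom C (shO (Dom C f)) (shO (Cod C f))"
    and "\<forall>a\<in>Ob C. shA (Idt C a) = Idt C (shO a)"
    and "\<forall>f\<in>Ar C. \<forall>g\<in>Ar C. Cod C f = Dom C g \<longrightarrow> shA (g \<cdot> f) = shA g \<cdot> shA f"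
    using * by - (elim conjE, assumption)+
qed

lemma shO_Ob [simp]: "a \<in> Ob C \<Longrightarrow> shO a \<in> Ob C"
  by (rule PiE_mem[OF shiftD(1)])

lemma shA_Hom: "f \<in> Hom C a b \<Longrightarrow> shA f \<in> Hom C (shO a) (shO b)"
  using shiftD(2) by (auto simp: Hom_def)

lemma shA_Idt [simp]: "a \<in> Ob C \<Longrightarrow> shA (Idt C a) = Idt C (shO a)"
  using shiftD(3) by blast

lemma shA_cmp: "g \<in> Hom C b c \<Longrightarrow> f \<in> Hom C a b \<Longrightarrow> shA (g \<cdot> f) = shA g \<cdot> shA f"
  using shiftD(4) by (auto simp: Hom_def)

lemma shA_inject:
  assumes f: "f \<in> Hom C a b" and "g \<in> Hom C a b" "shA f = shA g"
  shows "f = g"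
proof -
  have "\<forall>a\<in>Ob C. \<forall>b\<in>Ob C. inj_on shA (Hom C a b)"
    using is_equivalence_properties(1)[OF triangulatedD(2)]
    unfolding faithful_fct_def triangulatedD(3) .
  then have "inj_on shA (Hom C a b)"
    using Hom_Ob[OF f] by simp
  then show ?thesis
    using assms by (simp add: inj_onD)
qed

lemma shA_full:
  assumes h: "h \<in> Hom C (shO a) (shO b)" and ab: "a \<in> Ob C" "b \<in> Ob C"
  obtains f where "f \<in> Hom C a b" "shA f = h"
proof -
  have "\<forall>a\<in>Ob C. \<forall>b\<in>Ob C. shA ` Hom C a b = Hom C (shO a) (shO b)"
    using is_equivalence_properties(2)[OF triangulatedD(2)]
    unfolding full_fct_def triangulatedD(3,4) .
  then have "h \<in> shA ` Hom C a b"
    using h ab by simp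
  then show thesis
    using that by auto
qed

lemma desuspension:
  assumes "b \<in> Ob C"
  obtains a f where "a \<in> Ob C" "f \<in> Hom C (shO a) b" "is_iso C f"
proof -
  have "\<forall>b\<in>Ob C. \<exists>a\<in>Ob C. \<exists>f\<in>Hom C (shO a) b. is_iso C f"
    using is_equivalence_properties(3)[OF triangulatedD(2)]
    unfolding ess_surj_def triangulatedD(3,4) .
  then have "\<exists>a\<in>Ob C. \<exists>f\<in>Hom C (shO a) b. is_iso C f"
    using assms by simp
  then show thesis
    using that by auto
qed

lemma shA_plus:
  assumes f: "f \<in> Hom C a b" and g: "g \<in> Hom C a b"
  shows "shA (f \<oplus> g) = shA f \<oplus> shA g"
  using triangulatedD(5) Hom_Ob[OF f] f g by simp

lemma shA_nul [simp]:
  assumes "a \<in> Ob C" "b \<in> Ob C"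
  shows "shA (nul a b) = nul (shO a) (shO b)"
proof (rule plus_idem_nul)
  note n = nul_Hom[OF assms]
  show "shA (nul a b) \<in> Hom C (shO a) (shO b)"
    by (rule shA_Hom[OF n])
  show "shA (nul a b) \<oplus> shA (nul a b) = shA (nul a b)"
    unfolding shA_plus[OF n n, symmetric] plus_nul(1)[OF n] by (rule refl)
qed

lemma shA_neg:
  assumes f: "f \<in> Hom C a b"
  shows "shA (\<ominus> f) = \<ominus> (shA f)"
proof (rule neg_eqI[symmetric])
  show "shA f \<oplus> shA (\<ominus> f) = nul (shO a) (shO b)"
    unfolding shA_plus[OF f neg_Hom[OF f], symmetric] neg_plus(1)[OF f]
    by (rule shA_nul[OF Hom_Ob[OF f]])
qed (intro shA_Hom neg_Hom f)+


text \<open>An object is zero as soon as its identity is a zero morphism, and the shift preserves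
  identities as well as zero morphisms.\<close>

lemma is_zero_shO:
  assumes z: "is_zero C z"
  shows "is_zero C (shO z)"
proof -
  have zOb: "z \<in> Ob C"
    using z unfolding is_zero_def by simp
  have "Idt C z = nul z z"
    using is_zero_Hom[OF z Idt_Hom[OF zOb] nul_Hom[OF zOb zOb]] by simp
  then have eq: "Idt C (shO z) = nul (shO z) (shO z)"
    using shA_Idt[OF zOb] shA_nul[OF zOb zOb] by simp
  have "f = nul (shO z) a" if "f \<in> Hom C (shO z) a" for f a
    using Hom_Idt(1)[OF that] cmp_nul[OF that, of "shO z"] zOb eq by simp
  moreover have "f = nul a (shO z)" if "f \<in> Hom C a (shO z)" for f a
    using Hom_Idt(2)[OF that] nul_cmp[OF that, of "shO z"] zOb eq by simp
  ultimately show ?thesis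
    unfolding is_zero_def using zOb by (metis nul_Hom shO_Ob)
qed

section \<open>Distinguished triangles: rotation, weak kernels and cokernels, fibres\<close>

lemma dist_is_triangle: "(f, g, h) \<in> dist T \<Longrightarrow> is_triangle C (shift T) (f, g, h)"
  by (rule bspec[OF triangulatedD(6)])

lemma dist_Hom:
  assumes "(f, g, h) \<in> dist T"
  shows "f \<in> Hom C (Dom C f) (Cod C f)" "g \<in> Hom C (Cod C f) (Cod C g)"
    "h \<in> Hom C (Cod C g) (shO (Dom C f))"
  using dist_is_triangle[OF assms] by (simp_all add: is_triangle_def Hom_def)

lemma dist_rotate: "(f, g, h) \<in> dist T \<Longrightarrow> (g, h, \<ominus> (shA f)) \<in> dist T"
  by (rule iffD1[OF triangulatedD(10)[rule_format]]) (rule dist_is_triangle)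

lemma dist_rotate_back:
  assumes "f \<in> Hom C a b" "g \<in> Hom C b c" "h \<in> Hom C c (shO a)" "(g, h, \<ominus> (shA f)) \<in> dist T"
  shows "(f, g, h) \<in> dist T"
proof -
  have "is_triangle C (shift T) (f, g, h)"
    using assms(1-3) by (auto simp: is_triangle_def Hom_def)
  then show ?thesis
    by (rule iffD2[OF triangulatedD(10)[rule_format]]) (rule assms(4))
qed

lemma dist_complete:
  assumes "f \<in> Hom C a b"
  obtains c g h where "(f, g, h) \<in> dist T" "g \<in> Hom C b c" "h \<in> Hom C c (shO a)"
proof -
  have "f \<in> Ar C"
    using assms unfolding Hom_def by simp
  then obtain g h where gh: "(f, g, h) \<in> dist T"
    using triangulatedD(9) by blast
  show thesis
    by (rule that[OF gh, of "Cod C g"]) (use dist_Hom[OF gh] assms in \<open>auto simp: Hom_def\<close>)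
qed

lemma dist_morphism:
  assumes t: "(f, g, h) \<in> dist T" and t': "(f', g', h') \<in> dist T"
    and a: "a \<in> Hom C (Dom C f) (Dom C f')" and b: "b \<in> Hom C (Cod C f) (Cod C f')"
    and eq: "b \<cdot> f = f' \<cdot> a"
  obtains c where "c \<in> Hom C (Cod C g) (Cod C g')" "c \<cdot> g = g' \<cdot> b" "shA a \<cdot> h = h' \<cdot> c"
proof -
  from triangulatedD(11)[rule_format, OF t t' a b eq]
  obtain c where "triangle_hom C (shift T) (f, g, h) (f', g', h') a b c" ..
  then show thesis
    using that[of c] dist_Hom[OF t] dist_Hom[OF t'] unfolding triangle_hom_def by (auto simp: Hom_def)
qed

lemma dist_Idt:
  assumes "a \<in> Ob C" "is_zero C z"
  shows "(Idt C a, nul a z, nul z (shO a)) \<in> dist T"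
  using bspec[OF triangulatedD(8) assms(1)] assms(2) by simp

lemma is_zero_Ob: "is_zero C z \<Longrightarrow> z \<in> Ob C"
  by (simp add: is_zero_def)

lemma dist_Ob:
  assumes "(f, g, h) \<in> dist T"
  shows "Dom C f \<in> Ob C" "Cod C f \<in> Ob C" "Cod C g \<in> Ob C"
  using Hom_Ob[OF dist_Hom(1)[OF assms]] Hom_Ob[OF dist_Hom(2)[OF assms]] by auto

lemma Hom_Dom_Cod:
  assumes "f \<in> Hom C a b"
  shows "Dom C f = a" "Cod C f = b"
  using assms by (auto simp: Hom_def)

text \<open>A morphism \<open>x\<close> that kills \<open>f\<close> is the middle part of a morphism
  to the triangle \<open>0 -> Z = Z -> \<Sigma> 0\<close>; the third component of that morphism is
  the factorization.\<close>

lemma dist_weak_cokernel: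
  assumes t: "(f, g, h) \<in> dist T" and x: "x \<in> Hom C (Cod C f) Z" "x \<cdot> f = nul (Dom C f) Z"
  obtains y where "y \<in> Hom C (Cod C g) Z" "y \<cdot> g = x"
proof -
  obtain z where z: "is_zero C z"
    using additiveD(1) ..
  note zOb = is_zero_Ob[OF z] and ZOb = Hom_Ob(2)[OF x(1)] and fOb = dist_Ob(1)[OF t]
  note n = nul_Hom[OF zOb ZOb] and I = Idt_Hom[OF ZOb] and n' = nul_Hom[OF fOb zOb]
  \<comment> \<open>The zero object in the triangle of the identity is taken to be
    \<open>shO z\<close>, so that this triangle is literally a rotation of the one wanted.\<close>
  have "(Idt C Z, nul Z (shO z), \<ominus> (shA (nul z Z))) \<in> dist T"
    using dist_Idt[OF ZOb is_zero_shO[OF z]] shA_nul[OF zOb ZOb] neg_nul[OF shO_Ob[OF zOb] shO_Ob[OF ZOb]]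
    by simp
  then have t': "(nul z Z, Idt C Z, nul Z (shO z)) \<in> dist T"
    by (rule dist_rotate_back[OF n I nul_Hom[OF ZOb shO_Ob[OF zOb]]])
  have "x \<cdot> f = nul z Z \<cdot> nul (Dom C f) z"
    using x(2) cmp_nul[OF n fOb] by simp
  then obtain y where y: "y \<in> Hom C (Cod C g) Z" "y \<cdot> g = Idt C Z \<cdot> x"
    using dist_morphism[OF t t', unfolded Hom_Dom_Cod[OF n] Hom_Dom_Cod[OF I], OF n' x(1)] by blast
  show thesis
    by (rule that[OF y(1)]) (simp add: y(2) Hom_Idt(2)[OF x(1)])
qed

text \<open>The axiom on morphisms of triangles produces a third component only. Hence the triangle
  of the identity of \<open>a\<close> and the given triangle are both rotated; the new component is
  then a morphism between suspensions, and it descends because the shift is fully faithful.\<close>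

lemma dist_weak_kernel:
  assumes t: "(f, g, h) \<in> dist T" and x: "x \<in> Hom C a (Cod C f)" "g \<cdot> x = nul a (Cod C g)"
  obtains y where "y \<in> Hom C a (Dom C f)" "f \<cdot> y = x"
proof -
  obtain z where z: "is_zero C z"
    using additiveD(1) ..
  note H = dist_Hom[OF t]
  note zOb = is_zero_Ob[OF z] and aOb = Hom_Ob(1)[OF x(1)]
  note s = dist_rotate[OF dist_Idt[OF aOb z]]
  note n = nul_Hom[OF aOb zOb] and n' = nul_Hom[OF zOb dist_Ob(3)[OF t]]
    and n'' = nul_Hom[OF zOb shO_Ob[OF aOb]]
  have "nul z (Cod C g) \<cdot> nul a z = g \<cdot> x"
    using x(2) cmp_nul[OF n' aOb] by simp
  then obtain c where c: "c \<in> Hom C (shO a) (shO (Dom C f))"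
      "shA x \<cdot> \<ominus> (shA (Idt C a)) = \<ominus> (shA f) \<cdot> c"
    using dist_morphism[OF s dist_rotate[OF t], unfolded Hom_Dom_Cod[OF n] Hom_Dom_Cod[OF n'']
      Hom_Dom_Cod(1)[OF H(2)] Hom_Dom_Cod[OF H(3)], OF x(1) n'] by blast
  obtain y where y: "y \<in> Hom C a (Dom C f)" "shA y = c"
    using shA_full[OF c(1) aOb dist_Ob(1)[OF t]] .
  note fy = cmp_Hom[OF H(1) y(1)]
  have "\<ominus> (shA x) = shA x \<cdot> \<ominus> (shA (Idt C a))"
    using cmp_neg[OF shA_Hom[OF x(1)] shA_Hom[OF Idt_Hom[OF aOb]]] shA_Idt[OF aOb]
      Hom_Idt(1)[OF shA_Hom[OF x(1)]] by simp
  also have "\<dots> = \<ominus> (shA (f \<cdot> y))"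
    using c(2) y(2) neg_cmp[OF shA_Hom[OF H(1)] c(1)] shA_cmp[OF H(1) y(1)] by simp
  finally have "shA x = shA (f \<cdot> y)"
    by (rule neg_inject[OF shA_Hom[OF x(1)] shA_Hom[OF fy]])
  then have "x = f \<cdot> y"
    by (rule shA_inject[OF x(1) fy])
  then show thesis
    using that y(1) by simp
qed

text \<open>The pair consisting of an identity and \<open>f\<close> extends to a morphism from the
  triangle of \<open>Idt C (Dom C f)\<close>, whose third object is zero; so
  \<open>g \<cdot> f\<close> factors through a zero object.\<close>

lemma dist_cmp_nul:
  assumes t: "(f, g, h) \<in> dist T"
  shows "g \<cdot> f = nul (Dom C f) (Cod C g)"
proof -
  obtain z where z: "is_zero C z"
    using additiveD(1) ..
  note H = dist_Hom[OF t] and a = dist_Ob(1)[OF t]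
  note I = Idt_Hom[OF a] and n = nul_Hom[OF a is_zero_Ob[OF z]]
  obtain c where c: "c \<in> Hom C z (Cod C g)" "c \<cdot> nul (Dom C f) z = g \<cdot> f"
    using dist_morphism[OF dist_Idt[OF a z] t, unfolded Hom_Dom_Cod[OF I] Hom_Dom_Cod[OF n],
      OF I H(1) refl] .
  show ?thesis
    using cmp_nul[OF c(1) a] c(2) by simp
qed

text \<open>Here the outer components are given and the middle one is sought. After two rotations
  the middle one has become the third, up to suspension, and full faithfulness of the shift brings
  it back.\<close>

lemma dist_extend_morphism:
  assumes t: "(f, g, h) \<in> dist T" and t': "(f', g', h') \<in> dist T"
    and a: "a \<in> Hom C (Dom C f) (Dom C f')" and c: "c \<in> Hom C (Cod C g) (Cod C g')"
    and eq: "shA a \<cdot> h = h' \<cdot> c"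
  obtains b where "b \<in> Hom C (Cod C f) (Cod C f')" "b \<cdot> f = f' \<cdot> a"
proof -
  note H = dist_Hom[OF t] and H' = dist_Hom[OF t']
  note r = dist_rotate[OF dist_rotate[OF t]] and r' = dist_rotate[OF dist_rotate[OF t']]
  note nH = neg_Hom[OF shA_Hom[OF H(1)]] and nH' = neg_Hom[OF shA_Hom[OF H'(1)]]
  obtain d where d: "d \<in> Hom C (shO (Cod C f)) (shO (Cod C f'))"
      "d \<cdot> \<ominus> (shA f) = \<ominus> (shA f') \<cdot> shA a"
    using dist_morphism[OF r r', unfolded Hom_Dom_Cod[OF H(3)] Hom_Dom_Cod[OF H'(3)]
      Hom_Dom_Cod[OF nH] Hom_Dom_Cod[OF nH'], OF c shA_Hom[OF a] eq] .
  obtain b where b: "b \<in> Hom C (Cod C f) (Cod C f')" "shA b = d"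
    using shA_full[OF d(1) dist_Ob(2)[OF t] dist_Ob(2)[OF t']] .
  note bf = cmp_Hom[OF b(1) H(1)] and fa = cmp_Hom[OF H'(1) a]
  have "\<ominus> (shA (b \<cdot> f)) = \<ominus> (shA (f' \<cdot> a))"
    using d(2) b(2) shA_cmp[OF b(1) H(1)] shA_cmp[OF H'(1) a] cmp_neg[OF d(1) shA_Hom[OF H(1)]]
      neg_cmp[OF shA_Hom[OF H'(1)] shA_Hom[OF a]] by simp
  then have "shA (b \<cdot> f) = shA (f' \<cdot> a)"
    by (rule neg_inject[OF shA_Hom[OF bf] shA_Hom[OF fa]])
  then show thesis
    by (intro that[OF b(1)] shA_inject[OF bf fa])
qed

lemma dist_iso:
  assumes t: "(f, g, h) \<in> dist T" and e: "e \<in> Hom C (Cod C g) c" "is_iso C e"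
    and g': "g' \<in> Hom C (Cod C f) c" "e \<cdot> g = g'"
    and h': "h' \<in> Hom C c (shO (Dom C f))" "h' \<cdot> e = h"
  shows "(f, g', h') \<in> dist T"
proof -
  note H = dist_Hom[OF t]
  have Ob: "Dom C f \<in> Ob C" "Cod C f \<in> Ob C"
    using Hom_Ob[OF H(1)] by auto
  have "triangle_hom C (shift T) (f, g, h) (f, g', h') (Idt C (Dom C f)) (Idt C (Cod C f)) e"
    unfolding triangle_hom_def using H e g' h' Ob by (auto simp: Hom_def)
  moreover have "is_triangle C (shift T) (f, g, h)" "is_triangle C (shift T) (f, g', h')"
    unfolding is_triangle_def using H g' h' by (auto simp: Hom_def)
  ultimately have "triangle_iso C (shift T) (f, g, h) (f, g', h')"
    unfolding triangle_iso_def using is_iso_Idt Ob e by blast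
  then show ?thesis
    using t triangulatedD(7) by blast
qed

text \<open>Complete \<open>w\<close> to a triangle, replace its cone by an isomorphic suspension
  \<open>shO e\<close>, and rotate back twice. This realizes a class in
  \<open>Hom C p (shO x)\<close> by an extension of \<open>p\<close> by \<open>x\<close>.\<close>

lemma dist_fibre:
  assumes "w \<in> Hom C p (shO x)" "x \<in> Ob C"
  obtains e a b where "(a, b, w) \<in> dist T" "a \<in> Hom C x e" "b \<in> Hom C e p"
proof -
  have p: "p \<in> Ob C"
    using Hom_Ob[OF assms(1)] by simp
  obtain c g h where t: "(w, g, h) \<in> dist T" "g \<in> Hom C (shO x) c" "h \<in> Hom C c (shO p)"
    using dist_complete[OF assms(1)] .
  have c: "c \<in> Ob C"
    using Hom_Ob[OF t(2)] by simp
  obtain e k where e: "e \<in> Ob C" "k \<in> Hom C (shO e) c" "is_iso C k"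
    using desuspension[OF c] .
  obtain k' where k': "k' \<in> Hom C c (shO e)" "k' \<cdot> k = Idt C (shO e)" "k \<cdot> k' = Idt C c"
    using is_isoE[OF e(3,2)] .
  have k'_iso: "is_iso C k'"
    using is_isoI[OF k'(1) e(2) k'(3,2)] .
  have t': "(w, k' \<cdot> g, h \<cdot> k) \<in> dist T"
  proof (rule dist_iso[OF t(1) _ k'_iso])
    show "h \<cdot> k \<cdot> k' = h"
      using Hom_assoc[OF t(3) e(2) k'(1)] k'(3) t(3) by simp
  qed (use t assms k' cmp_Hom[OF k'(1) t(2)] cmp_Hom[OF t(3) e(2)] in \<open>auto simp: Hom_def\<close>)
  \<comment> \<open>The signs in the choice of \<open>a\<close> and \<open>b\<close> cancel those
    which the two rotations introduce.\<close>
  obtain a where a: "a \<in> Hom C x e" "shA a = \<ominus> (k' \<cdot> g)"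
    using shA_full[OF neg_Hom[OF cmp_Hom[OF k'(1) t(2)]] assms(2) e(1)] .
  obtain b where b: "b \<in> Hom C e p" "shA b = \<ominus> (h \<cdot> k)"
    using shA_full[OF neg_Hom[OF cmp_Hom[OF t(3) e(2)]] e(1) p] .
  have "\<ominus> (shA a) = k' \<cdot> g" "\<ominus> (shA b) = h \<cdot> k"
    unfolding a b using neg_neg cmp_Hom[OF k'(1) t(2)] cmp_Hom[OF t(3) e(2)] by auto
  then have "(b, w, \<ominus> (shA a)) \<in> dist T"
    using dist_rotate_back[OF b(1) assms(1) neg_Hom[OF shA_Hom[OF a(1)]]] t' by simp
  then have "(a, b, w) \<in> dist T"
    using dist_rotate_back[OF a(1) b(1) assms(1)] by simp
  then show thesis
    using that a b by blast
qed

end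

section \<open>Small sets\<close>

lemma small_lepoll: "B \<lesssim> A \<Longrightarrow> small U A \<Longrightarrow> small U B"
  unfolding small_def by (rule lesspoll_trans1)

lemma small_image: "small U A \<Longrightarrow> small U (f ` A)"
  by (rule small_lepoll[OF image_lepoll])

text \<open>A countable set embeds into the uncountable type \<open>'u\<close> but cannot be
  equipollent to it. This makes coproducts of sequences available.\<close>

lemma countable_small:
  assumes "regular_universe TYPE('u)" "countable A"
  shows "small TYPE('u) A"
proof -
  have unc: "uncountable (UNIV :: 'u set)"
    using assms(1) unfolding regular_universe_def by simp
  then have "(UNIV :: nat set) \<lesssim> (UNIV :: 'u set)"
    using infinite_le_lepoll uncountable_infinite by blast
  moreover have "A \<lesssim> (UNIV :: nat set)"
    using assms(2) unfolding countable_def lepoll_def by auto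
  ultimately have "A \<lesssim> (UNIV :: 'u set)"
    using lepoll_trans by blast
  moreover have "\<not> A \<approx> (UNIV :: 'u set)"
    using unc assms(2) countable_eqpoll eqpoll_sym by blast
  ultimately show ?thesis
    unfolding small_def lesspoll_def by simp
qed

lemma small_indexE:
  fixes A :: "'b set"
  assumes "small TYPE('u) A"
  obtains J :: "'u set" and e where "bij_betw e J A" "small TYPE('u) J"
proof -
  obtain f :: "'b \<Rightarrow> 'u" where "inj_on f A"
    using assms unfolding small_def lesspoll_def lepoll_def by blast
  then have f: "bij_betw f A (f ` A)"
    by (rule inj_on_imp_bij_betw)
  show thesis
    by (rule that[OF bij_betw_inv_into[OF f] small_image[OF assms]])
qed

text \<open>Regularity speaks of unions of subsets of \<open>'u\<close>. A pairing on the infinite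
  type \<open>'u\<close> embeds the disjoint sum into such a union.\<close>

lemma small_Sigma:
  fixes A :: "'b set" and B :: "'b \<Rightarrow> 'c set"
  assumes U: "regular_universe TYPE('u)" and A: "small TYPE('u) A"
    and B: "\<And>a. a \<in> A \<Longrightarrow> small TYPE('u) (B a)"
  shows "small TYPE('u) (Sigma A B)"
proof -
  have inf: "infinite (UNIV :: 'u set)"
    using uncountable_infinite[OF conjunct1[OF U[unfolded regular_universe_def]]] .
  obtain p :: "'u \<times> 'u \<Rightarrow> 'u" where "bij_betw p (UNIV \<times> UNIV) UNIV"
    using iffD2[OF card_of_ordIso card_of_Times_same_infinite[OF inf]] ..
  then have p: "inj p"
    by (simp add: bij_betw_def)
  obtain J :: "'u set" and e where e: "bij_betw e J A" and J: "small TYPE('u) J"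
    using small_indexE[OF A] .
  have "\<forall>a\<in>A. \<exists>k :: 'c \<Rightarrow> 'u. inj_on k (B a)"
    using B unfolding small_def lesspoll_def lepoll_def by blast
  then obtain k :: "'b \<Rightarrow> 'c \<Rightarrow> 'u" where k: "\<And>a. a \<in> A \<Longrightarrow> inj_on (k a) (B a)"
    by metis
  \<comment> \<open>A copy of the fibre over \<open>e j\<close> inside \<open>'u\<close>, tagged by
    \<open>j\<close> so that distinct fibres stay disjoint.\<close>
  define W where "W j = (\<lambda>x. p (j, k (e j) x)) ` B (e j)" for j
  have eJ: "e j \<in> A" if "j \<in> J" for j
    using e that by (auto simp: bij_betw_def)
  have "small TYPE('u) (W j)" if "j \<in> J" for j
    unfolding W_def by (rule small_image[OF B[OF eJ[OF that]]])
  then have W: "small TYPE('u) (\<Union>j\<in>J. W j)"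
    using U J unfolding regular_universe_def small_def by blast
  define i where "i = inv_into J e"
  have i: "i a \<in> J" "e (i a) = a" if "a \<in> A" for a
    using e that unfolding i_def bij_betw_def by (auto simp: inv_into_into f_inv_into_f)
  have "inj_on (\<lambda>(a, x). p (i a, k a x)) (Sigma A B)"
  proof (rule inj_onI, clarify)
    fix a x b y
    assume a: "a \<in> A" "x \<in> B a" and b: "b \<in> A" "y \<in> B b" and "p (i a, k a x) = p (i b, k b y)"
    then have *: "i a = i b" "k a x = k b y"
      using injD[OF p] by auto
    then have "a = b"
      using i(2)[OF a(1)] i(2)[OF b(1)] by metis
    then show "a = b \<and> x = y"
      using *(2) a b inj_onD[OF k[OF a(1)]] by auto
  qed
  moreover have "(\<lambda>(a, x). p (i a, k a x)) ` Sigma A B \<subseteq> (\<Union>j\<in>J. W j)"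
  proof clarify
    fix a x assume a: "a \<in> A" and x: "x \<in> B a"
    show "p (i a, k a x) \<in> (\<Union>j\<in>J. W j)"
      unfolding W_def by (intro UN_I[OF i(1)[OF a]] image_eqI[of _ _ x]) (use i(2)[OF a] x in simp_all)
  qed
  ultimately have "Sigma A B \<lesssim> (\<Union>j\<in>J. W j)"
    unfolding lepoll_def by blast
  then show ?thesis
    using W small_lepoll by blast
qed

section \<open>Coproducts over small index sets of arbitrary type\<close>

context category
begin

lemma is_coproduct_cong:
  assumes "is_coproduct C J X P \<iota>" "\<And>j. j \<in> J \<Longrightarrow> X j = Y j"
  shows "is_coproduct C J Y P \<iota>"
  unfolding is_coproduct_def
proof (intro conjI ballI allI impI)
  note p = is_coproduct_injection[OF assms(1)]
  show "P \<in> Ob C"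
    by (rule p(1))
  show "Y j \<in> Ob C" "\<iota> j \<in> Hom C (Y j) P" if "j \<in> J" for j
    using p(2,3)[OF that] assms(2)[OF that] by simp_all
  fix Z f assume Z: "Z \<in> Ob C" and f: "\<forall>j\<in>J. f j \<in> Hom C (Y j) Z"
  have f': "f j \<in> Hom C (X j) Z" if "j \<in> J" for j
    using f assms(2)[OF that] that by simp
  obtain h where h: "h \<in> Hom C P Z" "\<And>j. j \<in> J \<Longrightarrow> h \<cdot> \<iota> j = f j"
    using is_coproduct_copair[OF assms(1) Z f'] by blast
  show "\<exists>!h. h \<in> Hom C P Z \<and> (\<forall>j\<in>J. h \<cdot> \<iota> j = f j)"
    by (rule ex1I[of _ h]) (use h in \<open>auto intro: is_coproduct_eqI[OF assms(1)]\<close>)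
qed

lemma small_coproduct_exists:
  fixes J :: "'j set"
  assumes C: "has_small_coproducts TYPE('u) C" and J: "small TYPE('u) J"
    and X: "\<And>j. j \<in> J \<Longrightarrow> X j \<in> Ob C"
  obtains P \<iota> where "is_coproduct C J X P \<iota>"
proof -
  obtain K :: "'u set" and e where e: "bij_betw e K J" and K: "small TYPE('u) K"
    using small_indexE[OF J] .
  have "\<forall>k\<in>K. (X \<circ> e) k \<in> Ob C"
    using e X by (auto simp: bij_betw_def)
  then obtain P \<iota> where "is_coproduct C K (X \<circ> e) P \<iota>"
    using C K unfolding has_small_coproducts_def by blast
  from is_coproduct_reindex[OF bij_betw_inv_into[OF e] this]
  have "is_coproduct C J X P (\<iota> \<circ> inv_into K e)"
    by (rule is_coproduct_cong) (use e in \<open>auto simp: bij_betw_def f_inv_into_f\<close>)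
  then show thesis
    by (rule that)
qed

lemma coprod_closedD:
  fixes J :: "'j set"
  assumes V: "coprod_closed TYPE('u) C V" and J: "small TYPE('u) J"
    and X: "\<And>j. j \<in> J \<Longrightarrow> X j \<in> V" and P: "is_coproduct C J X P \<iota>"
  shows "P \<in> V"
proof -
  obtain K :: "'u set" and e where e: "bij_betw e K J" and K: "small TYPE('u) K"
    using small_indexE[OF J] .
  have "\<forall>k\<in>K. (X \<circ> e) k \<in> V"
    using e X by (auto simp: bij_betw_def)
  then show ?thesis
    using V K is_coproduct_reindex[OF e P] unfolding coprod_closed_def by blast
qed

end

section \<open>Compact objects and Milnor colimits\<close>

context triangulated
begin

text \<open>Every target is isomorphic to a suspension, and between suspensions the universal
  property is that of the original coproduct, the shift being fully faithful.\<close>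

lemma is_coproduct_shift:
  assumes P: "is_coproduct C J X P \<iota>"
  shows "is_coproduct C J (\<lambda>j. shO (X j)) (shO P) (\<lambda>j. shA (\<iota> j))"
  unfolding is_coproduct_def
proof (intro conjI ballI allI impI)
  note p = is_coproduct_injection[OF P]
  show "shO P \<in> Ob C"
    using p(1) by simp
  show "shO (X j) \<in> Ob C" "shA (\<iota> j) \<in> Hom C (shO (X j)) (shO P)" if "j \<in> J" for j
    using p(2)[OF that] shA_Hom[OF p(3)[OF that]] by auto
  fix Z f assume Z: "Z \<in> Ob C" and f: "\<forall>j\<in>J. f j \<in> Hom C (shO (X j)) Z"
  obtain Z' e where Z': "Z' \<in> Ob C" and e: "e \<in> Hom C (shO Z') Z" "is_iso C e"
    using desuspension[OF Z] .
  obtain e' where e': "e' \<in> Hom C Z (shO Z')" "e' \<cdot> e = Idt C (shO Z')" "e \<cdot> e' = Idt C Z"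
    using is_isoE[OF e(2,1)] .
  have cancel: "e \<cdot> (e' \<cdot> x) = x" if "x \<in> Hom C a Z" for x a
    using Hom_assoc[OF e(1) e'(1) that] e'(3) Hom_Idt(2)[OF that] by simp
  have "\<exists>y. y \<in> Hom C (X j) Z' \<and> shA y = e' \<cdot> f j" if "j \<in> J" for j
    using shA_full[OF cmp_Hom[OF e'(1) bspec[OF f that]] p(2)[OF that] Z'] by blast
  then obtain y where y: "\<And>j. j \<in> J \<Longrightarrow> y j \<in> Hom C (X j) Z'"
      "\<And>j. j \<in> J \<Longrightarrow> shA (y j) = e' \<cdot> f j"
    by metis
  obtain h where h: "h \<in> Hom C P Z'" "\<And>j. j \<in> J \<Longrightarrow> h \<cdot> \<iota> j = y j"
    using is_coproduct_copair[OF P Z' y(1)] by blast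
  show "\<exists>!h. h \<in> Hom C (shO P) Z \<and> (\<forall>j\<in>J. h \<cdot> shA (\<iota> j) = f j)"
  proof (rule ex1I[of _ "e \<cdot> shA h"], intro conjI ballI)
    show "e \<cdot> shA h \<in> Hom C (shO P) Z"
      by (rule cmp_Hom[OF e(1) shA_Hom[OF h(1)]])
    fix j assume j: "j \<in> J"
    have "e \<cdot> shA h \<cdot> shA (\<iota> j) = e \<cdot> (shA h \<cdot> shA (\<iota> j))"
      by (rule Hom_assoc[OF e(1) shA_Hom[OF h(1)] shA_Hom[OF p(3)[OF j]]])
    also have "shA h \<cdot> shA (\<iota> j) = e' \<cdot> f j"
      using shA_cmp[OF h(1) p(3)[OF j]] h(2)[OF j] y(2)[OF j] by simp
    also have "e \<cdot> (e' \<cdot> f j) = f j"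
      by (rule cancel[OF bspec[OF f j]])
    finally show "e \<cdot> shA h \<cdot> shA (\<iota> j) = f j" .
  next
    fix h' assume h': "h' \<in> Hom C (shO P) Z \<and> (\<forall>j\<in>J. h' \<cdot> shA (\<iota> j) = f j)"
    obtain k where k: "k \<in> Hom C P Z'" "shA k = e' \<cdot> h'"
      using shA_full[OF cmp_Hom[OF e'(1) conjunct1[OF h']] p(1) Z'] .
    have "k = h"
    proof (rule is_coproduct_eqI[OF P k(1) h(1)])
      fix j assume j: "j \<in> J"
      have "shA (k \<cdot> \<iota> j) = e' \<cdot> h' \<cdot> shA (\<iota> j)"
        using shA_cmp[OF k(1) p(3)[OF j]] k(2) by simp
      also have "\<dots> = e' \<cdot> (h' \<cdot> shA (\<iota> j))"
        by (rule Hom_assoc[OF e'(1) conjunct1[OF h'] shA_Hom[OF p(3)[OF j]]])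
      also have "\<dots> = shA (y j)"
        using h' j y(2)[OF j] by simp
      finally have "k \<cdot> \<iota> j = y j"
        by (rule shA_inject[OF cmp_Hom[OF k(1) p(3)[OF j]] y(1)[OF j]])
      then show "k \<cdot> \<iota> j = h \<cdot> \<iota> j"
        using h(2)[OF j] by simp
    qed
    then show "h' = e \<cdot> shA h"
      using cancel[OF conjunct1[OF h']] k(2) by simp
  qed
qed

text \<open>Only the surjectivity half of compactness is needed: every morphism into a coproduct is a
  finite sum of morphisms through the summands. It is stated as an induction principle.\<close>

definition weakly_compact :: "'u itself \<Rightarrow> 'o \<Rightarrow> bool" where
  "weakly_compact U A \<longleftrightarrow> A \<in> Ob C \<and>
     (\<forall>(J :: 'u set) X P \<iota> W. small U J \<longrightarrow> is_coproduct C J X P \<iota> \<longrightarrow> nul A P \<in> W \<longrightarrow>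
        (\<forall>j\<in>J. \<forall>x\<in>Hom C A (X j). \<iota> j \<cdot> x \<in> W) \<longrightarrow>
        (\<forall>s\<in>Hom C A P. \<forall>t\<in>Hom C A P. s \<in> W \<longrightarrow> t \<in> W \<longrightarrow> s \<oplus> t \<in> W) \<longrightarrow> Hom C A P \<subseteq> W)"

lemma weakly_compact_induct:
  fixes J :: "'j set"
  assumes A: "weakly_compact TYPE('u) A" and J: "small TYPE('u) J"
    and P: "is_coproduct C J X P \<iota>" and t: "t \<in> Hom C A P"
    and nul: "nul A P \<in> W"
    and inj: "\<And>j x. j \<in> J \<Longrightarrow> x \<in> Hom C A (X j) \<Longrightarrow> \<iota> j \<cdot> x \<in> W"
    and add: "\<And>s t. s \<in> Hom C A P \<Longrightarrow> t \<in> Hom C A P \<Longrightarrow> s \<in> W \<Longrightarrow> t \<in> W \<Longrightarrow> s \<oplus> t \<in> W"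
  shows "t \<in> W"
proof -
  obtain K :: "'u set" and e where e: "bij_betw e K J" and K: "small TYPE('u) K"
    using small_indexE[OF J] .
  have *: "\<forall>k\<in>K. \<forall>x\<in>Hom C A ((X \<circ> e) k). (\<iota> \<circ> e) k \<cdot> x \<in> W"
    using e inj by (auto simp: bij_betw_def)
  have "Hom C A P \<subseteq> W"
    using A[unfolded weakly_compact_def, THEN conjunct2, rule_format,
      OF K is_coproduct_reindex[OF e P] nul] * add by blast
  then show ?thesis
    using t by blast
qed

text \<open>Surjectivity of the canonical map writes each morphism into \<open>P\<close> as a finite
  sum of morphisms through the injections; induction on the support puts this sum into
  \<open>W\<close>.\<close>

lemma weakly_compact_if_compact:
  assumes "compact_ob (U :: 'u itself) C T A"
  shows "weakly_compact U A"
  unfolding weakly_compact_def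
proof (intro conjI allI impI)
  show A: "A \<in> Ob C"
    using assms unfolding compact_ob_def by simp
  fix J :: "'u set" and X P \<iota> W
  assume J: "small U J" and P: "is_coproduct C J X P \<iota>" and nul: "nul A P \<in> W"
    and inj: "\<forall>j\<in>J. \<forall>x\<in>Hom C A (X j). \<iota> j \<cdot> x \<in> W"
    and add: "\<forall>s\<in>Hom C A P. \<forall>t\<in>Hom C A P. s \<in> W \<longrightarrow> t \<in> W \<longrightarrow> s \<oplus> t \<in> W"
  note p = is_coproduct_injection[OF P]
  let ?D = "{x \<in> (\<Pi>\<^sub>E j\<in>J. Hom C A (X j)). finite {j \<in> J. x j \<noteq> nul A (X j)}}"
  let ?F = "\<lambda>x. finprod (hom_grp C T A P) (\<lambda>j. \<iota> j \<cdot> x j) {j \<in> J. x j \<noteq> nul A (X j)}"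
  have "bij_betw ?F ?D (Hom C A P)"
    using assms J P unfolding compact_ob_def by blast
  then have surj: "?F ` ?D = Hom C A P"
    by (rule bij_betw_imp_surj_on)
  have "?F x \<in> W" if x: "x \<in> ?D" for x
  proof -
    interpret comm_monoid "hom_grp C T A P"
      by (rule comm_group.axioms(1)[OF comm_group_Hom[OF A p(1)]])
    have xH: "\<iota> j \<cdot> x j \<in> Hom C A P" "\<iota> j \<cdot> x j \<in> W" if "j \<in> J" for j
    proof -
      have "x j \<in> Hom C A (X j)"
        using x that by (auto simp: PiE_iff)
      then show "\<iota> j \<cdot> x j \<in> Hom C A P" "\<iota> j \<cdot> x j \<in> W"
        using cmp_Hom[OF p(3)[OF that]] inj that by simp_all
    qed
    \<comment> \<open>Membership in \<open>Hom C A P\<close> is carried along in the induction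
      because \<open>W\<close> is closed under sums of morphisms from \<open>A\<close> to
      \<open>P\<close> only.\<close>
    have "finprod (hom_grp C T A P) (\<lambda>j. \<iota> j \<cdot> x j) F \<in> W \<inter> Hom C A P"
      if "finite F" "F \<subseteq> J" for F
      using that
    proof (induction F rule: finite_induct)
      case empty
      then show ?case
        using nul nul_Hom[OF A p(1)] by simp
    next
      case (insert j F)
      have "(\<lambda>j. \<iota> j \<cdot> x j) \<in> F \<rightarrow> carrier (hom_grp C T A P)"
        using xH insert by auto
      then have "finprod (hom_grp C T A P) (\<lambda>j. \<iota> j \<cdot> x j) (insert j F) =
          \<iota> j \<cdot> x j \<oplus> finprod (hom_grp C T A P) (\<lambda>j. \<iota> j \<cdot> x j) F"
        using finprod_insert[of F j] insert xH by simp
      then show ?case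
        using add xH[of j] insert plus_Hom by auto
    qed
    then show ?thesis
      using x by blast
  qed
  then have "?F ` ?D \<subseteq> W"
    by (rule image_subsetI)
  then show "Hom C A P \<subseteq> W"
    unfolding surj .
qed

text \<open>Each summand is isomorphic to a suspension \<open>shO (Y j)\<close>, which makes
  \<open>P\<close> a retract of the suspension of the coproduct \<open>Q\<close> of the
  \<open>Y j\<close>. A morphism from \<open>shO A\<close> to \<open>P\<close> therefore comes from
  a morphism from \<open>A\<close> to \<open>Q\<close>, to which the induction principle for
  \<open>A\<close> applies.\<close>

lemma weakly_compact_shift:
  assumes C: "has_small_coproducts TYPE('u) C" and A: "weakly_compact TYPE('u) A"
  shows "weakly_compact TYPE('u) (shO A)"
  unfolding weakly_compact_def
proof (intro conjI allI impI subsetI)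
  have AOb: "A \<in> Ob C"
    using A unfolding weakly_compact_def by simp
  then show "shO A \<in> Ob C"
    by simp
  fix J :: "'u set" and X P \<iota> W t
  assume J: "small TYPE('u) J" and P: "is_coproduct C J X P \<iota>" and nul: "nul (shO A) P \<in> W"
    and inj: "\<forall>j\<in>J. \<forall>x\<in>Hom C (shO A) (X j). \<iota> j \<cdot> x \<in> W"
    and add: "\<forall>s\<in>Hom C (shO A) P. \<forall>t\<in>Hom C (shO A) P. s \<in> W \<longrightarrow> t \<in> W \<longrightarrow> s \<oplus> t \<in> W"
    and t: "t \<in> Hom C (shO A) P"
  note p = is_coproduct_injection[OF P]
  have "\<exists>Y. Y \<in> Ob C \<and> (\<exists>e\<in>Hom C (shO Y) (X j). is_iso C e)" if "j \<in> J" for j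
    using desuspension[OF p(2)[OF that]] by blast
  then obtain Y where Y: "\<And>j. j \<in> J \<Longrightarrow> Y j \<in> Ob C"
      "\<And>j. j \<in> J \<Longrightarrow> \<exists>e\<in>Hom C (shO (Y j)) (X j). is_iso C e"
    by metis
  then obtain e where e: "\<And>j. j \<in> J \<Longrightarrow> e j \<in> Hom C (shO (Y j)) (X j)"
      "\<And>j. j \<in> J \<Longrightarrow> is_iso C (e j)"
    by metis
  have "\<exists>e'. e' \<in> Hom C (X j) (shO (Y j)) \<and> e j \<cdot> e' = Idt C (X j)" if "j \<in> J" for j
    using is_isoE[OF e(2,1)] that by metis
  then obtain e' where e': "\<And>j. j \<in> J \<Longrightarrow> e' j \<in> Hom C (X j) (shO (Y j))"
      "\<And>j. j \<in> J \<Longrightarrow> e j \<cdot> e' j = Idt C (X j)"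
    by metis
  obtain Q \<kappa> where Q: "is_coproduct C J Y Q \<kappa>"
    using small_coproduct_exists[OF C J, of Y] Y(1) by blast
  note q = is_coproduct_injection[OF Q]
  note SQ = is_coproduct_shift[OF Q]
  note sq = is_coproduct_injection[OF SQ]
  obtain \<phi> where \<phi>: "\<phi> \<in> Hom C (shO Q) P" "\<And>j. j \<in> J \<Longrightarrow> \<phi> \<cdot> shA (\<kappa> j) = \<iota> j \<cdot> e j"
    using is_coproduct_copair[OF SQ p(1), of "\<lambda>j. \<iota> j \<cdot> e j"] cmp_Hom[OF p(3) e(1)] by metis
  obtain \<psi> where \<psi>: "\<psi> \<in> Hom C P (shO Q)" "\<And>j. j \<in> J \<Longrightarrow> \<psi> \<cdot> \<iota> j = shA (\<kappa> j) \<cdot> e' j"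
    using is_coproduct_copair[OF P sq(1), of "\<lambda>j. shA (\<kappa> j) \<cdot> e' j"] cmp_Hom[OF sq(3) e'(1)] by metis
  have \<phi>\<psi>: "\<phi> \<cdot> \<psi> = Idt C P"
  proof (rule is_coproduct_eqI[OF P cmp_Hom[OF \<phi>(1) \<psi>(1)] Idt_Hom[OF p(1)]])
    fix j assume j: "j \<in> J"
    have "\<phi> \<cdot> \<psi> \<cdot> \<iota> j = \<phi> \<cdot> shA (\<kappa> j) \<cdot> e' j"
      using Hom_assoc[OF \<phi>(1) \<psi>(1) p(3)[OF j]] Hom_assoc[OF \<phi>(1) sq(3)[OF j] e'(1)[OF j]] \<psi>(2)[OF j]
      by simp
    also have "\<dots> = \<iota> j \<cdot> (e j \<cdot> e' j)"
      using \<phi>(2)[OF j] Hom_assoc[OF p(3)[OF j] e(1)[OF j] e'(1)[OF j]] by simp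
    also have "\<dots> = Idt C P \<cdot> \<iota> j"
      using e'(2)[OF j] Hom_Idt[OF p(3)[OF j]] by simp
    finally show "\<phi> \<cdot> \<psi> \<cdot> \<iota> j = Idt C P \<cdot> \<iota> j" .
  qed
  obtain s where s: "s \<in> Hom C A Q" "shA s = \<psi> \<cdot> t"
    using shA_full[OF cmp_Hom[OF \<psi>(1) t] AOb q(1)] .
  \<comment> \<open>The preimage of \<open>W\<close> under the additive map
    \<open>s \<mapsto> \<phi> \<cdot> shA s\<close> inherits the closure properties of
    \<open>W\<close>.\<close>
  have "s \<in> {s. \<phi> \<cdot> shA s \<in> W}"
  proof (rule weakly_compact_induct[OF A J Q s(1)]; unfold mem_Collect_eq)
    show "\<phi> \<cdot> shA (nul A Q) \<in> W"
      using nul shA_nul[OF AOb q(1)] cmp_nul[OF \<phi>(1) shO_Ob[OF AOb]] by simp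
    show "\<phi> \<cdot> shA (\<kappa> j \<cdot> x) \<in> W" if j: "j \<in> J" and x: "x \<in> Hom C A (Y j)" for j x
    proof -
      note sx = shA_Hom[OF x]
      have "\<phi> \<cdot> shA (\<kappa> j \<cdot> x) = \<phi> \<cdot> shA (\<kappa> j) \<cdot> shA x"
        using shA_cmp[OF q(3)[OF j] x] Hom_assoc[OF \<phi>(1) sq(3)[OF j] sx] by simp
      also have "\<dots> = \<iota> j \<cdot> (e j \<cdot> shA x)"
        using \<phi>(2)[OF j] Hom_assoc[OF p(3)[OF j] e(1)[OF j] sx] by simp
      finally show ?thesis
        using inj j cmp_Hom[OF e(1)[OF j] sx] by simp
    qed
    show "\<phi> \<cdot> shA (s \<oplus> t) \<in> W"
      if "s \<in> Hom C A Q" "t \<in> Hom C A Q" "\<phi> \<cdot> shA s \<in> W" "\<phi> \<cdot> shA t \<in> W" for s t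
      using that add cmp_Hom[OF \<phi>(1) shA_Hom] shA_plus[OF that(1,2)]
        cmp_plus[OF \<phi>(1) shA_Hom[OF that(1)] shA_Hom[OF that(2)]] by simp
  qed
  moreover have "\<phi> \<cdot> (\<psi> \<cdot> t) = t"
    using Hom_assoc[OF \<phi>(1) \<psi>(1) t] \<phi>\<psi> Hom_Idt(2)[OF t] by simp
  ultimately show "t \<in> W"
    using s(2) by simp
qed

text \<open>This is injectivity of \<open>1 - \<sigma>\<close> on morphisms out of \<open>A\<close>.
  The components of a fixed \<open>t\<close> vanish one after the other: the component at 0 because
  \<open>\<sigma>\<close> misses the summand \<open>L 0\<close>, each later one because it is the
  image of its predecessor under \<open>f\<close>. By compactness \<open>t\<close> is the sum of
  finitely many of its components.\<close>

lemma shift_map_fixpoint_nul: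
  fixes L :: "nat \<Rightarrow> 'o"
  assumes U: "regular_universe TYPE('u)"
    and A: "weakly_compact TYPE('u) A" and Q: "is_coproduct C UNIV L Q \<iota>"
    and f: "\<And>n. f n \<in> Hom C (L n) (L (Suc n))"
    and \<sigma>: "\<sigma> \<in> Hom C Q Q" "\<And>n. \<sigma> \<cdot> \<iota> n = \<iota> (Suc n) \<cdot> f n"
    and t: "t \<in> Hom C A Q" "\<sigma> \<cdot> t = t"
  shows "t = nul A Q"
proof -
  have AOb: "A \<in> Ob C"
    using A unfolding weakly_compact_def by simp
  have QOb: "Q \<in> Ob C" and LOb: "\<And>n. L n \<in> Ob C" and \<iota>: "\<And>n. \<iota> n \<in> Hom C (L n) Q"
    using is_coproduct_injection[OF Q] by auto
  \<comment> \<open>The matrix entries of the projection of \<open>Q\<close> onto its summand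
    \<open>L n\<close>.\<close>
  define d where "d n m = (if m = n then Idt C (L n) else nul (L m) (L n))" for n m
  have d: "d n m \<in> Hom C (L m) (L n)" for n m
    using Idt_Hom[OF LOb] nul_Hom[OF LOb LOb] unfolding d_def by simp
  have "\<exists>\<pi>. \<pi> \<in> Hom C Q (L n) \<and> (\<forall>m. \<pi> \<cdot> \<iota> m = d n m)" for n
    using is_coproduct_copair[OF Q LOb d] by (metis UNIV_I)
  then obtain \<pi> where \<pi>: "\<And>n. \<pi> n \<in> Hom C Q (L n)" "\<And>n m. \<pi> n \<cdot> \<iota> m = d n m"
    by metis
  have \<pi>_0: "\<pi> 0 \<cdot> \<sigma> = nul Q (L 0)"
  proof (rule is_coproduct_eqI[OF Q cmp_Hom[OF \<pi>(1) \<sigma>(1)] nul_Hom[OF QOb LOb]])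
    fix m
    have "\<pi> 0 \<cdot> \<sigma> \<cdot> \<iota> m = \<pi> 0 \<cdot> \<iota> (Suc m) \<cdot> f m"
      using Hom_assoc[OF \<pi>(1) \<sigma>(1) \<iota>] Hom_assoc[OF \<pi>(1) \<iota> f] \<sigma>(2) by simp
    then show "\<pi> 0 \<cdot> \<sigma> \<cdot> \<iota> m = nul Q (L 0) \<cdot> \<iota> m"
      using \<pi>(2) nul_cmp[OF f LOb] nul_cmp[OF \<iota> LOb] by (simp add: d_def)
  qed
  have \<pi>_Suc: "\<pi> (Suc n) \<cdot> \<sigma> = f n \<cdot> \<pi> n" for n
  proof (rule is_coproduct_eqI[OF Q cmp_Hom[OF \<pi>(1) \<sigma>(1)] cmp_Hom[OF f \<pi>(1)]])
    fix m
    have "\<pi> (Suc n) \<cdot> \<sigma> \<cdot> \<iota> m = d (Suc n) (Suc m) \<cdot> f m"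
      using Hom_assoc[OF \<pi>(1) \<sigma>(1) \<iota>] Hom_assoc[OF \<pi>(1) \<iota> f] \<sigma>(2) \<pi>(2) by metis
    also have "\<dots> = f n \<cdot> d n m"
      using Hom_Idt[OF f] nul_cmp[OF f LOb] cmp_nul[OF f LOb] by (simp add: d_def)
    also have "\<dots> = f n \<cdot> \<pi> n \<cdot> \<iota> m"
      using Hom_assoc[OF f \<pi>(1) \<iota>] \<pi>(2) by simp
    finally show "\<pi> (Suc n) \<cdot> \<sigma> \<cdot> \<iota> m = f n \<cdot> \<pi> n \<cdot> \<iota> m" .
  qed
  have \<pi>_t: "\<pi> n \<cdot> t = nul A (L n)" for n
  proof (induction n)
    case 0
    have "\<pi> 0 \<cdot> \<sigma> \<cdot> t = \<pi> 0 \<cdot> t"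
      using Hom_assoc[OF \<pi>(1) \<sigma>(1) t(1)] t(2) by simp
    then show ?case
      unfolding \<pi>_0 using nul_cmp[OF t(1) LOb] by simp
  next
    case (Suc n)
    have "\<pi> (Suc n) \<cdot> \<sigma> \<cdot> t = \<pi> (Suc n) \<cdot> t"
      using Hom_assoc[OF \<pi>(1) \<sigma>(1) t(1)] t(2) by simp
    then show ?case
      unfolding \<pi>_Suc using Hom_assoc[OF f \<pi>(1) t(1)] Suc cmp_nul[OF f AOb] by simp
  qed
  \<comment> \<open>The endomorphism \<open>E n\<close> is the identity on the summands with index
    below \<open>n\<close> and zero on all others.\<close>
  define E where "E = rec_nat (nul Q Q) (\<lambda>n e. e \<oplus> \<iota> n \<cdot> \<pi> n)"
  have E_simps: "E 0 = nul Q Q" "E (Suc n) = E n \<oplus> \<iota> n \<cdot> \<pi> n" for n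
    unfolding E_def by simp_all
  have E: "E n \<in> Hom C Q Q" for n
    by (induction n) (use nul_Hom[OF QOb QOb] plus_Hom cmp_Hom[OF \<iota> \<pi>(1)] in \<open>auto simp: E_simps\<close>)
  have E_\<iota>: "E n \<cdot> \<iota> m = (if m < n then \<iota> m else nul (L m) Q)" for n m
  proof (induction n)
    case 0
    show ?case
      using nul_cmp[OF \<iota> QOb] by (simp add: E_simps)
  next
    case (Suc n)
    have "E (Suc n) \<cdot> \<iota> m = E n \<cdot> \<iota> m \<oplus> \<iota> n \<cdot> d n m"
      unfolding E_simps using plus_cmp[OF E cmp_Hom[OF \<iota> \<pi>(1)] \<iota>] Hom_assoc[OF \<iota> \<pi>(1) \<iota>] \<pi>(2) by simp
    also have "\<dots> = (if m < Suc n then \<iota> m else nul (L m) Q)"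
      unfolding Suc d_def using cmp_nul[OF \<iota> LOb] Hom_Idt(1)[OF \<iota>] plus_nul[OF \<iota>]
        plus_nul(1)[OF nul_Hom[OF LOb QOb]] by (auto simp: less_Suc_eq)
    finally show ?case .
  qed
  have nat_small: "small TYPE('u) (UNIV :: nat set)"
    by (rule countable_small[OF U countableI_type])
  \<comment> \<open>Finite support, expressed as being fixed by all sufficiently late truncations;
    in this form the bounds for two morphisms combine to one for their sum.\<close>
  have "t \<in> {t. \<exists>N. \<forall>n\<ge>N. E n \<cdot> t = t}"
  proof (rule weakly_compact_induct[OF A nat_small Q t(1)]; unfold mem_Collect_eq)
    show "\<exists>N. \<forall>n\<ge>N. E n \<cdot> nul A Q = nul A Q"
      using cmp_nul[OF E AOb] by simp
    show "\<exists>N. \<forall>n\<ge>N. E n \<cdot> (\<iota> j \<cdot> x) = \<iota> j \<cdot> x" if "x \<in> Hom C A (L j)" for j x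
      using Hom_assoc[OF E \<iota> that] E_\<iota> by (intro exI[of _ "Suc j"]) (metis Suc_le_lessD)
    show "\<exists>N. \<forall>n\<ge>N. E n \<cdot> (s \<oplus> t) = s \<oplus> t"
      if st: "s \<in> Hom C A Q" "t \<in> Hom C A Q" "\<exists>N. \<forall>n\<ge>N. E n \<cdot> s = s" "\<exists>N. \<forall>n\<ge>N. E n \<cdot> t = t" for s t
    proof -
      obtain N M where "\<forall>n\<ge>N. E n \<cdot> s = s" "\<forall>n\<ge>M. E n \<cdot> t = t"
        using st by blast
      then have "\<forall>n\<ge>max N M. E n \<cdot> (s \<oplus> t) = s \<oplus> t"
        using cmp_plus[OF E st(1,2)] by simp
      then show ?thesis ..
    qed
  qed
  then obtain N where N: "E N \<cdot> t = t"
    by auto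
  have "E n \<cdot> t = nul A Q" for n
  proof (induction n)
    case 0
    show ?case
      using nul_cmp[OF t(1) QOb] by (simp add: E_simps)
  next
    case (Suc n)
    have "\<iota> n \<cdot> \<pi> n \<cdot> t = nul A Q"
      using Hom_assoc[OF \<iota> \<pi>(1) t(1)] \<pi>_t cmp_nul[OF \<iota> AOb] by simp
    then show ?case
      unfolding E_simps using plus_cmp[OF E cmp_Hom[OF \<iota> \<pi>(1)] t(1)] Suc
        plus_nul(1)[OF nul_Hom[OF AOb QOb]] by simp
  qed
  then show ?thesis
    using N by simp
qed

text \<open>Consecutive maps of a triangle compose to zero, so \<open>p\<close> kills
  \<open>1 - \<sigma>\<close>. In other words, the morphisms \<open>p \<cdot> \<iota> n\<close> form
  a cocone on the sequence.\<close>

lemma Mcolim_cocone: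
  assumes \<sigma>: "\<sigma> \<in> Hom C Q Q" and dist: "(Idt C Q \<oplus> \<ominus> \<sigma>, p, q) \<in> dist T" and p: "p \<in> Hom C Q Y"
  shows "p \<cdot> \<sigma> = p"
proof -
  note I = Idt_Hom[OF Hom_Ob(1)[OF p]]
  note d = plus_Hom[OF I neg_Hom[OF \<sigma>]]
  have "p \<cdot> (Idt C Q \<oplus> \<ominus> \<sigma>) = nul Q Y"
    using dist_cmp_nul[OF dist] Hom_Dom_Cod[OF p] Hom_Dom_Cod[OF d] by simp
  then have "p \<oplus> \<ominus> (p \<cdot> \<sigma>) = nul Q Y"
    using cmp_plus[OF p I neg_Hom[OF \<sigma>]] cmp_neg[OF p \<sigma>] Hom_Idt(1)[OF p] by simp
  then show ?thesis
    using eq_if_diff_nul[OF p cmp_Hom[OF p \<sigma>]] by simp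
qed

text \<open>The obstruction to lifting \<open>k\<close> along \<open>shA p\<close> is
  \<open>shA q \<cdot> k\<close>. It is fixed by the twice suspended \<open>\<sigma>\<close>, hence
  zero by \<open>shift_map_fixpoint_nul\<close>. The lift to the suspended coproduct is a finite sum
  through its summands, and such a sum can be collected at one stage of the sequence.\<close>

lemma hom_to_shift_Mcolim_factors:
  fixes L :: "nat \<Rightarrow> 'o"
  assumes U: "regular_universe TYPE('u)"
    and A: "weakly_compact TYPE('u) A" and Q: "is_coproduct C UNIV L Q \<iota>"
    and f: "\<And>n. f n \<in> Hom C (L n) (L (Suc n))"
    and \<sigma>: "\<sigma> \<in> Hom C Q Q" "\<And>n. \<sigma> \<cdot> \<iota> n = \<iota> (Suc n) \<cdot> f n"
    and dist: "(Idt C Q \<oplus> \<ominus> \<sigma>, p, q) \<in> dist T" and p: "p \<in> Hom C Q Y"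
    and k: "k \<in> Hom C A (shO Y)"
  obtains N x where "x \<in> Hom C A (shO (L N))" "k = shA (p \<cdot> \<iota> N) \<cdot> x"
proof -
  have AOb: "A \<in> Ob C"
    using A unfolding weakly_compact_def by simp
  have QOb: "Q \<in> Ob C" and LOb: "\<And>n. L n \<in> Ob C" and \<iota>: "\<And>n. \<iota> n \<in> Hom C (L n) Q"
    using is_coproduct_injection[OF Q] by auto
  define d where "d = Idt C Q \<oplus> \<ominus> \<sigma>"
  have I: "Idt C Q \<in> Hom C Q Q"
    by (rule Idt_Hom[OF QOb])
  have d: "d \<in> Hom C Q Q"
    unfolding d_def by (rule plus_Hom[OF I neg_Hom[OF \<sigma>(1)]])
  have dist': "(d, p, q) \<in> dist T"
    using dist unfolding d_def .
  have q: "q \<in> Hom C Y (shO Q)"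
    using dist_Hom(3)[OF dist'] Hom_Dom_Cod[OF p] Hom_Dom_Cod[OF d] by simp
  note sd = shA_Hom[OF d] and ssd = shA_Hom[OF shA_Hom[OF d]] and sq = shA_Hom[OF q]
    and sp = shA_Hom[OF p] and s\<sigma> = shA_Hom[OF \<sigma>(1)] and ss\<sigma> = shA_Hom[OF shA_Hom[OF \<sigma>(1)]]
  \<comment> \<open>Three rotations suspend a triangle up to sign, and the fourth moves it on by one
    place, so that \<open>rot4\<close> starts with \<open>\<ominus> (shA p)\<close> and
    \<open>\<ominus> (shA q)\<close>.\<close>
  note rot1 = dist_rotate[OF dist'] and rot2 = dist_rotate[OF dist_rotate[OF dist']]
    and rot4 = dist_rotate[OF dist_rotate[OF dist_rotate[OF dist_rotate[OF dist']]]]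
  define b where "b = shA q \<cdot> k"
  have b: "b \<in> Hom C A (shO (shO Q))"
    unfolding b_def by (rule cmp_Hom[OF sq k])
  have "\<ominus> (shA d) \<cdot> q = nul Y (shO Q)"
    using dist_cmp_nul[OF rot2] dist_cmp_nul[OF rot1] Hom_Dom_Cod[OF p] Hom_Dom_Cod[OF q]
      Hom_Dom_Cod[OF neg_Hom[OF sd]] by simp
  then have "\<ominus> (shA d \<cdot> q) = \<ominus> (nul Y (shO Q))"
    using neg_cmp[OF sd q] neg_nul Hom_Ob[OF q] by simp
  then have dq: "shA d \<cdot> q = nul Y (shO Q)"
    by (rule neg_inject[OF cmp_Hom[OF sd q] nul_Hom[OF Hom_Ob[OF q]]])
  have "shA (shA d) \<cdot> b = shA (shA d \<cdot> q) \<cdot> k"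
    unfolding b_def using Hom_assoc[OF ssd sq k] shA_cmp[OF sd q] by simp
  also have "\<dots> = nul A (shO (shO Q))"
    unfolding dq using shA_nul[OF Hom_Ob[OF q]] nul_cmp[OF k] QOb by simp
  finally have "shA (shA d) \<cdot> b = nul A (shO (shO Q))" .
  moreover have "shA (shA d) = Idt C (shO (shO Q)) \<oplus> \<ominus> (shA (shA \<sigma>))"
    unfolding d_def using shA_plus[OF I neg_Hom[OF \<sigma>(1)]] shA_neg[OF \<sigma>(1)] shA_neg[OF s\<sigma>]
      shA_plus[OF shA_Hom[OF I] neg_Hom[OF s\<sigma>]] QOb by simp
  ultimately have "b \<oplus> \<ominus> (shA (shA \<sigma>) \<cdot> b) = nul A (shO (shO Q))"
    using plus_cmp[OF Idt_Hom neg_Hom[OF ss\<sigma>] b] neg_cmp[OF ss\<sigma> b] Hom_Idt(2)[OF b] QOb by simp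
  then have b_fix: "shA (shA \<sigma>) \<cdot> b = b"
    using eq_if_diff_nul[OF b cmp_Hom[OF ss\<sigma> b]] by simp
  have "b = nul A (shO (shO Q))"
  proof (rule shift_map_fixpoint_nul[OF U A is_coproduct_shift[OF is_coproduct_shift[OF Q]] _ ss\<sigma> _ b b_fix])
    show "shA (shA (f n)) \<in> Hom C (shO (shO (L n))) (shO (shO (L (Suc n))))" for n
      by (rule shA_Hom[OF shA_Hom[OF f]])
    show "shA (shA \<sigma>) \<cdot> shA (shA (\<iota> n)) = shA (shA (\<iota> (Suc n))) \<cdot> shA (shA (f n))" for n
      using shA_cmp[OF \<sigma>(1) \<iota>, of n] shA_cmp[OF s\<sigma> shA_Hom[OF \<iota>], of n]
        shA_cmp[OF \<iota> f, of n] shA_cmp[OF shA_Hom[OF \<iota>] shA_Hom[OF f], of n] \<sigma>(2)[of n] by simp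
  qed
  then have "\<ominus> (shA q) \<cdot> k = nul A (shO (shO Q))"
    unfolding b_def using neg_cmp[OF sq k] neg_nul[OF AOb] QOb by simp
  then obtain l' where l': "l' \<in> Hom C A (shO Q)" "\<ominus> (shA p) \<cdot> l' = k"
    using dist_weak_kernel[OF rot4, unfolded Hom_Dom_Cod[OF neg_Hom[OF sp]] Hom_Dom_Cod[OF neg_Hom[OF sq]], OF k] by metis
  define l where "l = \<ominus> l'"
  have l: "l \<in> Hom C A (shO Q)"
    unfolding l_def by (rule neg_Hom[OF l'(1)])
  have pl: "shA p \<cdot> l = k"
    unfolding l_def using l'(2) neg_cmp[OF sp l'(1)] cmp_neg[OF sp l'(1)] by simp
  note p\<iota> = cmp_Hom[OF p \<iota>]
  note p\<sigma> = Mcolim_cocone[OF \<sigma>(1) dist p]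
  have step: "p \<cdot> \<iota> n = p \<cdot> \<iota> (Suc n) \<cdot> f n" for n
    using Hom_assoc[OF p \<sigma>(1) \<iota>, of n] Hom_assoc[OF p \<iota> f, of n] p\<sigma> \<sigma>(2)[of n] by simp
  \<comment> \<open>Factorizations through different stages have to be moved to a common later stage
    before they can be added.\<close>
  have raise: "\<exists>x'\<in>Hom C A (shO (L M)). shA (p \<cdot> \<iota> M) \<cdot> x' = shA (p \<cdot> \<iota> N) \<cdot> x"
    if "N \<le> M" "x \<in> Hom C A (shO (L N))" for N M x
    using that(1)
  proof (induction M rule: dec_induct)
    case base
    show ?case
      using that(2) by blast
  next
    case (step n)
    then obtain x' where x': "x' \<in> Hom C A (shO (L n))" "shA (p \<cdot> \<iota> n) \<cdot> x' = shA (p \<cdot> \<iota> N) \<cdot> x"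
      by blast
    have "shA (p \<cdot> \<iota> (Suc n)) \<cdot> (shA (f n) \<cdot> x') = shA (p \<cdot> \<iota> n) \<cdot> x'"
      using Hom_assoc[OF shA_Hom[OF p\<iota>] shA_Hom[OF f] x'(1)] shA_cmp[OF p\<iota> f, of n]
        \<open>\<And>n. p \<cdot> \<iota> n = p \<cdot> \<iota> (Suc n) \<cdot> f n\<close>[of n] by simp
    then show ?case
      using x'(2) cmp_Hom[OF shA_Hom[OF f] x'(1)] by (intro bexI[of _ "shA (f n) \<cdot> x'"]) simp_all
  qed
  have nat_small: "small TYPE('u) (UNIV :: nat set)"
    by (rule countable_small[OF U countableI_type])
  \<comment> \<open>The induction runs over those morphisms into \<open>shO Q\<close> whose image in
    \<open>shO Y\<close> comes from a single stage.\<close>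
  have "l \<in> {l. \<exists>N. \<exists>x\<in>Hom C A (shO (L N)). shA (p \<cdot> \<iota> N) \<cdot> x = shA p \<cdot> l}"
  proof (rule weakly_compact_induct[OF A nat_small is_coproduct_shift[OF Q] l]; unfold mem_Collect_eq)
    show "\<exists>N. \<exists>x\<in>Hom C A (shO (L N)). shA (p \<cdot> \<iota> N) \<cdot> x = shA p \<cdot> nul A (shO Q)"
      using cmp_nul[OF shA_Hom[OF p\<iota>] AOb, of 0] cmp_nul[OF sp AOb]
      by (intro exI[of _ 0] bexI[of _ "nul A (shO (L 0))"] nul_Hom AOb shO_Ob LOb) simp
    show "\<exists>N. \<exists>x\<in>Hom C A (shO (L N)). shA (p \<cdot> \<iota> N) \<cdot> x = shA p \<cdot> (shA (\<iota> j) \<cdot> x')"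
      if "x' \<in> Hom C A (shO (L j))" for j x'
      using Hom_assoc[OF sp shA_Hom[OF \<iota>] that] shA_cmp[OF p \<iota>, of j]
      by (intro exI[of _ j] bexI[OF _ that]) simp
    show "\<exists>N. \<exists>x\<in>Hom C A (shO (L N)). shA (p \<cdot> \<iota> N) \<cdot> x = shA p \<cdot> (s \<oplus> t)"
      if st: "s \<in> Hom C A (shO Q)" "t \<in> Hom C A (shO Q)"
        "\<exists>N. \<exists>x\<in>Hom C A (shO (L N)). shA (p \<cdot> \<iota> N) \<cdot> x = shA p \<cdot> s"
        "\<exists>N. \<exists>x\<in>Hom C A (shO (L N)). shA (p \<cdot> \<iota> N) \<cdot> x = shA p \<cdot> t" for s t
    proof -
      obtain N x where x: "x \<in> Hom C A (shO (L N))" "shA (p \<cdot> \<iota> N) \<cdot> x = shA p \<cdot> s"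
        using st(3) by blast
      obtain M y where y: "y \<in> Hom C A (shO (L M))" "shA (p \<cdot> \<iota> M) \<cdot> y = shA p \<cdot> t"
        using st(4) by blast
      let ?K = "max N M"
      obtain x' where x': "x' \<in> Hom C A (shO (L ?K))" "shA (p \<cdot> \<iota> ?K) \<cdot> x' = shA p \<cdot> s"
        using raise[OF max.cobounded1 x(1)] x(2) by auto
      obtain y' where y': "y' \<in> Hom C A (shO (L ?K))" "shA (p \<cdot> \<iota> ?K) \<cdot> y' = shA p \<cdot> t"
        using raise[OF max.cobounded2 y(1)] y(2) by auto
      show ?thesis
        using cmp_plus[OF shA_Hom[OF p\<iota>] x'(1) y'(1)] cmp_plus[OF sp st(1,2)] x'(2) y'(2)
        by (intro exI[of _ ?K] bexI[OF _ plus_Hom[OF x'(1) y'(1)]]) simp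
    qed
  qed
  then show thesis
    using that pl by auto
qed

end

section \<open>Suspended subcategories generated by compact objects\<close>

context triangulated
begin

lemma is_Mcolim_iso:
  assumes Y: "is_Mcolim C T L f Y" and u: "u \<in> Hom C Y M" "is_iso C u"
  shows "is_Mcolim C T L f M"
proof -
  obtain Q \<iota> \<sigma> p q where Q: "is_coproduct C UNIV L Q \<iota>"
    and \<sigma>: "\<sigma> \<in> Hom C Q Q" "\<forall>n. \<sigma> \<cdot> \<iota> n = \<iota> (Suc n) \<cdot> f n"
    and t: "(Idt C Q \<oplus> \<ominus> \<sigma>, p, q) \<in> dist T" and Cod_p: "Cod C p = Y"
    using Y unfolding is_Mcolim_def by blast
  obtain s where s: "s \<in> Hom C M Y" "s \<cdot> u = Idt C Y"
    using is_isoE[OF u(2,1)] by metis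
  let ?d = "Idt C Q \<oplus> \<ominus> \<sigma>"
  have d: "?d \<in> Hom C Q Q"
    by (rule plus_Hom[OF Idt_Hom[OF is_coproduct_injection(1)[OF Q]] neg_Hom[OF \<sigma>(1)]])
  have p: "p \<in> Hom C Q Y" and q: "q \<in> Hom C Y (shO Q)"
    using dist_Hom(2,3)[OF t] unfolding Cod_p Hom_Dom_Cod[OF d] by auto
  have up: "u \<cdot> p \<in> Hom C Q M"
    by (rule cmp_Hom[OF u(1) p])
  have "(?d, u \<cdot> p, q \<cdot> s) \<in> dist T"
  proof (rule dist_iso[OF t, unfolded Cod_p Hom_Dom_Cod[OF d], OF u up refl])
    show "q \<cdot> s \<in> Hom C M (shO Q)"
      by (rule cmp_Hom[OF q s(1)])
    show "q \<cdot> s \<cdot> u = q"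
      using Hom_assoc[OF q s(1) u(1)] s(2) Hom_Idt(1)[OF q] by simp
  qed
  then show ?thesis
    unfolding is_Mcolim_def using Q \<sigma> Hom_Dom_Cod(2)[OF up] by blast
qed

text \<open>Existence: \<open>v \<cdot> f\<close> is zero. Uniqueness: if \<open>u\<close> kills the
  difference \<open>d\<close> of two factorizations, then \<open>shA d\<close> factors through the
  cone by a morphism out of \<open>shO A\<close>; for this reason orthogonality is asked of
  \<open>shO A\<close> as well.\<close>

lemma factorization_if_orthogonal_cone:
  assumes t: "(u, v, w) \<in> dist T" and f: "f \<in> Hom C A (Cod C u)"
    and orth: "\<And>x. x \<in> Hom C A (Cod C v) \<Longrightarrow> x = nul A (Cod C v)"
      "\<And>x. x \<in> Hom C (shO A) (Cod C v) \<Longrightarrow> x = nul (shO A) (Cod C v)"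
  shows "\<exists>!g. g \<in> Hom C A (Dom C u) \<and> u \<cdot> g = f"
proof (rule ex_ex1I)
  note H = dist_Hom[OF t]
  have "v \<cdot> f = nul A (Cod C v)"
    by (rule orth(1)[OF cmp_Hom[OF H(2) f]])
  then show "\<exists>g. g \<in> Hom C A (Dom C u) \<and> u \<cdot> g = f"
    using dist_weak_kernel[OF t f] by metis
  fix g g'
  assume "g \<in> Hom C A (Dom C u) \<and> u \<cdot> g = f" "g' \<in> Hom C A (Dom C u) \<and> u \<cdot> g' = f"
  then have g: "g \<in> Hom C A (Dom C u)" "u \<cdot> g = f" and g': "g' \<in> Hom C A (Dom C u)" "u \<cdot> g' = f"
    by auto
  note AOb = Hom_Ob(1)[OF f] and uOb = dist_Ob[OF t]
  define d where "d = g \<oplus> \<ominus> g'"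
  have d: "d \<in> Hom C A (Dom C u)"
    unfolding d_def by (rule plus_Hom[OF g(1) neg_Hom[OF g'(1)]])
  have "u \<cdot> d = nul A (Cod C u)"
    unfolding d_def using cmp_plus[OF H(1) g(1) neg_Hom[OF g'(1)]] cmp_neg[OF H(1) g'(1)] g(2) g'(2)
      neg_plus(1)[OF f] by simp
  then have "\<ominus> (shA u) \<cdot> shA d = nul (shO A) (shO (Cod C u))"
    using neg_cmp[OF shA_Hom[OF H(1)] shA_Hom[OF d]] shA_cmp[OF H(1) d] shA_nul[OF AOb uOb(2)]
      neg_nul[OF shO_Ob[OF AOb] shO_Ob[OF uOb(2)]] by simp
  then obtain m where m: "m \<in> Hom C (shO A) (Cod C v)" "w \<cdot> m = shA d"
    using dist_weak_kernel[OF dist_rotate[OF dist_rotate[OF t]], unfolded Hom_Dom_Cod[OF H(3)]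
        Hom_Dom_Cod[OF neg_Hom[OF shA_Hom[OF H(1)]]], OF shA_Hom[OF d]] by metis
  have "shA d = shA (nul A (Dom C u))"
    using m(2) cmp_nul[OF H(3) shO_Ob[OF AOb]] shA_nul[OF AOb uOb(1)]
    unfolding orth(2)[OF m(1)] by simp
  then have "d = nul A (Dom C u)"
    by (rule shA_inject[OF d nul_Hom[OF AOb uOb(1)]])
  then show "g = g'"
    unfolding d_def by (rule eq_if_diff_nul[OF g(1) g'(1)])
qed

section \<open>The subcategory generated under extensions, shifts and coproducts\<close>

lemma ext_closedD:
  assumes "ext_closed C T V" "(f, g, h) \<in> dist T" "Dom C f \<in> V" "Cod C g \<in> V"
  shows "Cod C f \<in> V"
  using bspec[OF assms(1)[unfolded ext_closed_def] assms(2)] assms(3,4) by simp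

lemma shift_closedD: "shift_closed T V \<Longrightarrow> A \<in> V \<Longrightarrow> shO A \<in> V"
  by (simp add: shift_closed_def)

lemma Susp_least:
  assumes "V \<subseteq> Ob C" "\<S> \<subseteq> V" "ext_closed C T V" "shift_closed T V" "coprod_closed U C V"
  shows "Susp U C T \<S> \<subseteq> V"
  unfolding Susp_def using assms by (intro Inter_lower) simp

lemma SuspI:
  assumes "\<And>V. V \<subseteq> Ob C \<Longrightarrow> \<S> \<subseteq> V \<Longrightarrow> ext_closed C T V \<Longrightarrow> shift_closed T V \<Longrightarrow>
    coprod_closed U C V \<Longrightarrow> A \<in> V"
  shows "A \<in> Susp U C T \<S>"
  unfolding Susp_def using assms by (intro InterI) simp

lemma Susp_properties:
  assumes "\<S> \<subseteq> Ob C"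
  shows "Susp TYPE('u) C T \<S> \<subseteq> Ob C" "\<S> \<subseteq> Susp TYPE('u) C T \<S>" "ext_closed C T (Susp TYPE('u) C T \<S>)"
    "shift_closed T (Susp TYPE('u) C T \<S>)" "coprod_closed TYPE('u) C (Susp TYPE('u) C T \<S>)"
proof -
  show "Susp TYPE('u) C T \<S> \<subseteq> Ob C"
  \<comment> \<open>The set \<open>Ob C\<close> meets all the closure conditions, so the
    intersection defining \<open>Susp\<close> runs over a non-empty family.\<close>
  proof (rule Susp_least[OF order_refl assms])
    show "ext_closed C T (Ob C)"
      unfolding ext_closed_def using dist_Ob(2) by auto
    show "shift_closed T (Ob C)"
      unfolding shift_closed_def by simp
    show "coprod_closed TYPE('u) C (Ob C)"
      unfolding coprod_closed_def by (intro allI impI) (rule is_coproduct_injection(1))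
  qed
  show "\<S> \<subseteq> Susp TYPE('u) C T \<S>"
    by (intro subsetI SuspI) (rule subsetD)
  show "ext_closed C T (Susp TYPE('u) C T \<S>)"
    unfolding ext_closed_def
  proof clarify
    fix f g h assume t: "(f, g, h) \<in> dist T"
      and f: "Dom C f \<in> Susp TYPE('u) C T \<S>" and g: "Cod C g \<in> Susp TYPE('u) C T \<S>"
    show "Cod C f \<in> Susp TYPE('u) C T \<S>"
    proof (rule SuspI)
      fix V assume V: "V \<subseteq> Ob C" "\<S> \<subseteq> V" "ext_closed C T V" "shift_closed T V"
        "coprod_closed TYPE('u) C V"
      note * = subsetD[OF Susp_least[OF V]]
      show "Cod C f \<in> V"
        by (rule ext_closedD[OF V(3) t *[OF f] *[OF g]])
    qed
  qed
  show "shift_closed T (Susp TYPE('u) C T \<S>)"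
    unfolding shift_closed_def
  proof
    fix A assume A: "A \<in> Susp TYPE('u) C T \<S>"
    show "shO A \<in> Susp TYPE('u) C T \<S>"
    proof (rule SuspI)
      fix V assume V: "V \<subseteq> Ob C" "\<S> \<subseteq> V" "ext_closed C T V" "shift_closed T V"
        "coprod_closed TYPE('u) C V"
      show "shO A \<in> V"
        by (rule shift_closedD[OF V(4) subsetD[OF Susp_least[OF V] A]])
    qed
  qed
  show "coprod_closed TYPE('u) C (Susp TYPE('u) C T \<S>)"
    unfolding coprod_closed_def
  proof (intro allI impI)
    fix J :: "'u set" and X P \<iota>
    assume J: "small TYPE('u) J" and X: "\<forall>j\<in>J. X j \<in> Susp TYPE('u) C T \<S>"
      and P: "is_coproduct C J X P \<iota>"
    show "P \<in> Susp TYPE('u) C T \<S>"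
    proof (rule SuspI)
      fix V assume V: "V \<subseteq> Ob C" "\<S> \<subseteq> V" "ext_closed C T V" "shift_closed T V"
        "coprod_closed TYPE('u) C V"
      show "P \<in> V"
        by (rule coprod_closedD[OF V(5) J _ P]) (rule subsetD[OF Susp_least[OF V] bspec[OF X]])
    qed
  qed
qed

section \<open>Vanishing of morphisms out of the generated subcategory\<close>

lemma shift_power_closedD: "shift_closed T V \<Longrightarrow> A \<in> V \<Longrightarrow> (shO ^^ n) A \<in> V"
  by (induction n) (simp_all add: shift_closedD)

lemma shift_power_Ob: "A \<in> Ob C \<Longrightarrow> (shO ^^ n) A \<in> Ob C"
  by (induction n) simp_all

text \<open>The objects without non-zero morphisms to \<open>N\<close> need not be closed under shifts; those without
  non-zero morphisms to any of the desuspensions \<open>c n\<close> of \<open>N\<close> are.\<close>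

lemma Susp_orthogonal:
  assumes S: "\<S> \<subseteq> Ob C" and N: "N \<in> Ob C"
    and orth: "\<And>A n x. A \<in> \<S> \<Longrightarrow> x \<in> Hom C ((shO ^^ n) A) N \<Longrightarrow> x = nul ((shO ^^ n) A) N"
    and A: "A \<in> Susp TYPE('u) C T \<S>" and x: "x \<in> Hom C A N"
  shows "x = nul A N"
proof -
  \<comment> \<open>Iterated desuspensions of \<open>N\<close>, determined up to isomorphism only
    and therefore obtained by dependent choice.\<close>
  have "\<exists>c. \<forall>n. (c n \<in> Ob C \<and> (n = 0 \<longrightarrow> c n = N)) \<and>
      (\<exists>e\<in>Hom C (shO (c (Suc n))) (c n). is_iso C e)"
  proof (rule dependent_nat_choice)
    show "\<exists>c. c \<in> Ob C \<and> (0 = (0 :: nat) \<longrightarrow> c = N)"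
      using N by blast
    fix c and n :: nat assume "c \<in> Ob C \<and> (n = 0 \<longrightarrow> c = N)"
    then have "c \<in> Ob C" ..
    then obtain a e where "a \<in> Ob C" "e \<in> Hom C (shO a) c" "is_iso C e"
      by (rule desuspension)
    then show "\<exists>a. (a \<in> Ob C \<and> (Suc n = 0 \<longrightarrow> a = N)) \<and> (\<exists>e\<in>Hom C (shO a) c. is_iso C e)"
      by blast
  qed
  then obtain c where c: "\<And>n. c n \<in> Ob C" "c 0 = N"
      "\<And>n. \<exists>e\<in>Hom C (shO (c (Suc n))) (c n). is_iso C e"
    by blast
  \<comment> \<open>Morphisms from \<open>shO A\<close> to \<open>c n\<close> correspond to
    morphisms from \<open>A\<close> to \<open>c (Suc n)\<close>, so a shift of the source trades for
    an index.\<close>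
  have shift: "(\<forall>x\<in>Hom C (shO A) (c n). x = nul (shO A) (c n)) \<longleftrightarrow>
      (\<forall>x\<in>Hom C A (c (Suc n)). x = nul A (c (Suc n)))" if A: "A \<in> Ob C" for A n
  proof -
    obtain e where e: "e \<in> Hom C (shO (c (Suc n))) (c n)" "is_iso C e"
      using c(3) by blast
    obtain e' where e': "e' \<in> Hom C (c n) (shO (c (Suc n)))" "e' \<cdot> e = Idt C (shO (c (Suc n)))"
        "e \<cdot> e' = Idt C (c n)"
      using is_isoE[OF e(2,1)] .
    note sA = shO_Ob[OF A]
    show ?thesis
    proof (intro iffI ballI)
      fix x assume *: "\<forall>x\<in>Hom C (shO A) (c n). x = nul (shO A) (c n)" and x: "x \<in> Hom C A (c (Suc n))"
      note sx = shA_Hom[OF x]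
      have "shA x = e' \<cdot> (e \<cdot> shA x)"
        using Hom_assoc[OF e'(1) e(1) sx] e'(2) Hom_Idt(2)[OF sx] by simp
      also have "e \<cdot> shA x = nul (shO A) (c n)"
        by (rule bspec[OF * cmp_Hom[OF e(1) sx]])
      also have "e' \<cdot> nul (shO A) (c n) = shA (nul A (c (Suc n)))"
        using cmp_nul[OF e'(1) sA] shA_nul[OF A c(1)] by simp
      finally show "x = nul A (c (Suc n))"
        by (rule shA_inject[OF x nul_Hom[OF A c(1)]])
    next
      fix x assume *: "\<forall>x\<in>Hom C A (c (Suc n)). x = nul A (c (Suc n))" and x: "x \<in> Hom C (shO A) (c n)"
      obtain y where y: "y \<in> Hom C A (c (Suc n))" "shA y = e' \<cdot> x"
        using shA_full[OF cmp_Hom[OF e'(1) x] A c(1)] .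
      have "x = e \<cdot> (e' \<cdot> x)"
        using Hom_assoc[OF e(1) e'(1) x] e'(3) Hom_Idt(2)[OF x] by simp
      also have "e' \<cdot> x = nul (shO A) (shO (c (Suc n)))"
        using y(2) shA_nul[OF A c(1)] unfolding bspec[OF * y(1)] by simp
      also have "e \<cdot> nul (shO A) (shO (c (Suc n))) = nul (shO A) (c n)"
        by (rule cmp_nul[OF e(1) sA])
      finally show "x = nul (shO A) (c n)" .
    qed
  qed
  define V where "V = {A \<in> Ob C. \<forall>n. \<forall>x\<in>Hom C A (c n). x = nul A (c n)}"
  have VOb: "V \<subseteq> Ob C"
    unfolding V_def by blast
  have "Susp TYPE('u) C T \<S> \<subseteq> V"
  proof (rule Susp_least[OF VOb])
    \<comment> \<open>The assumption concerns all shifts of \<open>A\<close> at once, so that it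
      passes from \<open>A\<close> to \<open>shO A\<close> in the induction on
      \<open>n\<close>.\<close>
    have "\<forall>x\<in>Hom C A (c n). x = nul A (c n)"
      if "A \<in> Ob C" "\<And>k x. x \<in> Hom C ((shO ^^ k) A) (c 0) \<Longrightarrow> x = nul ((shO ^^ k) A) (c 0)" for A n
      using that
    proof (induction n arbitrary: A)
      case 0
      show ?case
        using 0(2)[of _ 0] by simp
    next
      case (Suc n)
      have "\<forall>x\<in>Hom C (shO A) (c n). x = nul (shO A) (c n)"
      proof (rule Suc.IH[OF shO_Ob[OF Suc.prems(1)]])
        show "x = nul ((shO ^^ k) (shO A)) (c 0)" if "x \<in> Hom C ((shO ^^ k) (shO A)) (c 0)" for k x
          using Suc.prems(2)[of x "Suc k"] that by (simp add: funpow_swap1)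
      qed
      then show ?case
        using shift[OF Suc.prems(1)] by simp
    qed
    then show "\<S> \<subseteq> V"
      unfolding V_def using S orth c(2) by auto
    show "shift_closed T V"
      unfolding shift_closed_def V_def using shift by auto
    show "ext_closed C T V"
      unfolding ext_closed_def
    proof clarify
      fix f g h assume t: "(f, g, h) \<in> dist T" and f: "Dom C f \<in> V" and g: "Cod C g \<in> V"
      have "x = nul (Cod C f) (c n)" if x: "x \<in> Hom C (Cod C f) (c n)" for n x
      proof -
        have "x \<cdot> f = nul (Dom C f) (c n)"
          using f cmp_Hom[OF x dist_Hom(1)[OF t]] unfolding V_def by simp
        then obtain y where y: "y \<in> Hom C (Cod C g) (c n)" "y \<cdot> g = x"
          using dist_weak_cokernel[OF t x] by metis
        have "y = nul (Cod C g) (c n)"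
          using g y(1) unfolding V_def by simp
        then show ?thesis
          using y(2) nul_cmp[OF dist_Hom(2)[OF t] c(1)] by simp
      qed
      then show "Cod C f \<in> V"
        unfolding V_def using dist_Ob(2)[OF t] by simp
    qed
    show "coprod_closed TYPE('u) C V"
      unfolding coprod_closed_def
    proof (intro allI impI)
      fix J :: "'u set" and X P \<iota> assume X: "\<forall>j\<in>J. X j \<in> V" and P: "is_coproduct C J X P \<iota>"
      note p = is_coproduct_injection[OF P]
      have "x = nul P (c n)" if x: "x \<in> Hom C P (c n)" for n x
      proof (rule is_coproduct_eqI[OF P x nul_Hom[OF p(1) c(1)]])
        fix j assume j: "j \<in> J"
        have "x \<cdot> \<iota> j = nul (X j) (c n)"
          using X j cmp_Hom[OF x p(3)[OF j]] unfolding V_def by simp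
        then show "x \<cdot> \<iota> j = nul P (c n) \<cdot> \<iota> j"
          using nul_cmp[OF p(3)[OF j] c(1)] by simp
      qed
      then show "P \<in> V"
        unfolding V_def using p(1) by simp
    qed
  qed
  then have "A \<in> V"
    using A by blast
  then show ?thesis
    using x c(2) unfolding V_def by blast
qed

section \<open>Iterated extensions and the tower over an object\<close>

lemma shift_coproducts_subset_Susp:
  assumes "\<S> \<subseteq> Ob C"
  shows "shift_coproducts TYPE('u) C T \<S> \<subseteq> Susp TYPE('u) C T \<S>"
proof
  note S = Susp_properties[OF assms, where 'u = 'u]
  fix P assume "P \<in> shift_coproducts TYPE('u) C T \<S>"
  then obtain J :: "'u set" and X \<iota> where J: "small TYPE('u) J" and P: "is_coproduct C J X P \<iota>"
    and X: "\<forall>j\<in>J. \<exists>A\<in>\<S>. \<exists>n. X j = (shO ^^ n) A"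
    unfolding shift_coproducts_def by blast
  have "X j \<in> Susp TYPE('u) C T \<S>" if "j \<in> J" for j
    using X that shift_power_closedD[OF S(4)] S(2) by force
  then show "P \<in> Susp TYPE('u) C T \<S>"
    by (rule coprod_closedD[OF S(5) J _ P])
qed

lemma fold_ext_subset_Susp:
  assumes "\<S> \<subseteq> Ob C"
  shows "fold_ext TYPE('u) C T \<S> n \<subseteq> Susp TYPE('u) C T \<S>"
proof (induction n)
  case 0
  show ?case
    unfolding fold_ext.simps by (rule shift_coproducts_subset_Susp[OF assms])
next
  case (Suc n)
  show ?case
  proof
    fix E assume "E \<in> fold_ext TYPE('u) C T \<S> (Suc n)"
    then have "\<exists>(f, g, h)\<in>dist T. Dom C f \<in> fold_ext TYPE('u) C T \<S> n \<and> Cod C f = E \<and>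
        Cod C g \<in> shift_coproducts TYPE('u) C T \<S>"
      unfolding fold_ext.simps mem_Collect_eq .
    then obtain f g h where t: "(f, g, h) \<in> dist T" and f: "Dom C f \<in> fold_ext TYPE('u) C T \<S> n"
      and E: "Cod C f = E" and g: "Cod C g \<in> shift_coproducts TYPE('u) C T \<S>"
      by blast
    show "E \<in> Susp TYPE('u) C T \<S>"
      using ext_closedD[OF Susp_properties(3)[OF assms] t subsetD[OF Suc f]
          subsetD[OF shift_coproducts_subset_Susp[OF assms] g]] E by simp
  qed
qed

text \<open>Take one summand for every pair of a shift of an object of \<open>\<S>\<close> and a
  morphism from it to \<open>N\<close>. The index set is small because there are only countably many
  shifts of each object and the morphism sets are small.\<close>

lemma shift_coproduct_cover:
  assumes U: "regular_universe TYPE('u)" and C: "has_small_coproducts TYPE('u) C"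
    and ls: "locally_small TYPE('u) C" and small: "small TYPE('u) \<S>" and S: "\<S> \<subseteq> Ob C"
    and N: "N \<in> Ob C"
  obtains P \<phi> where "P \<in> shift_coproducts TYPE('u) C T \<S>" "\<phi> \<in> Hom C P N"
    "\<And>A n g. A \<in> \<S> \<Longrightarrow> g \<in> Hom C ((shO ^^ n) A) N \<Longrightarrow> \<exists>g'\<in>Hom C ((shO ^^ n) A) P. \<phi> \<cdot> g' = g"
proof -
  define G where "G = (\<lambda>(A, n). (shO ^^ n) A) ` (\<S> \<times> (UNIV :: nat set))"
  have GOb: "A \<in> Ob C" if "A \<in> G" for A
    using that S shift_power_Ob unfolding G_def by auto
  have "small TYPE('u) G"
    unfolding G_def by (intro small_image small_Sigma[OF U small] countable_small[OF U countableI_type])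
  then have "small TYPE('u) (SIGMA A:G. Hom C A N)"
    by (rule small_Sigma[OF U]) (use ls GOb N in \<open>auto simp: locally_small_def\<close>)
  then obtain J :: "'u set" and e where e: "bij_betw e J (SIGMA A:G. Hom C A N)" and J: "small TYPE('u) J"
    by (rule small_indexE)
  have eJ: "fst (e j) \<in> G" "snd (e j) \<in> Hom C (fst (e j)) N" if "j \<in> J" for j
    using bij_betwE[OF e] that by (auto simp: split_beta)
  have fst_Ob: "fst (e j) \<in> Ob C" if "j \<in> J" for j
    by (rule GOb[OF eJ(1)[OF that]])
  obtain P \<iota> where P: "is_coproduct C J (\<lambda>j. fst (e j)) P \<iota>"
    using small_coproduct_exists[OF C J, of "\<lambda>j. fst (e j)"] fst_Ob by blast
  obtain \<phi> where \<phi>: "\<phi> \<in> Hom C P N" "\<And>j. j \<in> J \<Longrightarrow> \<phi> \<cdot> \<iota> j = snd (e j)"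
    using is_coproduct_copair[OF P N, of "\<lambda>j. snd (e j)"] eJ(2) by blast
  show thesis
  proof (rule that[OF _ \<phi>(1)])
    have "\<forall>j\<in>J. \<exists>A\<in>\<S>. \<exists>n. fst (e j) = (shO ^^ n) A"
      using eJ(1) unfolding G_def by fastforce
    then show "P \<in> shift_coproducts TYPE('u) C T \<S>"
      unfolding shift_coproducts_def by (intro CollectI exI conjI) (rule J, assumption, rule P)
    fix A n g assume A: "A \<in> \<S>" and g: "g \<in> Hom C ((shO ^^ n) A) N"
    have "((shO ^^ n) A, g) \<in> (SIGMA A:G. Hom C A N)"
      using A g unfolding G_def by auto
    then obtain j where j: "j \<in> J" "e j = ((shO ^^ n) A, g)"
      using bij_betw_imp_surj_on[OF e] by (metis imageE)
    show "\<exists>g'\<in>Hom C ((shO ^^ n) A) P. \<phi> \<cdot> g' = g"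
      using is_coproduct_injection(3)[OF P j(1)] \<phi>(2)[OF j(1)] j(2) by auto
  qed
qed

text \<open>The object \<open>E\<close> is the fibre of
  \<open>P \<rightarrow> N \<rightarrow> shO X\<close>, where \<open>N\<close> is the cone of
  \<open>u\<close> and \<open>P\<close> covers \<open>N\<close>. The identity of \<open>X\<close>
  and \<open>\<phi>\<close> are compatible outer maps of triangles, and the middle map they induce
  extends \<open>u\<close>. A morphism \<open>l\<close> killed by \<open>shA u\<close> comes from
  \<open>N\<close>, hence from \<open>P\<close>, and \<open>shA a\<close> kills everything that
  comes from \<open>P\<close>.\<close>

lemma extension_step:
  assumes U: "regular_universe TYPE('u)" and C: "has_small_coproducts TYPE('u) C"
    and ls: "locally_small TYPE('u) C" and small: "small TYPE('u) \<S>" and S: "\<S> \<subseteq> Ob C"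
    and u: "u \<in> Hom C X M"
  obtains E u' a b w where "(a, b, w) \<in> dist T" "a \<in> Hom C X E"
    "Cod C b \<in> shift_coproducts TYPE('u) C T \<S>" "u' \<in> Hom C E M" "u' \<cdot> a = u"
    "\<forall>A\<in>\<S>. \<forall>n. \<forall>l\<in>Hom C ((shO ^^ n) A) (shO X).
      shA u \<cdot> l = nul ((shO ^^ n) A) (shO M) \<longrightarrow> shA a \<cdot> l = nul ((shO ^^ n) A) (shO E)"
proof -
  have X: "X \<in> Ob C" and M: "M \<in> Ob C"
    using Hom_Ob[OF u] .
  obtain N v w\<^sub>0 where t: "(u, v, w\<^sub>0) \<in> dist T" and v: "v \<in> Hom C M N" and w\<^sub>0: "w\<^sub>0 \<in> Hom C N (shO X)"
    using dist_complete[OF u] .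
  obtain P \<phi> where P: "P \<in> shift_coproducts TYPE('u) C T \<S>" and \<phi>: "\<phi> \<in> Hom C P N"
      "\<And>A n g. A \<in> \<S> \<Longrightarrow> g \<in> Hom C ((shO ^^ n) A) N \<Longrightarrow> \<exists>g'\<in>Hom C ((shO ^^ n) A) P. \<phi> \<cdot> g' = g"
    using shift_coproduct_cover[OF U C ls small S Hom_Ob(2)[OF v]] by blast
  define w where "w = w\<^sub>0 \<cdot> \<phi>"
  have w: "w \<in> Hom C P (shO X)"
    unfolding w_def by (rule cmp_Hom[OF w\<^sub>0 \<phi>(1)])
  obtain E a b where t': "(a, b, w) \<in> dist T" and a: "a \<in> Hom C X E" and b: "b \<in> Hom C E P"
    using dist_fibre[OF w X] .
  have "shA (Idt C X) \<cdot> w = w\<^sub>0 \<cdot> \<phi>"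
    using X Hom_Idt(2)[OF w] w_def by simp
  then obtain u' where u': "u' \<in> Hom C E M" "u' \<cdot> a = u \<cdot> Idt C X"
    using dist_extend_morphism[OF t' t, unfolded Hom_Dom_Cod[OF u] Hom_Dom_Cod[OF v]
        Hom_Dom_Cod[OF a] Hom_Dom_Cod[OF b], OF Idt_Hom[OF X] \<phi>(1)] by metis
  note su = shA_Hom[OF u] and sa = shA_Hom[OF a]
  show thesis
  proof (rule that[OF t' a _ u'(1)])
    show "Cod C b \<in> shift_coproducts TYPE('u) C T \<S>"
      using P Hom_Dom_Cod(2)[OF b] by simp
    show "u' \<cdot> a = u"
      using u'(2) Hom_Idt(1)[OF u] by simp
    show "\<forall>A\<in>\<S>. \<forall>n. \<forall>l\<in>Hom C ((shO ^^ n) A) (shO X).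
      shA u \<cdot> l = nul ((shO ^^ n) A) (shO M) \<longrightarrow> shA a \<cdot> l = nul ((shO ^^ n) A) (shO E)"
    proof (intro ballI allI impI)
      fix A n l assume A: "A \<in> \<S>" and l: "l \<in> Hom C ((shO ^^ n) A) (shO X)"
        and eq: "shA u \<cdot> l = nul ((shO ^^ n) A) (shO M)"
      note AOb = Hom_Ob(1)[OF l]
      have "\<ominus> (shA u) \<cdot> l = nul ((shO ^^ n) A) (shO M)"
        using neg_cmp[OF su l] eq neg_nul[OF AOb shO_Ob[OF M]] by simp
      \<comment> \<open>Two rotations put \<open>w\<^sub>0\<close> in front of
        \<open>\<ominus> (shA u)\<close>, so what \<open>shA u\<close> kills lifts along
        \<open>w\<^sub>0\<close> to the cone.\<close>
      then obtain m where m: "m \<in> Hom C ((shO ^^ n) A) N" "w\<^sub>0 \<cdot> m = l"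
        using dist_weak_kernel[OF dist_rotate[OF dist_rotate[OF t]], unfolded Hom_Dom_Cod[OF w\<^sub>0]
            Hom_Dom_Cod[OF neg_Hom[OF su]], OF l] by metis
      obtain m' where m': "m' \<in> Hom C ((shO ^^ n) A) P" "\<phi> \<cdot> m' = m"
        using \<phi>(2)[OF A m(1)] by blast
      have "w \<cdot> m' = l"
        unfolding w_def using Hom_assoc[OF w\<^sub>0 \<phi>(1) m'(1)] m(2) m'(2) by simp
      moreover have "\<ominus> (shA a) \<cdot> w = nul P (shO E)"
        using dist_cmp_nul[OF dist_rotate[OF dist_rotate[OF t']]] Hom_Dom_Cod[OF w]
          Hom_Dom_Cod[OF neg_Hom[OF sa]] by simp
      ultimately have "\<ominus> (shA a) \<cdot> l = nul ((shO ^^ n) A) (shO E)"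
        using Hom_assoc[OF neg_Hom[OF sa] w m'(1)] nul_cmp[OF m'(1) Hom_Ob(2)[OF sa]] by simp
      then have "\<ominus> (shA a \<cdot> l) = \<ominus> (nul ((shO ^^ n) A) (shO E))"
        using neg_cmp[OF sa l] neg_nul[OF AOb Hom_Ob(2)[OF sa]] by simp
      then show "shA a \<cdot> l = nul ((shO ^^ n) A) (shO E)"
        by (rule neg_inject[OF cmp_Hom[OF sa l] nul_Hom[OF AOb Hom_Ob(2)[OF sa]]])
    qed
  qed
qed

text \<open>Iterate \<open>extension_step\<close>, starting from a cover of \<open>M\<close>.
  Dependent choice is applied to pairs of an object and its morphism to \<open>M\<close>; the
  transition maps merely exist in \<open>succ\<close> and are chosen once the pairs are
  fixed.\<close>

lemma extension_tower:
  assumes U: "regular_universe TYPE('u)" and C: "has_small_coproducts TYPE('u) C"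
    and ls: "locally_small TYPE('u) C" and small: "small TYPE('u) \<S>" and S: "\<S> \<subseteq> Ob C"
    and M: "M \<in> Ob C"
  obtains L f u where "\<forall>i. L i \<in> fold_ext TYPE('u) C T \<S> i"
    "\<forall>i. f i \<in> Hom C (L i) (L (Suc i))" "\<forall>i. u i \<in> Hom C (L i) M" "\<forall>i. u (Suc i) \<cdot> f i = u i"
    "\<forall>A\<in>\<S>. \<forall>n. \<forall>g\<in>Hom C ((shO ^^ n) A) M. \<exists>g'\<in>Hom C ((shO ^^ n) A) (L 0). u 0 \<cdot> g' = g"
    "\<forall>i. \<forall>A\<in>\<S>. \<forall>n. \<forall>l\<in>Hom C ((shO ^^ n) A) (shO (L i)).
      shA (u i) \<cdot> l = nul ((shO ^^ n) A) (shO M) \<longrightarrow>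
      shA (f i) \<cdot> l = nul ((shO ^^ n) A) (shO (L (Suc i)))"
proof -
  define surj where "surj X u \<longleftrightarrow> (\<forall>A\<in>\<S>. \<forall>n. \<forall>g\<in>Hom C ((shO ^^ n) A) M.
    \<exists>g'\<in>Hom C ((shO ^^ n) A) X. u \<cdot> g' = g)" for X u
  define kill where "kill X u E a \<longleftrightarrow> (\<forall>A\<in>\<S>. \<forall>n. \<forall>l\<in>Hom C ((shO ^^ n) A) (shO X).
    shA u \<cdot> l = nul ((shO ^^ n) A) (shO M) \<longrightarrow> shA a \<cdot> l = nul ((shO ^^ n) A) (shO E))" for X u E a
  \<comment> \<open>Lifting of morphisms into \<open>M\<close> is recorded at stage 0 alone, since a
    lift to \<open>L 0\<close> can be pushed on to every later stage.\<close>
  define stage where "stage i Xu \<longleftrightarrow> fst Xu \<in> fold_ext TYPE('u) C T \<S> i \<and>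
    snd Xu \<in> Hom C (fst Xu) M \<and> (i = 0 \<longrightarrow> surj (fst Xu) (snd Xu))" for i Xu
  define succ where "succ Xu Xu' \<longleftrightarrow> (\<exists>a. a \<in> Hom C (fst Xu) (fst Xu') \<and> snd Xu' \<cdot> a = snd Xu \<and>
    kill (fst Xu) (snd Xu) (fst Xu') a)" for Xu Xu'
  have "\<exists>Xu. \<forall>i. stage i (Xu i) \<and> succ (Xu i) (Xu (Suc i))"
  proof (rule dependent_nat_choice)
    obtain P \<phi> where P: "P \<in> shift_coproducts TYPE('u) C T \<S>" and \<phi>: "\<phi> \<in> Hom C P M"
      and cover: "\<And>A n g. A \<in> \<S> \<Longrightarrow> g \<in> Hom C ((shO ^^ n) A) M \<Longrightarrow>
        \<exists>g'\<in>Hom C ((shO ^^ n) A) P. \<phi> \<cdot> g' = g"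
      using shift_coproduct_cover[OF U C ls small S M] by blast
    have "surj P \<phi>"
      unfolding surj_def by (intro ballI allI) (rule cover)
    then have "stage 0 (P, \<phi>)"
      unfolding stage_def using P \<phi> by simp
    then show "\<exists>Xu. stage 0 Xu" ..
    fix Xu i assume "stage i Xu"
    then have X: "fst Xu \<in> fold_ext TYPE('u) C T \<S> i" and u: "snd Xu \<in> Hom C (fst Xu) M"
      unfolding stage_def by simp_all
    obtain a b w E u' where t: "(a, b, w) \<in> dist T" and a: "a \<in> Hom C (fst Xu) E"
      and b: "Cod C b \<in> shift_coproducts TYPE('u) C T \<S>" and u': "u' \<in> Hom C E M" "u' \<cdot> a = snd Xu"
      and "\<forall>A\<in>\<S>. \<forall>n. \<forall>l\<in>Hom C ((shO ^^ n) A) (shO (fst Xu)).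
        shA (snd Xu) \<cdot> l = nul ((shO ^^ n) A) (shO M) \<longrightarrow> shA a \<cdot> l = nul ((shO ^^ n) A) (shO E)"
      by (rule extension_step[OF U C ls small S u]) (rule that; assumption)
    then have kill: "kill (fst Xu) (snd Xu) E a"
      unfolding kill_def by simp
    have "E \<in> fold_ext TYPE('u) C T \<S> (Suc i)"
      unfolding fold_ext.simps mem_Collect_eq
      by (rule bexI[OF _ t]) (use b X Hom_Dom_Cod[OF a] in simp)
    then have "stage (Suc i) (E, u')"
      unfolding stage_def using u' by simp
    moreover have "succ Xu (E, u')"
      unfolding succ_def fst_conv snd_conv using a u'(2) kill by (intro exI conjI)
    ultimately show "\<exists>Xu'. stage (Suc i) Xu' \<and> succ Xu Xu'"
      by (intro exI conjI)
  qed
  then obtain Xu where Xu: "\<forall>i. stage i (Xu i) \<and> succ (Xu i) (Xu (Suc i))" ..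
  then have stage: "stage i (Xu i)" for i
    by simp
  from Xu have "\<forall>i. \<exists>a. a \<in> Hom C (fst (Xu i)) (fst (Xu (Suc i))) \<and>
      snd (Xu (Suc i)) \<cdot> a = snd (Xu i) \<and> kill (fst (Xu i)) (snd (Xu i)) (fst (Xu (Suc i))) a"
    unfolding succ_def by simp
  from choice[OF this] obtain f where f: "\<forall>i. f i \<in> Hom C (fst (Xu i)) (fst (Xu (Suc i))) \<and>
      snd (Xu (Suc i)) \<cdot> f i = snd (Xu i) \<and>
      kill (fst (Xu i)) (snd (Xu i)) (fst (Xu (Suc i))) (f i)" ..
  show thesis
  proof (rule that[of "\<lambda>i. fst (Xu i)" f "\<lambda>i. snd (Xu i)"])
    show "\<forall>i. fst (Xu i) \<in> fold_ext TYPE('u) C T \<S> i" "\<forall>i. snd (Xu i) \<in> Hom C (fst (Xu i)) M"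
      using stage unfolding stage_def by simp_all
    show "\<forall>A\<in>\<S>. \<forall>n. \<forall>g\<in>Hom C ((shO ^^ n) A) M.
        \<exists>g'\<in>Hom C ((shO ^^ n) A) (fst (Xu 0)). snd (Xu 0) \<cdot> g' = g"
      using stage[of 0] unfolding stage_def surj_def by simp
    show "\<forall>i. f i \<in> Hom C (fst (Xu i)) (fst (Xu (Suc i)))" "\<forall>i. snd (Xu (Suc i)) \<cdot> f i = snd (Xu i)"
      using f by simp_all
    have "\<forall>i. kill (fst (Xu i)) (snd (Xu i)) (fst (Xu (Suc i))) (f i)"
      using f by simp
    then show "\<forall>i. \<forall>A\<in>\<S>. \<forall>n. \<forall>l\<in>Hom C ((shO ^^ n) A) (shO (fst (Xu i))).
        shA (snd (Xu i)) \<cdot> l = nul ((shO ^^ n) A) (shO M) \<longrightarrow>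
        shA (f i) \<cdot> l = nul ((shO ^^ n) A) (shO (fst (Xu (Suc i))))"
      unfolding kill_def .
  qed
qed

text \<open>This is the truncation triangle of \<open>M\<close> for the aisle. Vanishing of
  morphisms into the cone is checked on the shifts of the generators and spreads to all of
  \<open>Susp\<close> by \<open>Susp_orthogonal\<close>.\<close>

lemma Susp_approximation:
  assumes U: "regular_universe TYPE('u)" and C: "has_small_coproducts TYPE('u) C"
    and ls: "locally_small TYPE('u) C" and small: "small TYPE('u) \<S>"
    and compact: "\<And>A. A \<in> \<S> \<Longrightarrow> compact_ob TYPE('u) C T A"
    and M: "M \<in> Ob C"
  obtains L f Y u v w where "\<And>i. L i \<in> fold_ext TYPE('u) C T \<S> i"
    "\<And>i. f i \<in> Hom C (L i) (L (Suc i))" "is_Mcolim C T L f Y" "Y \<in> Susp TYPE('u) C T \<S>"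
    "(u, v, w) \<in> dist T" "u \<in> Hom C Y M"
    "\<And>A x. A \<in> Susp TYPE('u) C T \<S> \<Longrightarrow> x \<in> Hom C A (Cod C v) \<Longrightarrow> x = nul A (Cod C v)"
proof -
  have S: "\<S> \<subseteq> Ob C"
    using compact unfolding compact_ob_def by blast
  note Susp = Susp_properties[OF S, where 'u = 'u]
  obtain L f u where tower: "\<forall>i. L i \<in> fold_ext TYPE('u) C T \<S> i"
      "\<forall>i. f i \<in> Hom C (L i) (L (Suc i))" "\<forall>i. u i \<in> Hom C (L i) M" "\<forall>i. u (Suc i) \<cdot> f i = u i"
    and surj: "\<forall>A\<in>\<S>. \<forall>n. \<forall>g\<in>Hom C ((shO ^^ n) A) M.
      \<exists>g'\<in>Hom C ((shO ^^ n) A) (L 0). u 0 \<cdot> g' = g"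
    and kill: "\<forall>i. \<forall>A\<in>\<S>. \<forall>n. \<forall>l\<in>Hom C ((shO ^^ n) A) (shO (L i)).
      shA (u i) \<cdot> l = nul ((shO ^^ n) A) (shO M) \<longrightarrow>
      shA (f i) \<cdot> l = nul ((shO ^^ n) A) (shO (L (Suc i)))"
    by (rule extension_tower[OF U C ls small S M]) (rule that; assumption)
  note L = spec[OF tower(1)] and f = spec[OF tower(2)] and u = spec[OF tower(3)] spec[OF tower(4)]
  have nat_small: "small TYPE('u) (UNIV :: nat set)"
    by (rule countable_small[OF U countableI_type])
  obtain Q \<iota> where Q: "is_coproduct C UNIV L Q \<iota>"
    using small_coproduct_exists[OF C nat_small, of L] Hom_Ob(1)[OF f] by blast
  have QOb: "Q \<in> Ob C" and \<iota>: "\<And>n. \<iota> n \<in> Hom C (L n) Q"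
    using is_coproduct_injection[OF Q] by auto
  obtain \<sigma> where \<sigma>: "\<sigma> \<in> Hom C Q Q" "\<And>n. \<sigma> \<cdot> \<iota> n = \<iota> (Suc n) \<cdot> f n"
    using is_coproduct_copair[OF Q QOb cmp_Hom[OF \<iota> f]] by (metis UNIV_I)
  note I = Idt_Hom[OF QOb]
  note d = plus_Hom[OF I neg_Hom[OF \<sigma>(1)]]
  obtain Y p q where t: "(Idt C Q \<oplus> \<ominus> \<sigma>, p, q) \<in> dist T" and p: "p \<in> Hom C Q Y" and q: "q \<in> Hom C Y (shO Q)"
    using dist_complete[OF d] .
  have Mcolim: "is_Mcolim C T L f Y"
    unfolding is_Mcolim_def using Q \<sigma> t Hom_Dom_Cod(2)[OF p] by blast
  have "Q \<in> Susp TYPE('u) C T \<S>"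
    by (rule coprod_closedD[OF Susp(5) nat_small _ Q]) (use L fold_ext_subset_Susp[OF S] in blast)
  \<comment> \<open>The rotated triangle \<open>Q \<rightarrow> Y \<rightarrow> shO Q\<close> shows
    \<open>Y\<close> to be an extension of \<open>shO Q\<close> by \<open>Q\<close>.\<close>
  then have Y: "Y \<in> Susp TYPE('u) C T \<S>"
    using ext_closedD[OF Susp(3) dist_rotate[OF t]] shift_closedD[OF Susp(4)]
    unfolding Hom_Dom_Cod[OF p] Hom_Dom_Cod[OF q] by simp
  obtain u' where u': "u' \<in> Hom C Q M" "\<And>n. u' \<cdot> \<iota> n = u n"
    using is_coproduct_copair[OF Q M u(1)] by (metis UNIV_I)
  \<comment> \<open>The morphisms \<open>u n\<close> form a cocone, so the induced \<open>u'\<close>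
    kills \<open>1 - \<sigma>\<close> and extends along \<open>p\<close> to the Milnor
    colimit.\<close>
  have "u' \<cdot> \<sigma> = u'"
  proof (rule is_coproduct_eqI[OF Q cmp_Hom[OF u'(1) \<sigma>(1)] u'(1)])
    show "u' \<cdot> \<sigma> \<cdot> \<iota> n = u' \<cdot> \<iota> n" for n
      using Hom_assoc[OF u'(1) \<sigma>(1) \<iota>, of n] Hom_assoc[OF u'(1) \<iota> f, of n] \<sigma>(2)[of n]
        u'(2)[of n] u'(2)[of "Suc n"] u(2)[of n] by simp
  qed
  then have "u' \<cdot> (Idt C Q \<oplus> \<ominus> \<sigma>) = nul Q M"
    using cmp_plus[OF u'(1) I neg_Hom[OF \<sigma>(1)]] cmp_neg[OF u'(1) \<sigma>(1)] Hom_Idt(1)[OF u'(1)]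
      neg_plus(1)[OF u'(1)] by simp
  then obtain c where c: "c \<in> Hom C Y M" "c \<cdot> p = u'"
    using dist_weak_cokernel[OF t, unfolded Hom_Dom_Cod[OF p] Hom_Dom_Cod[OF d], OF u'(1)] by metis
  obtain N v w where t': "(c, v, w) \<in> dist T" and v: "v \<in> Hom C M N" and w: "w \<in> Hom C N (shO Y)"
    using dist_complete[OF c(1)] .
  note N = Hom_Ob(2)[OF v] and sc = shA_Hom[OF c(1)]
  note p\<iota> = cmp_Hom[OF p \<iota>]
  have c_p\<iota>: "c \<cdot> (p \<cdot> \<iota> n) = u n" for n
    using Hom_assoc[OF c(1) p \<iota>, of n] c(2) u'(2) by simp
  have p\<iota>_Suc: "p \<cdot> \<iota> (Suc n) \<cdot> f n = p \<cdot> \<iota> n" for n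
    using Hom_assoc[OF p \<sigma>(1) \<iota>, of n] Hom_assoc[OF p \<iota> f, of n] \<sigma>(2)[of n]
      Mcolim_cocone[OF \<sigma>(1) t p] by simp
  \<comment> \<open>First \<open>w \<cdot> g\<close> is shown to vanish: it comes from some stage
    \<open>i\<close> and dies at stage \<open>Suc i\<close>. Then \<open>g\<close> comes from
    \<open>M\<close>, hence from \<open>Y\<close> through \<open>L 0\<close>, and
    \<open>v \<cdot> c\<close> is zero.\<close>
  have orth: "g = nul ((shO ^^ n) A) N" if A: "A \<in> \<S>" and g: "g \<in> Hom C ((shO ^^ n) A) N" for A n g
  proof -
    let ?A = "(shO ^^ n) A"
    note AOb = Hom_Ob(1)[OF g]
    have "weakly_compact TYPE('u) ?A"
      by (induction n) (simp_all add: weakly_compact_if_compact[OF compact[OF A]] weakly_compact_shift[OF C])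
    then obtain i x where x: "x \<in> Hom C ?A (shO (L i))" "w \<cdot> g = shA (p \<cdot> \<iota> i) \<cdot> x"
      using hom_to_shift_Mcolim_factors[OF U _ Q f \<sigma> t p cmp_Hom[OF w g]] by metis
    have "\<ominus> (shA c) \<cdot> w = nul N (shO M)"
      using dist_cmp_nul[OF dist_rotate[OF dist_rotate[OF t']]] Hom_Dom_Cod[OF w]
        Hom_Dom_Cod[OF neg_Hom[OF sc]] by simp
    then have "\<ominus> (shA c \<cdot> w) = \<ominus> (nul N (shO M))"
      using neg_cmp[OF sc w] neg_nul[OF N shO_Ob[OF M]] by simp
    then have cw: "shA c \<cdot> w = nul N (shO M)"
      by (rule neg_inject[OF cmp_Hom[OF sc w] nul_Hom[OF N shO_Ob[OF M]]])
    have "shA (u i) \<cdot> x = shA c \<cdot> (shA (p \<cdot> \<iota> i) \<cdot> x)"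
      using Hom_assoc[OF sc shA_Hom[OF p\<iota>] x(1)] shA_cmp[OF c(1) p\<iota>, of i] c_p\<iota>[of i] by simp
    also have "\<dots> = shA c \<cdot> w \<cdot> g"
      using Hom_assoc[OF sc w g] x(2) by simp
    also have "\<dots> = nul ?A (shO M)"
      unfolding cw by (rule nul_cmp[OF g shO_Ob[OF M]])
    finally have fx: "shA (f i) \<cdot> x = nul ?A (shO (L (Suc i)))"
      by (rule kill[rule_format, OF A x(1)])
    have "w \<cdot> g = shA (p \<cdot> \<iota> (Suc i)) \<cdot> (shA (f i) \<cdot> x)"
      using x(2) Hom_assoc[OF shA_Hom[OF p\<iota>] shA_Hom[OF f] x(1)] shA_cmp[OF p\<iota> f, of i]
        p\<iota>_Suc[of i] by simp
    also have "\<dots> = nul ?A (shO Y)"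
      unfolding fx by (rule cmp_nul[OF shA_Hom[OF p\<iota>] AOb])
    finally obtain g' where g': "g' \<in> Hom C ?A M" "v \<cdot> g' = g"
      using dist_weak_kernel[OF dist_rotate[OF t'], unfolded Hom_Dom_Cod[OF v] Hom_Dom_Cod[OF w], OF g]
      by metis
    obtain g'' where g'': "g'' \<in> Hom C ?A (L 0)" "u 0 \<cdot> g'' = g'"
      using surj[rule_format, OF A g'(1)] by blast
    note pg = cmp_Hom[OF p\<iota> g''(1)]
    have "c \<cdot> (p \<cdot> \<iota> 0 \<cdot> g'') = g'"
      using Hom_assoc[OF c(1) p\<iota> g''(1)] c_p\<iota>[of 0] g''(2) by simp
    moreover have "v \<cdot> c = nul Y N"
      using dist_cmp_nul[OF t'] unfolding Hom_Dom_Cod[OF c(1)] Hom_Dom_Cod[OF v] .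
    ultimately show ?thesis
      using Hom_assoc[OF v c(1) pg] nul_cmp[OF pg N] g'(2) by simp
  qed
  show thesis
  proof (rule that[OF L f Mcolim Y t' c(1)])
    show "x = nul A (Cod C v)" if "A \<in> Susp TYPE('u) C T \<S>" "x \<in> Hom C A (Cod C v)" for A x
      using Susp_orthogonal[OF S N orth that(1)] that(2) unfolding Hom_Dom_Cod[OF v] by blast
  qed
qed

text \<open>The approximations are coreflections into \<open>Susp\<close>, which gives the right
  adjoint. For \<open>M\<close> in \<open>Susp\<close> the identity of \<open>M\<close> lifts to a
  section of the coreflection, and uniqueness of lifts makes this section an inverse, so
  \<open>M\<close> inherits the Milnor colimit presentation.\<close>

theorem Susp_left_aisle_and_Mcolim:
  assumes U: "regular_universe TYPE('u)" and C: "has_small_coproducts TYPE('u) C"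
    and ls: "locally_small TYPE('u) C" and small: "small TYPE('u) \<S>"
    and compact: "\<And>A. A \<in> \<S> \<Longrightarrow> compact_ob TYPE('u) C T A"
  shows "left_aisle C T (Susp TYPE('u) C T \<S>)"
    and "M \<in> Susp TYPE('u) C T \<S> \<Longrightarrow> \<exists>L f.
      (\<forall>i. L i \<in> fold_ext TYPE('u) C T \<S> i \<and> f i \<in> Hom C (L i) (L (Suc i))) \<and> is_Mcolim C T L f M"
proof -
  let ?V = "Susp TYPE('u) C T \<S>"
  have S: "\<S> \<subseteq> Ob C"
    using compact unfolding compact_ob_def by blast
  note Susp = Susp_properties[OF S, where 'u = 'u]
  note approx = Susp_approximation[OF U C ls small compact]
  obtain z where z: "is_zero C z"
    using additiveD(1) ..
  \<comment> \<open>A zero object is the coproduct of the empty family, so closure under small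
    coproducts puts it into \<open>Susp\<close>.\<close>
  have empty: "is_coproduct C ({} :: nat set) X z \<iota>" for X \<iota>
    using z unfolding is_coproduct_def is_zero_def by simp
  have zV: "z \<in> ?V"
    by (rule coprod_closedD[OF Susp(5) countable_small[OF U countable_empty] _ empty]) simp
  have "\<exists>Y u. Y \<in> ?V \<and> u \<in> Hom C Y M \<and>
      (\<forall>A\<in>?V. \<forall>f\<in>Hom C A M. \<exists>!g. g \<in> Hom C A Y \<and> u \<cdot> g = f)" if M: "M \<in> Ob C" for M
  proof -
    obtain Y u v w where Y: "Y \<in> ?V" and t: "(u, v, w) \<in> dist T" and u: "u \<in> Hom C Y M"
      and orth: "\<And>A x. A \<in> ?V \<Longrightarrow> x \<in> Hom C A (Cod C v) \<Longrightarrow> x = nul A (Cod C v)"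
      using approx[OF _ M] by metis
    have "\<exists>!g. g \<in> Hom C A Y \<and> u \<cdot> g = f" if A: "A \<in> ?V" and f: "f \<in> Hom C A M" for A f
      using factorization_if_orthogonal_cone[OF t, unfolded Hom_Dom_Cod[OF u], OF f orth[OF A]
          orth[OF shift_closedD[OF Susp(4) A]]] .
    then show ?thesis
      using Y u by blast
  qed
  then obtain Y u where Y: "\<And>M. M \<in> Ob C \<Longrightarrow> Y M \<in> ?V \<and> u M \<in> Hom C (Y M) M"
    and univ: "\<And>M A f. M \<in> Ob C \<Longrightarrow> A \<in> ?V \<Longrightarrow> f \<in> Hom C A M \<Longrightarrow> \<exists>!g. g \<in> Hom C A (Y M) \<and> u M \<cdot> g = f"
    by metis
  have "\<exists>R \<epsilon>. right_adj (incl_fct C ?V) R \<epsilon>"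
    by (rule right_adj_incl_fct[OF Susp(1) Y univ])
  then show "left_aisle C T ?V"
    unfolding left_aisle_def using Susp(1,3,4) z zV by blast
  assume MV: "M \<in> ?V"
  have M: "M \<in> Ob C"
    using MV Susp(1) by blast
  obtain L f Y u v w where L: "\<And>i. L i \<in> fold_ext TYPE('u) C T \<S> i"
    and f: "\<And>i. f i \<in> Hom C (L i) (L (Suc i))" and Mcolim: "is_Mcolim C T L f Y" and Y: "Y \<in> ?V"
    and t: "(u, v, w) \<in> dist T" and u: "u \<in> Hom C Y M"
    and orth: "\<And>A x. A \<in> ?V \<Longrightarrow> x \<in> Hom C A (Cod C v) \<Longrightarrow> x = nul A (Cod C v)"
    using approx[OF _ M] by metis
  have univ: "\<exists>!g. g \<in> Hom C A Y \<and> u \<cdot> g = f" if A: "A \<in> ?V" and f: "f \<in> Hom C A M" for A f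
    using factorization_if_orthogonal_cone[OF t, unfolded Hom_Dom_Cod[OF u], OF f orth[OF A]
        orth[OF shift_closedD[OF Susp(4) A]]] .
  obtain s where s: "s \<in> Hom C M Y" "u \<cdot> s = Idt C M"
    using univ[OF MV Idt_Hom[OF M]] by blast
  have "u \<cdot> (s \<cdot> u) = u"
    using Hom_assoc[OF u s(1) u] s(2) Hom_Idt(2)[OF u] by simp
  moreover have "u \<cdot> Idt C Y = u"
    by (rule Hom_Idt(1)[OF u])
  \<comment> \<open>Both sides lift \<open>u\<close> along itself, and \<open>Y\<close> lies in
    \<open>Susp\<close>, so they agree by uniqueness.\<close>
  ultimately have "s \<cdot> u = Idt C Y"
    using univ[OF Y u] cmp_Hom[OF s(1) u] Idt_Hom[OF Hom_Ob(1)[OF u]] by blast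
  then have "is_iso C u"
    by (rule is_isoI[OF u s(1) _ s(2)])
  then have "is_Mcolim C T L f M"
    by (rule is_Mcolim_iso[OF Mcolim u])
  then show "\<exists>L f. (\<forall>i. L i \<in> fold_ext TYPE('u) C T \<S> i \<and> f i \<in> Hom C (L i) (L (Suc i))) \<and>
      is_Mcolim C T L f M"
    using L f by blast
qed

end

section \<open>From the derivator to its base\<close>

lemma small_cat_pt_cat:
  assumes "regular_universe TYPE('u)"
  shows "small_cat (pt_cat :: 'u scat)"
proof -
  have Ob: "Ob (pt_cat :: 'u scat) = {Nt 0}" and Ar: "Ar (pt_cat :: 'u scat) = {Pr (Nt 0) (Nt 0)}"
    unfolding ord_cat_def by auto
  have "is_cat (pt_cat :: 'u scat)"
    unfolding is_cat_def Hom_def Ob Ar by (simp add: ord_cat_def)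
  then show ?thesis
    unfolding small_cat_def Ob Ar by (simp add: countable_small[OF assms])
qed

theorem theorem12p3:
  fixes D :: "('u, 'o, 'm) prederivator"
    and T :: "('o, 'm) triangulation"
    and \<S> :: "'o set"
  assumes "regular_universe TYPE('u)"
    and "triangulated_derivator D"
    and "base_triangulation D T"
    and "has_small_coproducts TYPE('u) (base D)"
    and "small TYPE('u) \<S>"
    and "\<And>S. S \<in> \<S> \<Longrightarrow> compact_ob TYPE('u) (base D) T S"
  shows "left_aisle (base D) T (Susp TYPE('u) (base D) T \<S>)
    \<and> (\<forall>X \<in> Susp TYPE('u) (base D) T \<S>. \<exists>L f.
         (\<forall>i. L i \<in> fold_ext TYPE('u) (base D) T \<S> i \<and> f i \<in> Hom (base D) (L i) (L (Suc i)))
         \<and> is_Mcolim (base D) T L f X)"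
proof -
  interpret triangulated "base D" T
    using assms(3) by unfold_locales (simp add: base_triangulation_def)
  have "is_prederivator D"
    using assms(2) by (simp add: triangulated_derivator_def is_derivator_def)
  \<comment> \<open>A prederivator takes locally small values on small categories, and the point is
    one of these.\<close>
  then have "locally_small TYPE('u) (base D)"
    using small_cat_pt_cat[OF assms(1)] unfolding is_prederivator_def by blast
  then show ?thesis
    using Susp_left_aisle_and_Mcolim[OF assms(1,4) _ assms(5,6)] by blast
qed

end
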